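(* Let $\mathfrak A\subset\mathcal A^{\mathbb Z^D}$ be a subshift of finite type, let $(\mathcal G,+)$ be an abelian (topological) group, and let $d\in\{0,\dots,D\}$. (a) There is a natural isomorphism $\mathcal H^d_{\mathrm{inv}}(\mathfrak A,\mathcal G)\cong{}_\infty\mathcal H^d_{\mathrm{eq}}(\mathfrak A,\mathcal G)$. (b) If $\mathcal G$ is discrete, then ${}_\infty\mathcal H^d_{\mathrm{eq}}(\mathfrak A,\mathcal G)=\mathcal H^d_{\mathrm{eq}}(\mathfrak A,\mathcal G)$, so $\mathcal H^d_{\mathrm{inv}}(\mathfrak A,\mathcal G)\cong\mathcal H^d_{\mathrm{eq}}(\mathfrak A,\mathcal G)$. In particular, $\mathcal H^1_{\mathrm{inv}}(\mathfrak A,\mathcal G)\cong\mathcal H^1_{\mathrm{dy}}(\mathfrak A,\mathcal G)$.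
   Context: **Subshifts.** $\mathcal A$ is a finite alphabet; $\mathcal A^{\mathbb Z^D}$ carries the product topology; $\sigma^{\mathsf v}(\mathbf a)_{\mathsf z}=a_{\mathsf z+\mathsf v}$; a subshift is a closed shift-invariant subset. $\mathbb B(r)=\{-r,\dots,r\}^D$, $\mathbb B(\mathsf z,r)=\mathsf z+\mathbb B(r)$; $\mathfrak A_{\mathbb U}=\{\mathbf a_{\mathbb U}:\mathbf a\in\mathfrak A\}$, patterns on translates of $\mathbb U$ being identified with patterns on $\mathbb U$; $\mathfrak A_{(r)}=\mathfrak A_{\mathbb B(r)}$. $\mathfrak A$ is a subshift of finite type of radius $R>0$ if $\mathfrak A=\{\mathbf a:\mathbf a_{\mathbb B(\mathsf z,R)}\in\mathfrak A_{(R)}\ \forall\mathsf z\}$. **Equivariant cohomology.** $\mathbf Y$ is the canonical cell decomposition of $\mathbb R^D$ with vertex set $\mathbb Z^D$ and top cells the unit cubes $\mathsf z+[0,1]^D$; $\mathbf Y^d$ is its set of (oriented) $d$-cells, $\mathbb Z[\mathbf Y^d]$ the group of $d$-chains, $\partial_d$ the cubical boundary, $\Upsilon_d^{\mathsf z}$ translation by $\mathsf z$. $\mathcal C^d_{\mathrm{eq}}(\mathfrak A,\mathcal G)$ is the group of continuous $C:\mathbb Z[\mathbf Y^d]\times\mathfrak A\to\mathcal G$, additive in the first variable, with $C(\zeta,\sigma^{\mathsf z}(\mathbf a))=C(\Upsilon_d^{\mathsf z}(\zeta),\mathbf a)$; $\delta_dC(\zeta,\mathbf a)=C(\partial_{d+1}\zeta,\mathbf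 a)$; $\mathcal H^d_{\mathrm{eq}}(\mathfrak A,\mathcal G)=\ker\delta_d/\mathrm{image}(\delta_{d-1})$. Let $\mathbf Y_0^d$ be the set of $d$-cells $x=\bigcap_{i\in I}\{t\in[0,1]^D:t_i=0\}$, $|I|=D-d$; put $\partial_x\mathbb B(r)=\{\mathsf u\in\mathbb B(r):u_i<r\ \forall i\in I\}$. Every $y\in\mathbf Y^d$ is uniquely $\Upsilon_d^{\mathsf z}(x)$ with $x\in\mathbf Y_0^d$. $C\in\mathcal C^d_{\mathrm{eq}}$ is locally determined with radius $r$ if for each $x\in\mathbf Y_0^d$ there is $c_x:\mathfrak A_{\partial_x\mathbb B(r)}\to\mathcal G$ with $C(\Upsilon^{\mathsf z}_d(x),\mathbf a)=c_x(\mathbf a_{\mathsf z+\partial_x\mathbb B(r)})$ for all $\mathbf a\in\mathfrak A$, $\mathsf z\in\mathbb Z^D$. Let ${}_r\mathcal C^d_{\mathrm{eq}}$ be the group of these, and ${}_\infty\mathcal C^d_{\mathrm{eq}}=\bigcup_r{}_r\mathcal C^d_{\mathrm{eq}}$, which with $\delta$ is a cochain complex; ${}_\infty\mathcal H^d_{\mathrm{eq}}(\mathfrak A,\mathcal G)$ is its $d$th cohomology group. **Invariant cohomology.** For $1\le d\le D$ let $\partial_d^+\mathbb B(r)=\{\mathsf u\in\mathbb B(r):u_d>-r\}$, $\partial_d^-\mathbb B(r)=\{\mathsf u\in\mathbb B(r):u_d<r\}$. For $r\ge R$ the tile complex $\mathbf X_r$ is obtained from the disjoint union of unit $D$-cubes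 $\square_{\mathsf z}\mathbf c$ ($\mathsf z\in\mathbb Z^D$, $\mathbf c\in\mathfrak A_{(r)}$), $\square_{\mathsf z}\mathbf c$ a copy of $\mathsf z+[0,1]^D$, by gluing the upper face of $\square_{\mathsf z}\mathbf c$ orthogonal to $\mathsf e_d$ to the lower face of $\square_{\mathsf z+\mathsf e_d}\mathbf c'$ orthogonal to $\mathsf e_d$ whenever $\mathbf c_{\partial_d^+\mathbb B(r)}=\mathbf c'_{\partial_d^-\mathbb B(r)}$ (index sets identified by translation). $\mathbb Z^D$ acts on $\mathbf X_r$ by cellular homeomorphisms $\Xi^{\mathsf z}:\square_{\mathsf x}\mathbf c\to\square_{\mathsf x+\mathsf z}\mathbf c$. Let $\mathcal C^d_{\mathrm{inv}}(\mathbf X_r,\mathcal G)$ be the group of cellular $d$-cochains $C$ with $C\circ\Xi^{\mathsf z}=C$ for all $\mathsf z$; with the cellular coboundary these form a complex with cohomology $\mathcal H^d_{\mathrm{inv}}(\mathbf X_r,\mathcal G)$. The cellular maps $\zeta_r:\mathbf X_{r+1}\to\mathbf X_r$, $\square_{\mathsf z}\mathbf c\mapsto\square_{\mathsf z}\mathbf c_{\mathbb B(r)}$, induce $\mathcal H^d_{\mathrm{inv}}(\mathbf X_r,\mathcal G)\to\mathcal H^d_{\mathrm{inv}}(\mathbf X_{r+1},\mathcal G)$, and $\mathcal H^d_{\mathrm{inv}}(\mathfrak A,\mathcal G):=\varinjlim_{r\ge R}\mathcal H^d_{\mathrm{inv}}(\mathbf X_r,\mathcal G)$. **Dynamical cohomology.**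 $\mathcal H^1_{\mathrm{dy}}(\mathfrak A,\mathcal G)$ is the group of continuous $\widetilde C:\mathbb Z^D\times\mathfrak A\to\mathcal G$ with $\widetilde C(\mathsf y+\mathsf z,\mathbf a)=\widetilde C(\mathsf y,\sigma^{\mathsf z}(\mathbf a))+\widetilde C(\mathsf z,\mathbf a)$, modulo those of the form $\widetilde B(\sigma^{\mathsf z}(\mathbf a))-\widetilde B(\mathbf a)$ with $\widetilde B:\mathfrak A\to\mathcal G$ continuous. *)

theory Defs
  imports "HOL-Analysis.Analysis" "HOL-Algebra.Free_Abelian_Groups"
begin

section \<open>Subshifts\<close>

text \<open>
  The lattice \<open>\<int>\<^sup>D\<close> is \<open>int ^ 'n\<close> with \<open>D = CARD('n)\<close>; the linear order on \<open>'n\<close> is only used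
  to orient cells. The finite alphabet is the type \<open>'a\<close>, with the discrete topology.
\<close>

type_synonym ('n, 'a) config = "int ^ 'n \<Rightarrow> 'a"

definition config_topology :: "('n::finite, 'a) config topology" where
  "config_topology = product_topology (\<lambda>_. discrete_topology UNIV) UNIV"

definition shift :: "int ^ 'n::finite \<Rightarrow> ('n, 'a) config \<Rightarrow> ('n, 'a) config" where
  "shift v a = (\<lambda>z. a (z + v))"

definition subshift :: "('n::finite, 'a) config set \<Rightarrow> bool" where
  "subshift A \<longleftrightarrow> closedin config_topology A \<and> (\<forall>v. shift v ` A = A)"

definition cube_window :: "nat \<Rightarrow> (int ^ 'n::finite) set" where
  "cube_window r = {u. \<forall>i. - int r \<le> u $ i \<and> u $ i \<le> int r}"

text \<open>
  A pattern on \<open>U\<close> is a function restricted to \<open>U\<close> (with value \<open>undefined\<close> elsewhere). With patterns on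
  \<open>z + U\<close> identified with patterns on \<open>U\<close>, the pattern of \<open>a\<close> on \<open>z + U\<close> is
  \<open>restrict (shift z a) U\<close>.
\<close>

definition patterns :: "(int ^ 'n::finite) set \<Rightarrow> ('n, 'a) config set \<Rightarrow> ('n, 'a) config set" where
  "patterns U A = (\<lambda>a. restrict a U) ` A"

definition sft :: "nat \<Rightarrow> ('n::finite, 'a) config set \<Rightarrow> bool" where
  "sft R A \<longleftrightarrow> subshift A \<and> R > 0 \<and>
     A = {a. \<forall>z. restrict (shift z a) (cube_window R) \<in> patterns (cube_window R) A}"


section \<open>Cochain complexes and direct limits\<close>

text \<open>Cochains are functions extended by 0 outside their domain, so that addition is pointwise.\<close>

definition pointwise_group :: "('x \<Rightarrow> 'g::ab_group_add) set \<Rightarrow> ('x \<Rightarrow> 'g) monoid" where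
  "pointwise_group S = \<lparr>carrier = S, monoid.mult = (\<lambda>f g x. f x + g x), one = (\<lambda>x. 0)\<rparr>"

abbreviation int_chains :: "'x set \<Rightarrow> ('x \<Rightarrow>\<^sub>0 int) set" where
  "int_chains S \<equiv> carrier (free_Abelian_group S)"

definition push :: "('x \<Rightarrow> 'y) \<Rightarrow> ('x \<Rightarrow>\<^sub>0 int) \<Rightarrow> ('y \<Rightarrow>\<^sub>0 int)" where
  "push f = frag_extend (\<lambda>x. frag_of (f x))"

definition cochains :: "'x set \<Rightarrow> (('x \<Rightarrow>\<^sub>0 int) \<Rightarrow> 'g::ab_group_add) set" where
  "cochains S = {C. (\<forall>\<zeta>\<in>int_chains S. \<forall>\<xi>\<in>int_chains S. C (\<zeta> + \<xi>) = C \<zeta> + C \<xi>) \<and>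
                    (\<forall>\<zeta>. \<zeta> \<notin> int_chains S \<longrightarrow> C \<zeta> = 0)}"

definition pullback ::
    "'x set \<Rightarrow> (('x \<Rightarrow>\<^sub>0 int) \<Rightarrow> ('y \<Rightarrow>\<^sub>0 int)) \<Rightarrow> (('y \<Rightarrow>\<^sub>0 int) \<Rightarrow> 'g) \<Rightarrow> ('x \<Rightarrow>\<^sub>0 int) \<Rightarrow> 'g::ab_group_add"
  where "pullback S f C = (\<lambda>\<zeta>. if \<zeta> \<in> int_chains S then C (f \<zeta>) else 0)"

definition cocycles :: "(nat \<Rightarrow> 'c monoid) \<Rightarrow> (nat \<Rightarrow> 'c \<Rightarrow> 'c) \<Rightarrow> nat \<Rightarrow> 'c set" where
  "cocycles K \<delta> d = kernel (K d) (K (Suc d)) (\<delta> d)"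

definition coboundaries :: "(nat \<Rightarrow> 'c monoid) \<Rightarrow> (nat \<Rightarrow> 'c \<Rightarrow> 'c) \<Rightarrow> nat \<Rightarrow> 'c set" where
  "coboundaries K \<delta> d = (case d of 0 \<Rightarrow> {\<one>\<^bsub>K 0\<^esub>} | Suc e \<Rightarrow> \<delta> e ` carrier (K e))"

definition cohomology :: "(nat \<Rightarrow> 'c monoid) \<Rightarrow> (nat \<Rightarrow> 'c \<Rightarrow> 'c) \<Rightarrow> nat \<Rightarrow> 'c set monoid" where
  "cohomology K \<delta> d = (K d)\<lparr>carrier := cocycles K \<delta> d\<rparr> Mod coboundaries K \<delta> d"

text \<open>
  The map induced on cohomology classes (cosets) by a cochain map \<open>f\<close> into \<open>(K, \<delta>)\<close>: the coset
  \<open>B + x\<close> goes to \<open>B' + f x\<close>, which equals \<open>B' + f ` (B + x)\<close> because \<open>f\<close> maps \<open>B\<close> into \<open>B'\<close>.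
\<close>

definition cohomology_map ::
    "(nat \<Rightarrow> 'c monoid) \<Rightarrow> (nat \<Rightarrow> 'c \<Rightarrow> 'c) \<Rightarrow> nat \<Rightarrow> ('b \<Rightarrow> 'c) \<Rightarrow> 'b set \<Rightarrow> 'c set" where
  "cohomology_map K \<delta> d f X = coboundaries K \<delta> d <#>\<^bsub>K d\<^esub> f ` X"

text \<open>
  The direct limit of \<open>G R \<rightarrow> G (R + 1) \<rightarrow> \<dots>\<close> with bonding maps \<open>f r : G r \<rightarrow> G (r + 1)\<close>;
  \<open>bond f r k\<close> is the composite \<open>G r \<rightarrow> G (r + k)\<close>.
\<close>

primrec bond :: "(nat \<Rightarrow> 'x \<Rightarrow> 'x) \<Rightarrow> nat \<Rightarrow> nat \<Rightarrow> 'x \<Rightarrow> 'x" where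
  "bond f r 0 x = x"
| "bond f r (Suc k) x = f (r + k) (bond f r k x)"

definition limit_rel ::
    "nat \<Rightarrow> (nat \<Rightarrow> 'x monoid) \<Rightarrow> (nat \<Rightarrow> 'x \<Rightarrow> 'x) \<Rightarrow> ((nat \<times> 'x) \<times> (nat \<times> 'x)) set" where
  "limit_rel R G f = {((r, x), (s, y)). r \<ge> R \<and> s \<ge> R \<and> x \<in> carrier (G r) \<and> y \<in> carrier (G s) \<and>
     (\<exists>k l. r + k = s + l \<and> bond f r k x = bond f s l y)}"

definition direct_limit ::
    "nat \<Rightarrow> (nat \<Rightarrow> 'x monoid) \<Rightarrow> (nat \<Rightarrow> 'x \<Rightarrow> 'x) \<Rightarrow> (nat \<times> 'x) set monoid" where
  "direct_limit R G f =
     \<lparr>carrier = (SIGMA r:{R..}. carrier (G r)) // limit_rel R G f,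
      monoid.mult = (\<lambda>X Y. \<Union>(r, x)\<in>X. \<Union>(s, y)\<in>Y.
        let t = max r s in limit_rel R G f `` {(t, bond f r (t - r) x \<otimes>\<^bsub>G t\<^esub> bond f s (t - s) y)}),
      one = limit_rel R G f `` {(R, \<one>\<^bsub>G R\<^esub>)}\<rparr>"

text \<open>The map between direct limits induced by maps \<open>\<phi> r : G r \<rightarrow> G' (r + s)\<close>; \<open>rel'\<close> is the
  equivalence relation defining the target.\<close>

definition limit_map ::
    "((nat \<times> 'y) \<times> (nat \<times> 'y)) set \<Rightarrow> nat \<Rightarrow> (nat \<Rightarrow> 'x \<Rightarrow> 'y) \<Rightarrow> (nat \<times> 'x) set \<Rightarrow> (nat \<times> 'y) set"
  where "limit_map rel' s \<phi> X = rel' `` ((\<lambda>(r, x). (r + s, \<phi> r x)) ` X)"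


section \<open>The cubical decomposition of Euclidean space\<close>

text \<open>
  The pair \<open>(z, J)\<close> is the cell \<open>{t. z\<^sub>i \<le> t\<^sub>i \<le> z\<^sub>i + 1 for i \<in> J, t\<^sub>i = z\<^sub>i for i \<notin> J}\<close>, of dimension
  \<open>card J\<close>, oriented by the order on \<open>'n\<close>. It is the translate by \<open>z\<close> of the cell \<open>(0, J)\<close>, and the
  cells \<open>(0, J)\<close> are those in the intersection of hyperplanes \<open>t\<^sub>i = 0\<close>, \<open>i \<in> I = - J\<close>, with the unit cube.
\<close>

type_synonym 'n cell = "(int ^ 'n) \<times> 'n set"

definition cells :: "nat \<Rightarrow> 'n::finite cell set" where
  "cells d = {(z, J). card J = d}"

definition translate_cell :: "int ^ 'n::finite \<Rightarrow> 'n cell \<Rightarrow> 'n cell" where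
  "translate_cell v = (\<lambda>(z, J). (z + v, J))"

definition incidence_sign :: "'n::{finite,linorder} set \<Rightarrow> 'n \<Rightarrow> int" where
  "incidence_sign J j = (-1) ^ card {i \<in> J. i < j}"

definition cell_boundary :: "'n::{finite,linorder} cell \<Rightarrow> ('n cell \<Rightarrow>\<^sub>0 int)" where
  "cell_boundary = (\<lambda>(z, J). \<Sum>j\<in>J. frag_cmul (incidence_sign J j)
     (frag_of (z + axis j 1, J - {j}) - frag_of (z, J - {j})))"


section \<open>Equivariant cohomology\<close>

type_synonym ('n, 'a, 'g) eq_cochain = "('n cell \<Rightarrow>\<^sub>0 int) \<times> ('n, 'a) config \<Rightarrow> 'g"

definition eq_cochains ::
    "('n::finite, 'a) config set \<Rightarrow> nat \<Rightarrow> ('n, 'a, 'g::topological_ab_group_add) eq_cochain set" where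
  "eq_cochains A d = {C.
     continuous_map
       (prod_topology (discrete_topology (int_chains (cells d))) (subtopology config_topology A))
       euclidean C \<and>
     (\<forall>\<zeta>\<in>int_chains (cells d). \<forall>\<xi>\<in>int_chains (cells d). \<forall>a\<in>A. C (\<zeta> + \<xi>, a) = C (\<zeta>, a) + C (\<xi>, a)) \<and>
     (\<forall>\<zeta>\<in>int_chains (cells d). \<forall>a\<in>A. \<forall>z. C (\<zeta>, shift z a) = C (push (translate_cell z) \<zeta>, a)) \<and>
     (\<forall>p. p \<notin> int_chains (cells d) \<times> A \<longrightarrow> C p = 0)}"

definition eq_coboundary ::
    "nat \<Rightarrow> ('n::{finite,linorder}, 'a, 'g::ab_group_add) eq_cochain \<Rightarrow> ('n, 'a, 'g) eq_cochain" where
  "eq_coboundary d C =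
     (\<lambda>(\<zeta>, a). if \<zeta> \<in> int_chains (cells (Suc d)) then C (frag_extend cell_boundary \<zeta>, a) else 0)"

definition eq_cohomology ::
    "('n::{finite,linorder}, 'a) config set \<Rightarrow> nat \<Rightarrow>
     ('n, 'a, 'g::topological_ab_group_add) eq_cochain set monoid" where
  "eq_cohomology A = cohomology (\<lambda>d. pointwise_group (eq_cochains A d)) eq_coboundary"

text \<open>The set \<open>\<partial>\<^sub>x \<bbbB>(r)\<close> for the cell \<open>x = (0, J)\<close>.\<close>

definition cell_box :: "'n::finite set \<Rightarrow> nat \<Rightarrow> (int ^ 'n) set" where
  "cell_box J r = {u \<in> cube_window r. \<forall>i. i \<notin> J \<longrightarrow> u $ i < int r}"

definition locally_determined ::
    "('n::finite, 'a) config set \<Rightarrow> nat \<Rightarrow> nat \<Rightarrow> ('n, 'a, 'g) eq_cochain \<Rightarrow> bool" where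
  "locally_determined A d r C \<longleftrightarrow> (\<forall>J. card J = d \<longrightarrow>
     (\<exists>c. \<forall>a\<in>A. \<forall>z. C (frag_of (translate_cell z (0, J)), a)
                    = c (restrict (shift z a) (cell_box J r))))"

definition loc_cochains ::
    "('n::finite, 'a) config set \<Rightarrow> nat \<Rightarrow> ('n, 'a, 'g::topological_ab_group_add) eq_cochain set" where
  "loc_cochains A d = (\<Union>r. {C \<in> eq_cochains A d. locally_determined A d r C})"

definition loc_complex ::
    "('n::finite, 'a) config set \<Rightarrow> nat \<Rightarrow> ('n, 'a, 'g::topological_ab_group_add) eq_cochain monoid" where
  "loc_complex A d = pointwise_group (loc_cochains A d)"

definition loc_cohomology ::
    "('n::{finite,linorder}, 'a) config set \<Rightarrow> nat \<Rightarrow>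
     ('n, 'a, 'g::topological_ab_group_add) eq_cochain set monoid" where
  "loc_cohomology A = cohomology (loc_complex A) eq_coboundary"


section \<open>Invariant cohomology\<close>

text \<open>
  The quadruple \<open>(z, c, J, U)\<close>, with \<open>U\<close> disjoint from \<open>J\<close>, is the face of the cube
  \<open>z + [0,1]\<^sup>D\<close> labelled \<open>c\<close> spanned by the directions in \<open>J\<close> and lying at \<open>t\<^sub>i = z\<^sub>i + 1\<close> for
  \<open>i \<in> U\<close> and at \<open>t\<^sub>i = z\<^sub>i\<close> for all other \<open>i \<notin> J\<close>. Gluing the upper face orthogonal to \<open>e\<^sub>i\<close> of one
  cube to the lower face of the next identifies all faces contained in them, and the \<open>d\<close>-cells of
  the tile complex are the classes of the generated equivalence relation.
\<close>

type_synonym ('n, 'a) tile_face = "(int ^ 'n) \<times> ('n, 'a) config \<times> 'n set \<times> 'n set"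
type_synonym ('n, 'a) tile_cell = "('n, 'a) tile_face set"
type_synonym ('n, 'a, 'g) tile_cochain = "(('n, 'a) tile_cell \<Rightarrow>\<^sub>0 int) \<Rightarrow> 'g"

definition tile_faces :: "nat \<Rightarrow> ('n::finite, 'a) config set \<Rightarrow> nat \<Rightarrow> ('n, 'a) tile_face set" where
  "tile_faces r A d = {(z, c, J, U). c \<in> patterns (cube_window r) A \<and> card J = d \<and> J \<inter> U = {}}"

definition upper_box :: "'n::finite \<Rightarrow> nat \<Rightarrow> (int ^ 'n) set" where
  "upper_box i r = {u \<in> cube_window r. u $ i > - int r}"

text \<open>
  Equality of \<open>c\<close> on \<open>\<partial>\<^sub>i\<^sup>+ \<bbbB>(r)\<close> = \<open>upper_box i r\<close> and \<open>c'\<close> on \<open>\<partial>\<^sub>i\<^sup>- \<bbbB>(r)\<close> = \<open>{u \<in> cube_window r. u $ i < int r}\<close>, which is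
  the translate of \<open>upper_box i r\<close> by \<open>- axis i 1\<close>.
\<close>

definition matching :: "nat \<Rightarrow> 'n::finite \<Rightarrow> ('n, 'a) config \<Rightarrow> ('n, 'a) config \<Rightarrow> bool" where
  "matching r i c c' \<longleftrightarrow> (\<forall>u \<in> upper_box i r. c u = c' (u - axis i 1))"

definition glue_step ::
    "nat \<Rightarrow> ('n::finite, 'a) config set \<Rightarrow> (('n, 'a) tile_face \<times> ('n, 'a) tile_face) set" where
  "glue_step r A = {((z, c, J, U), (z + axis i 1, c', J, U - {i})) | z c c' J U i.
     c \<in> patterns (cube_window r) A \<and> c' \<in> patterns (cube_window r) A \<and> J \<inter> U = {} \<and> i \<in> U \<and> matching r i c c'}"

definition glue ::
    "nat \<Rightarrow> ('n::finite, 'a) config set \<Rightarrow> (('n, 'a) tile_face \<times> ('n, 'a) tile_face) set" where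
  "glue r A = (glue_step r A \<union> (glue_step r A)\<inverse>)\<^sup>*"

definition tile_cells :: "nat \<Rightarrow> ('n::finite, 'a) config set \<Rightarrow> nat \<Rightarrow> ('n, 'a) tile_cell set" where
  "tile_cells r A d = tile_faces r A d // glue r A"

text \<open>
  Maps between cells are defined on classes by mapping all members and saturating under the gluing
  relation; they are compatible with gluing, so the result is a single class. All members
  of a class have the same \<open>J\<close>.
\<close>

definition tile_dirs :: "('n::finite, 'a) tile_cell \<Rightarrow> 'n set" where
  "tile_dirs X = (\<Union>(z, c, J, U)\<in>X. J)"

definition lower_face :: "nat \<Rightarrow> ('n::finite, 'a) config set \<Rightarrow> 'n \<Rightarrow> ('n, 'a) tile_cell \<Rightarrow> ('n, 'a) tile_cell" where
  "lower_face r A j X = glue r A `` ((\<lambda>(z, c, J, U). (z, c, J - {j}, U)) ` X)"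

definition upper_face :: "nat \<Rightarrow> ('n::finite, 'a) config set \<Rightarrow> 'n \<Rightarrow> ('n, 'a) tile_cell \<Rightarrow> ('n, 'a) tile_cell" where
  "upper_face r A j X = glue r A `` ((\<lambda>(z, c, J, U). (z, c, J - {j}, insert j U)) ` X)"

definition tile_boundary ::
    "nat \<Rightarrow> ('n::{finite,linorder}, 'a) config set \<Rightarrow> ('n, 'a) tile_cell \<Rightarrow> (('n, 'a) tile_cell \<Rightarrow>\<^sub>0 int)" where
  "tile_boundary r A X = (\<Sum>j\<in>tile_dirs X. frag_cmul (incidence_sign (tile_dirs X) j)
     (frag_of (upper_face r A j X) - frag_of (lower_face r A j X)))"

definition tile_shift :: "int ^ 'n::finite \<Rightarrow> ('n, 'a) tile_cell \<Rightarrow> ('n, 'a) tile_cell" where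
  "tile_shift v X = (\<lambda>(z, c, J, U). (z + v, c, J, U)) ` X"

definition inv_cochains ::
    "nat \<Rightarrow> ('n::finite, 'a) config set \<Rightarrow> nat \<Rightarrow> ('n, 'a, 'g::ab_group_add) tile_cochain set" where
  "inv_cochains r A d = {C \<in> cochains (tile_cells r A d).
     \<forall>z. \<forall>\<zeta>\<in>int_chains (tile_cells r A d). C (push (tile_shift z) \<zeta>) = C \<zeta>}"

definition inv_complex ::
    "nat \<Rightarrow> ('n::finite, 'a) config set \<Rightarrow> nat \<Rightarrow> ('n, 'a, 'g::ab_group_add) tile_cochain monoid" where
  "inv_complex r A d = pointwise_group (inv_cochains r A d)"

definition inv_coboundary ::
    "nat \<Rightarrow> ('n::{finite,linorder}, 'a) config set \<Rightarrow> nat \<Rightarrow>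
     ('n, 'a, 'g::ab_group_add) tile_cochain \<Rightarrow> ('n, 'a, 'g) tile_cochain" where
  "inv_coboundary r A d = pullback (tile_cells r A (Suc d)) (frag_extend (tile_boundary r A))"

definition tile_cohomology ::
    "nat \<Rightarrow> ('n::{finite,linorder}, 'a) config set \<Rightarrow> nat \<Rightarrow>
     ('n, 'a, 'g::ab_group_add) tile_cochain set monoid" where
  "tile_cohomology r A = cohomology (inv_complex r A) (inv_coboundary r A)"

definition tile_restrict :: "nat \<Rightarrow> ('n::finite, 'a) config set \<Rightarrow> ('n, 'a) tile_cell \<Rightarrow> ('n, 'a) tile_cell" where
  "tile_restrict r A X = glue r A `` ((\<lambda>(z, c, J, U). (z, restrict c (cube_window r), J, U)) ` X)"

definition tile_bond ::
    "('n::{finite,linorder}, 'a) config set \<Rightarrow> nat \<Rightarrow> nat \<Rightarrow>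
     ('n, 'a, 'g::ab_group_add) tile_cochain set \<Rightarrow> ('n, 'a, 'g) tile_cochain set" where
  "tile_bond A d r = cohomology_map (inv_complex (Suc r) A) (inv_coboundary (Suc r) A) d
     (pullback (tile_cells (Suc r) A d) (push (tile_restrict r A)))"

type_synonym ('n, 'a, 'g) inv_class = "(nat \<times> ('n, 'a, 'g) tile_cochain set) set"

definition inv_cohomology ::
    "nat \<Rightarrow> ('n::{finite,linorder}, 'a) config set \<Rightarrow> nat \<Rightarrow> ('n, 'a, 'g::ab_group_add) inv_class monoid" where
  "inv_cohomology R A d = direct_limit R (\<lambda>r. tile_cohomology r A d) (tile_bond A d)"


section \<open>Dynamical cohomology\<close>

type_synonym ('n, 'a, 'g) dy_cochain = "(int ^ 'n) \<times> ('n, 'a) config \<Rightarrow> 'g"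

definition dy_cocycles ::
    "('n::finite, 'a) config set \<Rightarrow> ('n, 'a, 'g::topological_ab_group_add) dy_cochain set" where
  "dy_cocycles A = {C.
     continuous_map (prod_topology (discrete_topology UNIV) (subtopology config_topology A)) euclidean C \<and>
     (\<forall>y z. \<forall>a\<in>A. C (y + z, a) = C (y, shift z a) + C (z, a)) \<and>
     (\<forall>z a. a \<notin> A \<longrightarrow> C (z, a) = 0)}"

definition dy_coboundaries ::
    "('n::finite, 'a) config set \<Rightarrow> ('n, 'a, 'g::topological_ab_group_add) dy_cochain set" where
  "dy_coboundaries A = {\<lambda>(z, a). if a \<in> A then B (shift z a) - B a else 0 | B.
     continuous_map (subtopology config_topology A) euclidean B}"

definition dy_cohomology ::
    "('n::finite, 'a) config set \<Rightarrow> ('n, 'a, 'g::topological_ab_group_add) dy_cochain set monoid" where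
  "dy_cohomology A = pointwise_group (dy_cocycles A) Mod dy_coboundaries A"


section \<open>The comparison map and functoriality\<close>

text \<open>
  A configuration \<open>a\<close> determines the section of the tile complex over Euclidean space that sends the
  cube \<open>z + [0,1]\<^sup>D\<close> to its copy labelled by the pattern of \<open>a\<close> around \<open>z\<close>. Pulling an
  invariant cochain back along these sections gives an equivariant cochain, and this induces the comparison
  map (all members of the direct-limit class give the same result, so the union is a single class).
\<close>

definition tile_section ::
    "nat \<Rightarrow> ('n::finite, 'a) config set \<Rightarrow> ('n, 'a) config \<Rightarrow> 'n cell \<Rightarrow> ('n, 'a) tile_cell" where
  "tile_section r A a = (\<lambda>(z, J). glue r A `` {(z, restrict (shift z a) (cube_window r), J, {})})"

definition section_pullback ::
    "('n::finite, 'a) config set \<Rightarrow> nat \<Rightarrow> nat \<Rightarrow>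
     ('n, 'a, 'g::ab_group_add) tile_cochain \<Rightarrow> ('n, 'a, 'g) eq_cochain" where
  "section_pullback A d r C =
     (\<lambda>(\<zeta>, a). if \<zeta> \<in> int_chains (cells d) \<and> a \<in> A then C (push (tile_section r A a) \<zeta>) else 0)"

definition comparison ::
    "('n::{finite,linorder}, 'a) config set \<Rightarrow> nat \<Rightarrow>
     ('n, 'a, 'g::topological_ab_group_add) inv_class \<Rightarrow> ('n, 'a, 'g) eq_cochain set" where
  "comparison A d X =
     (\<Union>(r, x)\<in>X. cohomology_map (loc_complex A) eq_coboundary d (section_pullback A d r) x)"

definition coefficient_hom ::
    "('g::topological_ab_group_add \<Rightarrow> 'h::topological_ab_group_add) \<Rightarrow> bool" where
  "coefficient_hom h \<longleftrightarrow> continuous_on UNIV h \<and> (\<forall>x y. h (x + y) = h x + h y)"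

definition loc_coeff_map ::
    "('n::{finite,linorder}, 'a) config set \<Rightarrow> nat \<Rightarrow>
     ('g::topological_ab_group_add \<Rightarrow> 'h::topological_ab_group_add) \<Rightarrow>
     ('n, 'a, 'g) eq_cochain set \<Rightarrow> ('n, 'a, 'h) eq_cochain set" where
  "loc_coeff_map A d h = cohomology_map (loc_complex A) eq_coboundary d (\<lambda>C. h \<circ> C)"

definition inv_coeff_map ::
    "nat \<Rightarrow> ('n::{finite,linorder}, 'a) config set \<Rightarrow> nat \<Rightarrow> ('g::ab_group_add \<Rightarrow> 'h::ab_group_add) \<Rightarrow>
     ('n, 'a, 'g) inv_class \<Rightarrow> ('n, 'a, 'h) inv_class" where
  "inv_coeff_map R A d h =
     limit_map (limit_rel R (\<lambda>r. tile_cohomology r A d) (tile_bond A d)) 0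
       (\<lambda>r. cohomology_map (inv_complex r A) (inv_coboundary r A) d (\<lambda>C. h \<circ> C))"

text \<open>Morphisms of subshifts over the same lattice, and the radius of the associated local rule.\<close>

definition subshift_morphism ::
    "('n::finite, 'a) config set \<Rightarrow> ('n, 'b) config set \<Rightarrow> (('n, 'a) config \<Rightarrow> ('n, 'b) config) \<Rightarrow> bool" where
  "subshift_morphism A A' F \<longleftrightarrow>
     continuous_map (subtopology config_topology A) (subtopology config_topology A') F \<and>
     (\<forall>a\<in>A. \<forall>z. F (shift z a) = shift z (F a))"

definition rule_radius ::
    "('n::finite, 'a) config set \<Rightarrow> (('n, 'a) config \<Rightarrow> ('n, 'b) config) \<Rightarrow> nat \<Rightarrow> bool" where
  "rule_radius A F s \<longleftrightarrow>
     (\<forall>a\<in>A. \<forall>b\<in>A. restrict a (cube_window s) = restrict b (cube_window s) \<longrightarrow> F a 0 = F b 0)"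

definition loc_pullback ::
    "('n::{finite,linorder}, 'a) config set \<Rightarrow> nat \<Rightarrow> (('n, 'a) config \<Rightarrow> ('n, 'b) config) \<Rightarrow>
     ('n, 'b, 'g::topological_ab_group_add) eq_cochain set \<Rightarrow> ('n, 'a, 'g) eq_cochain set" where
  "loc_pullback A d F = cohomology_map (loc_complex A) eq_coboundary d
     (\<lambda>C (\<zeta>, a). if \<zeta> \<in> int_chains (cells d) \<and> a \<in> A then C (\<zeta>, F a) else 0)"

text \<open>A morphism with a local rule of radius \<open>s\<close> induces a cellular map from the tile complex of radius
  \<open>r + s\<close> of \<open>A\<close> to the one of radius \<open>r\<close> of \<open>A'\<close>, by applying the rule to the labels of the cubes.\<close>

definition tile_map ::
    "('n::finite, 'a) config set \<Rightarrow> ('n, 'b) config set \<Rightarrow> (('n, 'a) config \<Rightarrow> ('n, 'b) config) \<Rightarrow>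
     nat \<Rightarrow> nat \<Rightarrow> ('n, 'a) tile_cell \<Rightarrow> ('n, 'b) tile_cell" where
  "tile_map A A' F s r X = glue r A' ``
     {(z, restrict (F a) (cube_window r), J, U) | z a J U. a \<in> A \<and> (z, restrict a (cube_window (r + s)), J, U) \<in> X}"

definition inv_pullback ::
    "nat \<Rightarrow> ('n::{finite,linorder}, 'a) config set \<Rightarrow> ('n, 'b) config set \<Rightarrow> nat \<Rightarrow>
     (('n, 'a) config \<Rightarrow> ('n, 'b) config) \<Rightarrow> nat \<Rightarrow>
     ('n, 'b, 'g::ab_group_add) inv_class \<Rightarrow> ('n, 'a, 'g) inv_class" where
  "inv_pullback R A A' d F s =
     limit_map (limit_rel R (\<lambda>r. tile_cohomology r A d) (tile_bond A d)) s
       (\<lambda>r. cohomology_map (inv_complex (r + s) A) (inv_coboundary (r + s) A) d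
         (pullback (tile_cells (r + s) A d) (push (tile_map A A' F s r))))"

end

theory Submission
  imports Defs
begin

text \<open>
  An invariant cochain on the tile complex of radius \<open>r\<close> is pulled back along the sections of the
  tile complex given by configurations. Every cell of the tile complex lies on such a section, so this
  embeds the invariant cochains into the locally determined equivariant ones, compatibly with the
  coboundaries and with the maps between tile complexes. The labels of glued faces agree on the box that
  belongs to their common cell; hence every cochain that is locally determined with radius \<open>r\<close> lies in
  the image at radius \<open>r\<close>, and that image consists of cochains locally determined with radius \<open>r + 1\<close>.
  The complex of locally determined cochains is therefore the increasing union of the invariant
  complexes, and its cohomology is the direct limit of theirs.

  For discrete coefficients a continuous function on a compact subshift depends on a finite window, so all
  equivariant cochains are locally determined. In degree one, an equivariant cocycle restricted to a
  configuration has a potential on the lattice; the differences of this potential form a dynamical cocycle.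
\<close>

text \<open>The obstacle is the gluing relation: it is generated by single steps through admissible
  labels, so it is awkward to decide when two faces become the same cell. Only two one-sided facts
  enter. A step preserves the label on a box attached to the face, and labels read off a single
  configuration always match. The gap between these facts costs one unit of radius, which the union
  over all radii absorbs.

  Calculations on classes are avoided as far as possible. Pulling back along sections is injective,
  so an identity between invariant cochains (vanishing of the squared coboundary, commutation with
  the maps between tile complexes) is checked after pulling back, where cells are pairs
  \<open>(z, J)\<close> and the boundary is explicit. The passage to cohomology is then pure
  algebra: a cocycle of an increasing union, and likewise a primitive of a coboundary, already
  appears at a finite stage.\<close>

section \<open>Direct limits and maps of cochain complexes\<close>

text \<open>A compatible family is an isomorphism on the limit once it is jointly surjective and
  elements with equal images merge at some later stage. The elements of \<open>H\<close> are sets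
  because the map on a class is formed as a union over its members; these all have the same image,
  so the union is that image.\<close>

lemma direct_limit_iso:
  fixes G :: "nat \<Rightarrow> 'x monoid" and H :: "'y set monoid"
  assumes G: "\<And>r. R \<le> r \<Longrightarrow> group (G r)"
    and f: "\<And>r. R \<le> r \<Longrightarrow> f r \<in> hom (G r) (G (Suc r))"
    and \<phi>: "\<And>r. R \<le> r \<Longrightarrow> \<phi> r \<in> hom (G r) H"
    and compat: "\<And>r x. R \<le> r \<Longrightarrow> x \<in> carrier (G r) \<Longrightarrow> \<phi> (Suc r) (f r x) = \<phi> r x"
    and surj: "\<And>y. y \<in> carrier H \<Longrightarrow> \<exists>r\<ge>R. y \<in> \<phi> r ` carrier (G r)"
    and inj: "\<And>r s x y. R \<le> r \<Longrightarrow> R \<le> s \<Longrightarrow> x \<in> carrier (G r) \<Longrightarrow> y \<in> carrier (G s) \<Longrightarrow>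
      \<phi> r x = \<phi> s y \<Longrightarrow> \<exists>k l. r + k = s + l \<and> bond f r k x = bond f s l y"
  shows "(\<lambda>X. \<Union>(r, x)\<in>X. \<phi> r x) \<in> iso (direct_limit R G f) H"
    and "\<And>r x. R \<le> r \<Longrightarrow> x \<in> carrier (G r) \<Longrightarrow>
      (\<Union>(s, y)\<in>limit_rel R G f `` {(r, x)}. \<phi> s y) = \<phi> r x"
proof -
  have bond: "bond f r k x \<in> carrier (G (r + k)) \<and> \<phi> (r + k) (bond f r k x) = \<phi> r x"
    if "R \<le> r" "x \<in> carrier (G r)" for r k x
  proof (induction k)
    case (Suc k)
    have "f (r + k) (bond f r k x) \<in> carrier (G (Suc (r + k)))"
      using Suc f[of "r + k"] that by (auto simp: hom_def)
    then show ?case using Suc compat[of "r + k"] that by simp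
  qed (use that in auto)
  \<comment> \<open>The identifications in the limit form the kernel relation of \<open>\<phi>\<close>, so transitivity and
    well-definedness are automatic.\<close>
  have rel: "limit_rel R G f = {((r, x), (s, y)). r \<ge> R \<and> s \<ge> R \<and> x \<in> carrier (G r) \<and>
      y \<in> carrier (G s) \<and> \<phi> r x = \<phi> s y}" (is "_ = ?E")
  proof -
    have "\<phi> r x = \<phi> s y" if "r \<ge> R" "s \<ge> R" "x \<in> carrier (G r)" "y \<in> carrier (G s)"
      "r + k = s + l" "bond f r k x = bond f s l y" for r s x y k l
      using bond[of r x k] bond[of s y l] that by auto
    then show ?thesis unfolding limit_rel_def using inj by blast
  qed
  let ?\<Phi> = "\<lambda>X. \<Union>(r, x)\<in>X. \<phi> r x"
  let ?c = "\<lambda>r x. limit_rel R G f `` {(r, x)}"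
  show val: "?\<Phi> (?c r x) = \<phi> r x" if "R \<le> r" "x \<in> carrier (G r)" for r x
    unfolding rel using that by force
  have carr: "carrier (direct_limit R G f) = {?c r x | r x. R \<le> r \<and> x \<in> carrier (G r)}"
    by (auto simp: direct_limit_def quotient_def)
  have cls_eq: "?c r x = ?c s y \<longleftrightarrow> \<phi> r x = \<phi> s y"
    if "R \<le> r" "x \<in> carrier (G r)" "R \<le> s" "y \<in> carrier (G s)" for r s x y
  proof
    assume "?c r x = ?c s y"
    then have "?\<Phi> (?c r x) = ?\<Phi> (?c s y)" by simp
    then show "\<phi> r x = \<phi> s y" using val that by simp
  next
    assume "\<phi> r x = \<phi> s y"
    then show "?c r x = ?c s y" unfolding rel using that by auto
  qed
  have mult: "\<exists>u z. R \<le> u \<and> z \<in> carrier (G u) \<and> ?c r x \<otimes>\<^bsub>direct_limit R G f\<^esub> ?c s y = ?c u z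
      \<and> \<phi> u z = \<phi> r x \<otimes>\<^bsub>H\<^esub> \<phi> s y"
    if "R \<le> r" "x \<in> carrier (G r)" "R \<le> s" "y \<in> carrier (G s)" for r s x y
  proof -
    \<comment> \<open>The pair \<open>g p q\<close> is the representative of the product that the
      limit attaches to \<open>p\<close> and \<open>q\<close>. The multiplication takes a union over
      all choices, so the class must be seen not to depend on them.\<close>
    define g where "g = (\<lambda>(r, x) (s, y). let t = max r s in
      (t, bond f r (t - r) x \<otimes>\<^bsub>G t\<^esub> bond f s (t - s) y))"
    have g: "\<exists>t z. g (r', x') (s', y') = (t, z) \<and> R \<le> t \<and> z \<in> carrier (G t) \<and>
        \<phi> t z = \<phi> r x \<otimes>\<^bsub>H\<^esub> \<phi> s y"
      if "(r', x') \<in> ?c r x" "(s', y') \<in> ?c s y" for r' x' s' y'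
    proof -
      define t where "t = max r' s'"
      have 1: "R \<le> r'" "R \<le> s'" "x' \<in> carrier (G r')" "y' \<in> carrier (G s')"
        "\<phi> r' x' = \<phi> r x" "\<phi> s' y' = \<phi> s y" using that unfolding rel by auto
      have 2: "R \<le> t" "t = r' + (t - r')" "t = s' + (t - s')" using 1 by (auto simp: t_def)
      define a b where "a = bond f r' (t - r') x'" and "b = bond f s' (t - s') y'"
      have ab: "a \<in> carrier (G t)" "b \<in> carrier (G t)" "\<phi> t a = \<phi> r x" "\<phi> t b = \<phi> s y"
        using bond[of r' x' "t - r'"] bond[of s' y' "t - s'"] 1 2 by (auto simp: a_def b_def)
      interpret Gt: group "G t" by (rule G) fact
      have "a \<otimes>\<^bsub>G t\<^esub> b \<in> carrier (G t)" "\<phi> t (a \<otimes>\<^bsub>G t\<^esub> b) = \<phi> r x \<otimes>\<^bsub>H\<^esub> \<phi> s y"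
        using ab \<phi>[OF 2(1)] by (auto simp: hom_def)
      then show ?thesis using 2(1)
        by (auto simp: g_def Let_def simp flip: t_def a_def b_def)
    qed
    have mem: "(r, x) \<in> ?c r x" "(s, y) \<in> ?c s y" using that by (auto simp: rel)
    obtain u z where uz: "g (r, x) (s, y) = (u, z)" "R \<le> u" "z \<in> carrier (G u)"
        "\<phi> u z = \<phi> r x \<otimes>\<^bsub>H\<^esub> \<phi> s y"
      using g[OF mem] by blast
    \<comment> \<open>Classes are determined by their value under \<open>\<phi>\<close>, and that
      value is the same for all representatives of the two factors.\<close>
    have same: "limit_rel R G f `` {g p q} = ?c u z" if pq_in: "p \<in> ?c r x" "q \<in> ?c s y" for p q
    proof -
      obtain r' x' s' y' where pq: "p = (r', x')" "q = (s', y')" by (cases p, cases q) auto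
      obtain t w where "g p q = (t, w)" "R \<le> t" "w \<in> carrier (G t)"
        "\<phi> t w = \<phi> r x \<otimes>\<^bsub>H\<^esub> \<phi> s y"
        using g[of r' x' s' y'] pq_in unfolding pq by blast
      then show ?thesis
        using uz cls_eq[of t w u z] by simp
    qed
    have "?c r x \<otimes>\<^bsub>direct_limit R G f\<^esub> ?c s y
        = (\<Union>p\<in>?c r x. \<Union>q\<in>?c s y. limit_rel R G f `` {g p q})"
      by (simp add: direct_limit_def g_def Let_def case_prod_beta)
    also have "\<dots> = ?c u z"
      using same mem by blast
    finally show ?thesis using uz by blast
  qed
  show "?\<Phi> \<in> iso (direct_limit R G f) H"
    unfolding iso_def
  proof (intro CollectI conjI)
    show "?\<Phi> \<in> hom (direct_limit R G f) H"
    proof (rule homI)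
      fix X assume "X \<in> carrier (direct_limit R G f)"
      then obtain r x where X: "R \<le> r" "x \<in> carrier (G r)" "X = ?c r x" unfolding carr by blast
      then show "?\<Phi> X \<in> carrier H" using val \<phi>[of r] by (auto simp: hom_def)
    next
      fix X Y assume "X \<in> carrier (direct_limit R G f)" "Y \<in> carrier (direct_limit R G f)"
      then obtain r x s y where X: "R \<le> r" "x \<in> carrier (G r)" "X = ?c r x"
        and Y: "R \<le> s" "y \<in> carrier (G s)" "Y = ?c s y" unfolding carr by blast
      obtain u z where "R \<le> u" "z \<in> carrier (G u)" "X \<otimes>\<^bsub>direct_limit R G f\<^esub> Y = ?c u z"
        "\<phi> u z = \<phi> r x \<otimes>\<^bsub>H\<^esub> \<phi> s y" using mult X Y by metis
      then show "?\<Phi> (X \<otimes>\<^bsub>direct_limit R G f\<^esub> Y) = ?\<Phi> X \<otimes>\<^bsub>H\<^esub> ?\<Phi> Y"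
        using val X Y by simp
    qed
    show "bij_betw ?\<Phi> (carrier (direct_limit R G f)) (carrier H)"
    proof (rule bij_betw_imageI)
      show "inj_on ?\<Phi> (carrier (direct_limit R G f))"
        unfolding carr using val cls_eq by (fastforce intro!: inj_onI)
      have "?\<Phi> ` carrier (direct_limit R G f) \<subseteq> carrier H"
        unfolding carr using val \<phi> by (fastforce simp: hom_def)
      moreover have "y \<in> ?\<Phi> ` carrier (direct_limit R G f)" if y: "y \<in> carrier H" for y
      proof -
        obtain r x where r: "r \<ge> R" "x \<in> carrier (G r)" "y = \<phi> r x" using surj[OF y] by blast
        then show ?thesis unfolding carr
          by (intro rev_image_eqI[of "?c r x"]) (use val in auto)
      qed
      ultimately show "?\<Phi> ` carrier (direct_limit R G f) = carrier H" by blast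
    qed
  qed
qed

locale cochain_complex =
  fixes K :: "nat \<Rightarrow> 'c monoid" and \<delta> :: "nat \<Rightarrow> 'c \<Rightarrow> 'c"
  assumes comm_group: "comm_group (K d)"
    and hom: "\<delta> d \<in> hom (K d) (K (Suc d))"
    and square_zero: "x \<in> carrier (K d) \<Longrightarrow> \<delta> (Suc d) (\<delta> d x) = \<one>\<^bsub>K (Suc (Suc d))\<^esub>"
begin

definition cls :: "nat \<Rightarrow> 'c \<Rightarrow> 'c set" where
  "cls d x = coboundaries K \<delta> d #>\<^bsub>K d\<^esub> x"

lemma group: "group (K d)"
  using comm_group by (simp add: comm_group_def)

lemma group_hom: "group_hom (K d) (K (Suc d)) (\<delta> d)"
  using group hom by (simp add: group_hom_def group_hom_axioms_def)

lemma cocycles_iff: "x \<in> cocycles K \<delta> d \<longleftrightarrow> x \<in> carrier (K d) \<and> \<delta> d x = \<one>\<^bsub>K (Suc d)\<^esub>"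
  by (simp add: cocycles_def kernel_def)

lemma subgroup_cocycles: "subgroup (cocycles K \<delta> d) (K d)"
  unfolding cocycles_def by (rule group_hom.subgroup_kernel[OF group_hom])

lemma coboundaries_Suc: "coboundaries K \<delta> (Suc d) = \<delta> d ` carrier (K d)"
  by (simp add: coboundaries_def)

lemma subgroup_coboundaries: "subgroup (coboundaries K \<delta> d) (K d)"
proof (cases d)
  case 0
  then show ?thesis
    using group.triv_subgroup[OF group, of 0] by (simp add: coboundaries_def)
next
  case (Suc e)
  then show ?thesis
    using group_hom.img_is_subgroup[OF group_hom, of e] by (simp add: coboundaries_Suc)
qed

lemma coboundaries_subset_cocycles: "coboundaries K \<delta> d \<subseteq> cocycles K \<delta> d"
proof (cases d)
  case 0
  then show ?thesis using subgroup.one_closed[OF subgroup_cocycles, of 0]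
    by (simp add: coboundaries_def)
next
  case (Suc e)
  then show ?thesis
    using square_zero hom[of e] by (auto simp: coboundaries_Suc cocycles_iff hom_def)
qed

lemma cocycle_group: "comm_group ((K d)\<lparr>carrier := cocycles K \<delta> d\<rparr>)"
proof (rule group.group_comm_groupI)
  show "Group.group ((K d)\<lparr>carrier := cocycles K \<delta> d\<rparr>)"
    by (rule subgroup.subgroup_is_group[OF subgroup_cocycles group])
qed (use comm_monoid.m_comm[OF comm_group.axioms(1)[OF comm_group]] in
    \<open>auto simp: cocycles_iff\<close>)

lemma coboundaries_subgroup_cocycles:
  "subgroup (coboundaries K \<delta> d) ((K d)\<lparr>carrier := cocycles K \<delta> d\<rparr>)"
  using group.subgroup_incl[OF group subgroup_coboundaries subgroup_cocycles
      coboundaries_subset_cocycles] .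

lemma normal_coboundaries:
  "coboundaries K \<delta> d \<lhd> (K d)\<lparr>carrier := cocycles K \<delta> d\<rparr>"
  by (rule comm_group.subgroup_imp_normal[OF cocycle_group coboundaries_subgroup_cocycles])

lemma group_cohomology: "group (cohomology K \<delta> d)"
  unfolding cohomology_def by (rule normal.factorgroup_is_group[OF normal_coboundaries])

lemma cls_hom: "cls d \<in> hom ((K d)\<lparr>carrier := cocycles K \<delta> d\<rparr>) (cohomology K \<delta> d)"
proof -
  \<comment> \<open>Shrinking the carrier to the cocycles leaves multiplication unchanged, so cosets
    in \<open>K d\<close> and in the group of cocycles are the same sets.\<close>
  have "cls d = (\<lambda>a. coboundaries K \<delta> d #>\<^bsub>(K d)\<lparr>carrier := cocycles K \<delta> d\<rparr>\<^esub> a)"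
    by (simp add: cls_def r_coset_def fun_eq_iff)
  then show ?thesis
    unfolding cohomology_def using normal.r_coset_hom_Mod[OF normal_coboundaries] by simp
qed

lemma carrier_cohomology: "carrier (cohomology K \<delta> d) = cls d ` cocycles K \<delta> d"
  by (simp add: cohomology_def carrier_FactGroup cls_def r_coset_def)

lemma cls_eq_iff:
  assumes "x \<in> carrier (K d)" "y \<in> carrier (K d)"
  shows "cls d x = cls d y \<longleftrightarrow> x \<otimes>\<^bsub>K d\<^esub> inv\<^bsub>K d\<^esub> y \<in> coboundaries K \<delta> d"
proof -
  interpret group "K d" by (rule group)
  have "cls d x = cls d y \<longleftrightarrow> x \<in> cls d y"
    using assms repr_independence[OF _ assms(2) subgroup_coboundaries]
      rcos_self[OF assms(1) subgroup_coboundaries] by (auto simp: cls_def)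
  also have "\<dots> \<longleftrightarrow> x \<otimes>\<^bsub>K d\<^esub> inv\<^bsub>K d\<^esub> y \<in> coboundaries K \<delta> d"
    unfolding cls_def
    using subgroup.rcos_module[OF subgroup_coboundaries is_group assms(2,1)] .
  finally show ?thesis .
qed

end

locale cochain_map = source: cochain_complex K \<delta> + target: cochain_complex K' \<delta>'
  for K :: "nat \<Rightarrow> 'b monoid" and \<delta> and K' :: "nat \<Rightarrow> 'c monoid" and \<delta>' +
  fixes f :: "nat \<Rightarrow> 'b \<Rightarrow> 'c"
  assumes map_hom: "f d \<in> hom (K d) (K' d)"
    and commutes: "x \<in> carrier (K d) \<Longrightarrow> f (Suc d) (\<delta> d x) = \<delta>' d (f d x)"
begin

lemma map_group_hom: "group_hom (K d) (K' d) (f d)"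
  using source.group target.group map_hom by (simp add: group_hom_def group_hom_axioms_def)

lemma map_cocycle: "x \<in> cocycles K \<delta> d \<Longrightarrow> f d x \<in> cocycles K' \<delta>' d"
  using map_hom[of d] commutes[of x d] group_hom.hom_one[OF map_group_hom, of "Suc d"]
  by (auto simp: source.cocycles_iff target.cocycles_iff hom_def)

lemma map_coboundary:
  assumes "x \<in> coboundaries K \<delta> d" shows "f d x \<in> coboundaries K' \<delta>' d"
proof (cases d)
  case 0
  then show ?thesis using assms group_hom.hom_one[OF map_group_hom, of 0]
    by (simp add: coboundaries_def)
next
  case (Suc e)
  then show ?thesis using assms map_hom[of e] commutes[of _ e]
    by (auto simp: source.coboundaries_Suc target.coboundaries_Suc hom_def)
qed

text \<open>Since \<open>f d\<close> carries coboundaries to coboundaries, adding target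
  coboundaries to the image of a whole coset gives a single coset. Later computations with induced
  maps can therefore be made on one cocycle.\<close>

lemma cohomology_map_cls:
  assumes x: "x \<in> cocycles K \<delta> d"
  shows "cohomology_map K' \<delta>' d (f d) (source.cls d x) = target.cls d (f d x)"
proof -
  interpret S: group "K d" by (rule source.group)
  interpret T: group "K' d" by (rule target.group)
  interpret B: subgroup "coboundaries K' \<delta>' d" "K' d" by (rule target.subgroup_coboundaries)
  have xc: "x \<in> carrier (K d)" using x by (simp add: source.cocycles_iff)
  then have fx: "f d x \<in> carrier (K' d)" using map_hom[of d] by (auto simp: hom_def)
  have Bc: "b \<in> carrier (K d)" if "b \<in> coboundaries K \<delta> d" for b
    using that subgroup.subset[OF source.subgroup_coboundaries] by blast
  have fb: "f d (b \<otimes>\<^bsub>K d\<^esub> x) = f d b \<otimes>\<^bsub>K' d\<^esub> f d x" if "b \<in> coboundaries K \<delta> d" for b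
    using hom_mult[OF map_hom Bc[OF that] xc] .
  show ?thesis
  proof (intro equalityI subsetI)
    fix y assume "y \<in> cohomology_map K' \<delta>' d (f d) (source.cls d x)"
    then obtain b b' where b: "b \<in> coboundaries K \<delta> d" "b' \<in> coboundaries K' \<delta>' d"
      "y = b' \<otimes>\<^bsub>K' d\<^esub> f d (b \<otimes>\<^bsub>K d\<^esub> x)"
      by (auto simp: cohomology_map_def source.cls_def set_mult_def r_coset_def)
    note fb' = map_coboundary[OF b(1)]
    have "y = (b' \<otimes>\<^bsub>K' d\<^esub> f d b) \<otimes>\<^bsub>K' d\<^esub> f d x"
      using b fb fb' fx by (simp add: T.m_assoc)
    then show "y \<in> target.cls d (f d x)"
      using b fb' by (auto simp: target.cls_def r_coset_def)
  next
    fix y assume "y \<in> target.cls d (f d x)"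
    then obtain b' where b': "b' \<in> coboundaries K' \<delta>' d" "y = b' \<otimes>\<^bsub>K' d\<^esub> f d x"
      by (auto simp: target.cls_def r_coset_def)
    have "x \<in> source.cls d x"
      unfolding source.cls_def by (rule S.rcos_self[OF xc source.subgroup_coboundaries])
    then show "y \<in> cohomology_map K' \<delta>' d (f d) (source.cls d x)"
      using b' by (auto simp: cohomology_map_def set_mult_def)
  qed
qed

lemma cohomology_map_hom:
  "cohomology_map K' \<delta>' d (f d) \<in> hom (cohomology K \<delta> d) (cohomology K' \<delta>' d)"
proof (rule homI)
  fix X assume "X \<in> carrier (cohomology K \<delta> d)"
  then show "cohomology_map K' \<delta>' d (f d) X \<in> carrier (cohomology K' \<delta>' d)"
    using cohomology_map_cls map_cocycle
    by (auto simp: source.carrier_cohomology target.carrier_cohomology)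
next
  fix X Y assume "X \<in> carrier (cohomology K \<delta> d)" "Y \<in> carrier (cohomology K \<delta> d)"
  then obtain x y where x: "x \<in> cocycles K \<delta> d" "X = source.cls d x"
    and y: "y \<in> cocycles K \<delta> d" "Y = source.cls d y"
    by (auto simp: source.carrier_cohomology)
  have xy: "x \<otimes>\<^bsub>K d\<^esub> y \<in> cocycles K \<delta> d"
    using subgroup.m_closed[OF source.subgroup_cocycles x(1) y(1)] .
  have "f d (x \<otimes>\<^bsub>K d\<^esub> y) = f d x \<otimes>\<^bsub>K' d\<^esub> f d y"
    using x y by (intro hom_mult[OF map_hom]) (auto simp: source.cocycles_iff)
  moreover have "source.cls d (x \<otimes>\<^bsub>K d\<^esub> y) = X \<otimes>\<^bsub>cohomology K \<delta> d\<^esub> Y"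
    using hom_mult[OF source.cls_hom, of x d y] x y by simp
  moreover have "target.cls d (f d x \<otimes>\<^bsub>K' d\<^esub> f d y)
      = target.cls d (f d x) \<otimes>\<^bsub>cohomology K' \<delta>' d\<^esub> target.cls d (f d y)"
    using hom_mult[OF target.cls_hom, of "f d x" d "f d y"] x y map_cocycle by simp
  ultimately show "cohomology_map K' \<delta>' d (f d) (X \<otimes>\<^bsub>cohomology K \<delta> d\<^esub> Y)
      = cohomology_map K' \<delta>' d (f d) X \<otimes>\<^bsub>cohomology K' \<delta>' d\<^esub> cohomology_map K' \<delta>' d (f d) Y"
    using cohomology_map_cls x y xy by metis
qed

end

text \<open>This is the algebraic form of a complex \<open>L\<close> that is an increasing union of
  subcomplexes: \<open>\<Psi> r\<close> are the inclusions and \<open>\<beta> r\<close> the steps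
  between them. \<open>R\<close> marks the stage at which the direct system starts.\<close>

locale exhausting_complexes =
  fixes K :: "nat \<Rightarrow> nat \<Rightarrow> 'b monoid" and \<delta> and L :: "nat \<Rightarrow> 'c monoid" and \<delta>'
    and \<beta> \<Psi> and R :: nat
  assumes embedding: "cochain_map (K r) (\<delta> r) L \<delta>' (\<Psi> r)"
    and bonding: "cochain_map (K r) (\<delta> r) (K (Suc r)) (\<delta> (Suc r)) (\<beta> r)"
    and compatible: "x \<in> carrier (K r d) \<Longrightarrow> \<Psi> (Suc r) d (\<beta> r d x) = \<Psi> r d x"
    and injective: "inj_on (\<Psi> r d) (carrier (K r d))"
    and exhausting: "y \<in> carrier (L d) \<Longrightarrow> \<exists>r\<ge>R. y \<in> \<Psi> r d ` carrier (K r d)"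
begin

sublocale \<Psi>: cochain_map "K r" "\<delta> r" L \<delta>' "\<Psi> r" for r by (rule embedding)
sublocale \<beta>: cochain_map "K r" "\<delta> r" "K (Suc r)" "\<delta> (Suc r)" "\<beta> r" for r by (rule bonding)

abbreviation Hmap :: "nat \<Rightarrow> nat \<Rightarrow> 'b set \<Rightarrow> 'b set" where
  "Hmap d r \<equiv> cohomology_map (K (Suc r)) (\<delta> (Suc r)) d (\<beta> r d)"

abbreviation limit_cls :: "nat \<Rightarrow> nat \<Rightarrow> 'b \<Rightarrow> (nat \<times> 'b set) set" where
  "limit_cls d r x \<equiv> limit_rel R (\<lambda>r. cohomology (K r) (\<delta> r) d) (Hmap d) `` {(r, \<Psi>.source.cls r d x)}"

lemma bond_carrier:
  "x \<in> carrier (K r d) \<Longrightarrow>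
    bond (\<lambda>r. \<beta> r d) r k x \<in> carrier (K (r + k) d) \<and>
    \<Psi> (r + k) d (bond (\<lambda>r. \<beta> r d) r k x) = \<Psi> r d x"
proof (induction k)
  case (Suc k)
  then show ?case using \<beta>.map_hom[of "r + k" d] compatible by (auto simp: hom_def)
qed auto

lemma bond_cocycle:
  "x \<in> cocycles (K r) (\<delta> r) d \<Longrightarrow>
    bond (\<lambda>r. \<beta> r d) r k x \<in> cocycles (K (r + k)) (\<delta> (r + k)) d \<and>
    bond (Hmap d) r k (\<Psi>.source.cls r d x) = \<Psi>.source.cls (r + k) d (bond (\<lambda>r. \<beta> r d) r k x)"
proof (induction k)
  case (Suc k)
  then show ?case
    using \<beta>.map_cocycle[of _ "r + k" d] \<beta>.cohomology_map_cls[of _ "r + k" d] by simp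
qed auto

text \<open>If cocycles from stages \<open>r\<close> and \<open>s\<close> become cohomologous in
  \<open>L\<close>, the coboundary separating them comes from a third stage \<open>t\<close>. Beyond
  all three stages injectivity of \<open>\<Psi>\<close> makes the relation hold inside the
  system.\<close>

lemma limit_injective:
  assumes x: "x \<in> cocycles (K r) (\<delta> r) d" and y: "y \<in> cocycles (K s) (\<delta> s) d"
    and eq: "\<Psi>.target.cls d (\<Psi> r d x) = \<Psi>.target.cls d (\<Psi> s d y)"
  shows "\<exists>k l. r + k = s + l \<and>
    bond (Hmap d) r k (\<Psi>.source.cls r d x) = bond (Hmap d) s l (\<Psi>.source.cls s d y)"
proof -
  have car: "\<Psi> r d x \<in> carrier (L d)" "\<Psi> s d y \<in> carrier (L d)"
    using x y \<Psi>.map_hom by (auto simp: hom_def \<Psi>.source.cocycles_iff)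
  have B: "\<Psi> r d x \<otimes>\<^bsub>L d\<^esub> inv\<^bsub>L d\<^esub> \<Psi> s d y \<in> coboundaries L \<delta>' d"
    using eq \<Psi>.target.cls_eq_iff car by simp
  \<comment> \<open>In degree 0 the coboundary group is trivial and any stage serves; in higher
    degree a primitive \<open>l\<close> lies in \<open>L\<close> and hence comes from some
    stage.\<close>
  have "\<exists>t. \<exists>b\<in>coboundaries (K t) (\<delta> t) d. \<Psi> r d x \<otimes>\<^bsub>L d\<^esub> inv\<^bsub>L d\<^esub> \<Psi> s d y = \<Psi> t d b"
  proof (cases d)
    case 0
    then show ?thesis using B group_hom.hom_one[OF \<Psi>.map_group_hom, of _ 0]
      by (auto simp: coboundaries_def)
  next
    case (Suc e)
    then obtain l where l: "l \<in> carrier (L e)"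
      "\<Psi> r d x \<otimes>\<^bsub>L d\<^esub> inv\<^bsub>L d\<^esub> \<Psi> s d y = \<delta>' e l"
      using B by (auto simp: \<Psi>.target.coboundaries_Suc)
    then obtain t w where "w \<in> carrier (K t e)" "l = \<Psi> t e w" using exhausting by blast
    then show ?thesis using l \<Psi>.commutes[of w t e] Suc
      by (intro exI[of _ t] bexI[of _ "\<delta> t e w"]) (auto simp: \<Psi>.source.coboundaries_Suc)
  qed
  then obtain t b where b: "b \<in> coboundaries (K t) (\<delta> t) d"
    "\<Psi> r d x \<otimes>\<^bsub>L d\<^esub> inv\<^bsub>L d\<^esub> \<Psi> s d y = \<Psi> t d b" by blast
  \<comment> \<open>The sum of the three stages, rather than their maximum, is reached from each of
    them by an explicit number of bonding maps.\<close>
  define u where "u = r + s + t"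
  define x' y' b' where "x' = bond (\<lambda>r. \<beta> r d) r (s + t) x" and "y' = bond (\<lambda>r. \<beta> r d) s (r + t) y"
    and "b' = bond (\<lambda>r. \<beta> r d) t (r + s) b"
  have u: "r + (s + t) = u" "s + (r + t) = u" "t + (r + s) = u" by (auto simp: u_def)
  have bc: "b \<in> carrier (K t d)"
    using b subgroup.subset[OF \<Psi>.source.subgroup_coboundaries] by blast
  have b'': "bond (\<lambda>r. \<beta> r d) t k b \<in> coboundaries (K (t + k)) (\<delta> (t + k)) d" for k
  proof (induction k)
    case (Suc k) then show ?case using \<beta>.map_coboundary[of _ "t + k" d] by simp
  qed (use b in auto)
  have x': "x' \<in> carrier (K u d)" "\<Psi> u d x' = \<Psi> r d x"
    and y': "y' \<in> carrier (K u d)" "\<Psi> u d y' = \<Psi> s d y"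
    and b': "b' \<in> carrier (K u d)" "\<Psi> u d b' = \<Psi> t d b" "b' \<in> coboundaries (K u) (\<delta> u) d"
    using bond_carrier[of x r d "s + t"] bond_carrier[of y s d "r + t"] bond_carrier[of b t d "r + s"]
      x y bc b''[of "r + s"]
    by (simp_all add: x'_def y'_def b'_def u \<Psi>.source.cocycles_iff)
  interpret Ku: group "K u d" by (rule \<Psi>.source.group)
  interpret h: group_hom "K u d" "L d" "\<Psi> u d" by (rule \<Psi>.map_group_hom)
  have "\<Psi> u d (x' \<otimes>\<^bsub>K u d\<^esub> inv\<^bsub>K u d\<^esub> y') = \<Psi> u d b'"
    using x' y' b' b by simp
  then have "x' \<otimes>\<^bsub>K u d\<^esub> inv\<^bsub>K u d\<^esub> y' = b'"
    by (rule inj_onD[OF injective]) (use x' y' b' in auto)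
  then have "\<Psi>.source.cls u d x' = \<Psi>.source.cls u d y'"
    using x' y' b' \<Psi>.source.cls_eq_iff by simp
  then have "bond (Hmap d) r (s + t) (\<Psi>.source.cls r d x) = bond (Hmap d) s (r + t) (\<Psi>.source.cls s d y)"
    using bond_cocycle[OF x, of "s + t"] bond_cocycle[OF y, of "r + t"]
    by (simp add: x'_def y'_def u)
  then show ?thesis
    by (intro exI[of _ "s + t"] exI[of _ "r + t"]) simp
qed

lemma cohomology_map_limit:
  shows "(\<lambda>X. \<Union>(r, x)\<in>X. cohomology_map L \<delta>' d (\<Psi> r d) x)
      \<in> iso (direct_limit R (\<lambda>r. cohomology (K r) (\<delta> r) d) (Hmap d)) (cohomology L \<delta>' d)" (is ?iso)
    and "\<And>r x. R \<le> r \<Longrightarrow> x \<in> cocycles (K r) (\<delta> r) d \<Longrightarrow>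
      (\<Union>(s, y)\<in>limit_cls d r x. cohomology_map L \<delta>' d (\<Psi> s d) y) = \<Psi>.target.cls d (\<Psi> r d x)"
proof -
  have surj: "\<exists>r\<ge>R. Y \<in> cohomology_map L \<delta>' d (\<Psi> r d) ` carrier (cohomology (K r) (\<delta> r) d)"
    if Y: "Y \<in> carrier (cohomology L \<delta>' d)" for Y
  proof -
    obtain y where y: "y \<in> cocycles L \<delta>' d" "Y = \<Psi>.target.cls d y"
      using Y by (auto simp: \<Psi>.target.carrier_cohomology)
    obtain r x where r: "r \<ge> R" "x \<in> carrier (K r d)" "y = \<Psi> r d x"
      using exhausting[of y d] y by (auto simp: \<Psi>.target.cocycles_iff)
    \<comment> \<open>The preimage of a cocycle is a cocycle because \<open>\<Psi> r\<close> is also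
      injective one degree higher.\<close>
    have "\<Psi> r (Suc d) (\<delta> r d x) = \<one>\<^bsub>L (Suc d)\<^esub>"
      using y r \<Psi>.commutes[of x r d] by (simp add: \<Psi>.target.cocycles_iff)
    also have "\<dots> = \<Psi> r (Suc d) \<one>\<^bsub>K r (Suc d)\<^esub>"
      using group_hom.hom_one[OF \<Psi>.map_group_hom] by metis
    finally have "\<delta> r d x = \<one>\<^bsub>K r (Suc d)\<^esub>"
      using injective[of r "Suc d"] \<Psi>.source.hom[of r d] r group.is_monoid[OF \<Psi>.source.group]
      by (auto dest!: inj_onD simp: hom_def intro: monoid.one_closed)
    then have "x \<in> cocycles (K r) (\<delta> r) d" using r by (simp add: \<Psi>.source.cocycles_iff)
    then show ?thesis using r y \<Psi>.cohomology_map_cls[of x r d]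
      by (auto simp: \<Psi>.source.carrier_cohomology)
  qed
  have compat: "cohomology_map L \<delta>' d (\<Psi> (Suc r) d) (Hmap d r X) = cohomology_map L \<delta>' d (\<Psi> r d) X"
    if "X \<in> carrier (cohomology (K r) (\<delta> r) d)" for r X
    using that \<beta>.map_cocycle compatible
    by (auto simp: \<Psi>.source.carrier_cohomology \<beta>.cohomology_map_cls \<Psi>.cohomology_map_cls
        \<Psi>.source.cocycles_iff)
  have inj: "\<exists>k l. r + k = s + l \<and> bond (Hmap d) r k X = bond (Hmap d) s l Y"
    if "X \<in> carrier (cohomology (K r) (\<delta> r) d)" "Y \<in> carrier (cohomology (K s) (\<delta> s) d)"
      "cohomology_map L \<delta>' d (\<Psi> r d) X = cohomology_map L \<delta>' d (\<Psi> s d) Y" for r s X Y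
    using that limit_injective
    by (auto simp: \<Psi>.source.carrier_cohomology \<Psi>.cohomology_map_cls)
  note lim = direct_limit_iso[of R "\<lambda>r. cohomology (K r) (\<delta> r) d" "Hmap d"
      "\<lambda>r. cohomology_map L \<delta>' d (\<Psi> r d)" "cohomology L \<delta>' d",
      OF \<Psi>.source.group_cohomology \<beta>.cohomology_map_hom \<Psi>.cohomology_map_hom compat surj inj]
  show ?iso by (rule lim(1))
  show "(\<Union>(s, y)\<in>limit_cls d r x. cohomology_map L \<delta>' d (\<Psi> s d) y) = \<Psi>.target.cls d (\<Psi> r d x)"
    if "R \<le> r" "x \<in> cocycles (K r) (\<delta> r) d" for r x
  proof -
    have "(\<Union>(s, y)\<in>limit_cls d r x. cohomology_map L \<delta>' d (\<Psi> s d) y)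
        = cohomology_map L \<delta>' d (\<Psi> r d) (\<Psi>.source.cls r d x)"
      by (rule lim(2)) (use that in \<open>auto simp: \<Psi>.source.carrier_cohomology\<close>)
    then show ?thesis using that \<Psi>.cohomology_map_cls by simp
  qed
qed

end

section \<open>Chains, windows and equivariant cochains\<close>

lemma int_chains_diff: "\<zeta> \<in> int_chains S \<Longrightarrow> \<xi> \<in> int_chains S \<Longrightarrow> \<zeta> - \<xi> \<in> int_chains S"
  using keys_diff by fastforce

lemma int_chains_add: "\<zeta> \<in> int_chains S \<Longrightarrow> \<xi> \<in> int_chains S \<Longrightarrow> \<zeta> + \<xi> \<in> int_chains S"
  using Poly_Mapping.keys_add by fastforce

lemma int_chains_cmul: "\<zeta> \<in> int_chains S \<Longrightarrow> frag_cmul k \<zeta> \<in> int_chains S"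
  by auto

lemma int_chains_frag_extend:
  assumes "\<And>x. x \<in> S \<Longrightarrow> b x \<in> int_chains T" "\<zeta> \<in> int_chains S"
  shows "frag_extend b \<zeta> \<in> int_chains T"
  using assms keys_frag_extend[of b \<zeta>] by fastforce

lemma frag_extend_eqI:
  assumes "\<And>x. x \<in> S \<Longrightarrow> f x = g x" "\<zeta> \<in> int_chains S"
  shows "frag_extend f \<zeta> = frag_extend g \<zeta>"
  using assms by (intro frag_extend_eq) auto

lemma push_frag_of [simp]: "push f (frag_of x) = frag_of (f x)"
  by (simp add: push_def)

lemma int_chains_push: "f ` S \<subseteq> T \<Longrightarrow> \<zeta> \<in> int_chains S \<Longrightarrow> push f \<zeta> \<in> int_chains T"
  unfolding push_def by (rule int_chains_frag_extend) auto

lemma frag_extend_frag_extend: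
  "frag_extend f (frag_extend g \<zeta>) = frag_extend (\<lambda>x. frag_extend f (g x)) \<zeta>"
  by (induction \<zeta> rule: frag_induction[OF subset_UNIV]) (auto simp: frag_extend_diff)

lemma frag_extend_push: "frag_extend f (push g \<zeta>) = frag_extend (\<lambda>x. f (g x)) \<zeta>"
  by (simp add: push_def frag_extend_frag_extend)

lemma push_push: "push f (push g \<zeta>) = push (\<lambda>x. f (g x)) \<zeta>"
  unfolding push_def[of f] frag_extend_push by (simp add: push_def)

lemma push_eqI:
  assumes "\<And>x. x \<in> S \<Longrightarrow> f x = g x" "\<zeta> \<in> int_chains S"
  shows "push f \<zeta> = push g \<zeta>"
  unfolding push_def using assms by (intro frag_extend_eqI) auto

text \<open>Additivity is demanded only on chains supported in \<open>S\<close>, because cochains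
  are set to 0 on all other chains and may fail to be additive there.\<close>

definition additive_on :: "'x set \<Rightarrow> (('x \<Rightarrow>\<^sub>0 int) \<Rightarrow> 'g::ab_group_add) \<Rightarrow> bool" where
  "additive_on S C \<longleftrightarrow> (\<forall>\<zeta>\<in>int_chains S. \<forall>\<xi>\<in>int_chains S. C (\<zeta> + \<xi>) = C \<zeta> + C \<xi>)"

lemma additive_on_zero: "additive_on S C \<Longrightarrow> C 0 = 0"
  unfolding additive_on_def by (metis add_0 add_cancel_left_left carrier_free_Abelian_group_iff
      empty_subsetI keys_zero)

lemma additive_on_diff:
  assumes "additive_on S C" "\<zeta> \<in> int_chains S" "\<xi> \<in> int_chains S"
  shows "C (\<zeta> - \<xi>) = C \<zeta> - C \<xi>"
proof -
  have "C (\<zeta> - \<xi> + \<xi>) = C (\<zeta> - \<xi>) + C \<xi>"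
    using assms int_chains_diff unfolding additive_on_def by blast
  then show ?thesis by simp
qed

lemma additive_on_eqI:
  assumes "additive_on S C" "additive_on S C'"
    and "\<And>x. x \<in> S \<Longrightarrow> C (frag_of x) = C' (frag_of x)" and "\<zeta> \<in> int_chains S"
  shows "C \<zeta> = C' \<zeta>"
proof -
  have "Poly_Mapping.keys \<zeta> \<subseteq> S" using assms(4) by simp
  then show ?thesis
    by (induction \<zeta> rule: free_Abelian_group_induct)
      (use assms in \<open>auto simp: additive_on_zero additive_on_diff\<close>)
qed

lemma additive_on_frag_extend:
  assumes "additive_on T C" "\<And>x. x \<in> S \<Longrightarrow> b x \<in> int_chains T"
  shows "additive_on S (\<lambda>\<zeta>. C (frag_extend b \<zeta>))"
  unfolding additive_on_def
proof (intro ballI)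
  fix \<zeta> \<xi> assume "\<zeta> \<in> int_chains S" "\<xi> \<in> int_chains S"
  then have "frag_extend b \<zeta> \<in> int_chains T" "frag_extend b \<xi> \<in> int_chains T"
    using int_chains_frag_extend[of S b T] assms(2) by blast+
  then show "C (frag_extend b (\<zeta> + \<xi>)) = C (frag_extend b \<zeta>) + C (frag_extend b \<xi>)"
    using assms(1) by (simp only: additive_on_def frag_extend_add)
qed

lemma additive_on_push:
  assumes "additive_on T C" "f ` S \<subseteq> T"
  shows "additive_on S (\<lambda>\<zeta>. C (push f \<zeta>))"
  unfolding push_def using assms by (intro additive_on_frag_extend) auto

lemma additive_on_cong:
  assumes "additive_on S C" "\<And>\<zeta>. \<zeta> \<in> int_chains S \<Longrightarrow> C \<zeta> = C' \<zeta>"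
  shows "additive_on S C'"
  unfolding additive_on_def
proof (intro ballI)
  fix \<zeta> \<xi> assume z: "\<zeta> \<in> int_chains S" "\<xi> \<in> int_chains S"
  have "C (\<zeta> + \<xi>) = C \<zeta> + C \<xi>" using assms(1) z unfolding additive_on_def by blast
  then show "C' (\<zeta> + \<xi>) = C' \<zeta> + C' \<xi>"
    using assms(2)[OF z(1)] assms(2)[OF z(2)] assms(2)[OF int_chains_add[OF z]] by simp
qed

lemma additive_on_minus:
  "additive_on S C \<Longrightarrow> additive_on S C' \<Longrightarrow> additive_on S (\<lambda>\<zeta>. C \<zeta> - C' \<zeta>)"
  unfolding additive_on_def by simp

text \<open>The choice is not vacuous, by the universal property of free Abelian groups.\<close>

definition chain_lift :: "('x \<Rightarrow> 'g::ab_group_add) \<Rightarrow> ('x \<Rightarrow>\<^sub>0 int) \<Rightarrow> 'g" where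
  "chain_lift v = (SOME h. additive_on UNIV h \<and> (\<forall>x. h (frag_of x) = v x))"

lemma chain_lift:
  shows additive_on_chain_lift: "additive_on S (chain_lift v)"
    and chain_lift_frag_of [simp]: "chain_lift v (frag_of x) = v x"
proof -
  \<comment> \<open>The universal property speaks of explicit group structures, so the type-class
    group is repackaged as one.\<close>
  define G :: "'b monoid" where "G = \<lparr>carrier = UNIV, monoid.mult = (+), one = 0\<rparr>"
  interpret comm_group G
    by (rule comm_groupI) (auto simp: G_def algebra_simps intro: exI[of _ "- x" for x])
  obtain h where h: "h \<in> Group.hom (free_Abelian_group UNIV) G" "\<And>x. h (frag_of x) = v x"
    by (rule free_Abelian_group_universal[of v UNIV]) (auto simp: G_def)
  have "additive_on UNIV h \<and> (\<forall>x. h (frag_of x) = v x)"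
    using h by (auto simp: additive_on_def Group.hom_def G_def)
  then have "additive_on UNIV (chain_lift v) \<and> (\<forall>x. chain_lift v (frag_of x) = v x)"
    unfolding chain_lift_def
    by (rule someI[of "\<lambda>h. additive_on UNIV h \<and> (\<forall>x. h (frag_of x) = v x)" h])
  then show "additive_on S (chain_lift v)" "chain_lift v (frag_of x) = v x"
    by (auto simp: additive_on_def)
qed

section \<open>Shifts, windows and continuity on the configuration space\<close>

lemma shift_shift: "shift u (shift v a) = shift (u + v) a"
  by (simp add: shift_def algebra_simps)

lemma shift_zero [simp]: "shift 0 a = a"
  by (simp add: shift_def)

lemma shift_in: "subshift A \<Longrightarrow> a \<in> A \<Longrightarrow> shift v a \<in> A"
  unfolding subshift_def by blast

lemma restrict_eq_iff: "restrict a W = restrict b W \<longleftrightarrow> (\<forall>w\<in>W. a w = b w)"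
  by (auto simp: restrict_def fun_eq_iff)

lemma cells_iff [simp]: "(z, J) \<in> cells d \<longleftrightarrow> card J = d"
  by (simp add: cells_def)

lemma finite_cube_window: "finite (cube_window r :: (int ^ 'n::finite) set)"
proof (rule finite_subset)
  show "(cube_window r :: (int ^ 'n) set) \<subseteq> vec_lambda ` PiE UNIV (\<lambda>_. {- int r..int r})"
  proof
    fix u :: "int ^ 'n" assume "u \<in> cube_window r"
    then show "u \<in> vec_lambda ` PiE UNIV (\<lambda>_. {- int r..int r})"
      by (intro image_eqI[of _ _ "vec_nth u"]) (auto simp: cube_window_def)
  qed
qed (auto intro!: finite_imageI finite_PiE)

lemma cube_window_mono: "r \<le> s \<Longrightarrow> cube_window r \<subseteq> cube_window s"
  unfolding cube_window_def by (clarsimp, meson neg_le_iff_le of_nat_mono order_trans)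

lemma finite_subset_cube_window:
  assumes "finite (W :: (int ^ 'n::finite) set)" shows "\<exists>r. W \<subseteq> cube_window r"
  using assms
proof induction
  case (insert u W)
  then obtain r where r: "W \<subseteq> cube_window r" by blast
  define s where "s = nat (\<Sum>i\<in>UNIV. \<bar>u $ i\<bar>)"
  have "\<bar>u $ i\<bar> \<le> int s" for i
  proof -
    have "\<bar>u $ i\<bar> \<le> (\<Sum>i\<in>UNIV. \<bar>u $ i\<bar>)" by (rule member_le_sum) auto
    then show ?thesis by (simp add: s_def)
  qed
  then have "u \<in> cube_window s" by (auto simp: cube_window_def abs_le_iff) (metis minus_le_iff)
  then show ?case
    using r cube_window_mono[of r "max r s"] cube_window_mono[of s "max r s"]
    by (intro exI[of _ "max r s"]) auto
qed simp

lemma topspace_config_topology [simp]: "topspace config_topology = UNIV"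
  by (simp add: config_topology_def)

lemma openin_cylinder:
  assumes "finite W" shows "openin config_topology {b. \<forall>w\<in>W. b w = a w}"
proof -
  have eq: "{b. \<forall>w\<in>W. b w = a w} = PiE UNIV (\<lambda>w. if w \<in> W then {a w} else UNIV)"
    by (auto simp: PiE_def Pi_def split: if_splits)
  have "finite {w. (if w \<in> W then {a w} else UNIV) \<noteq> UNIV}"
    by (rule finite_subset[OF _ assms]) auto
  then show ?thesis
    unfolding eq config_topology_def by (subst openin_PiE_gen) auto
qed

text \<open>A function that reads only finitely many sites is constant on open cylinders, so every
  preimage is open whatever the topology of the target. Pullbacks of invariant cochains get their
  continuity from here.\<close>

lemma continuous_map_window:
  assumes "finite W" and "\<And>a b. a \<in> A \<Longrightarrow> b \<in> A \<Longrightarrow> \<forall>w\<in>W. b w = a w \<Longrightarrow> f b = f a"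
  shows "continuous_map (subtopology config_topology A) euclidean f"
  unfolding continuous_map
proof (intro conjI allI impI)
  fix U :: "'c set"
  have "\<exists>T. openin (subtopology config_topology A) T \<and> a \<in> T \<and> T \<subseteq> {x \<in> A. f x \<in> U}"
    if "a \<in> A" "f a \<in> U" for a
  proof (intro exI conjI)
    show "openin (subtopology config_topology A) (A \<inter> {b. \<forall>w\<in>W. b w = a w})"
      by (intro openin_subtopology_Int2 openin_cylinder assms)
    show "A \<inter> {b. \<forall>w\<in>W. b w = a w} \<subseteq> {x \<in> A. f x \<in> U}"
    proof
      fix b assume "b \<in> A \<inter> {b. \<forall>w\<in>W. b w = a w}"
      then show "b \<in> {x \<in> A. f x \<in> U}" using that assms(2)[of a b] by simp
    qed
  qed (use that in auto)
  then show "openin (subtopology config_topology A) {x \<in> topspace (subtopology config_topology A). f x \<in> U}"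
    by (subst openin_subopen) auto
qed auto

lemma continuous_map_shift:
  assumes "subshift A"
  shows "continuous_map (subtopology config_topology A) (subtopology config_topology A) (shift z)"
proof -
  have "continuous_map config_topology config_topology (shift z)"
    unfolding shift_def config_topology_def
    by (subst continuous_map_componentwise_UNIV) (auto intro: continuous_map_product_projection)
  then show ?thesis
    using shift_in[OF assms]
    by (auto simp: continuous_map_in_subtopology intro: continuous_map_from_subtopology)
qed

lemma compactin_subshift:
  fixes A :: "('n::finite, 'a::finite) config set"
  assumes "subshift A" shows "compactin config_topology A"
proof (rule closedin_compact_space)
  show "compact_space (config_topology :: ('n, 'a) config topology)"
    unfolding config_topology_def
    by (simp add: compact_space_product_topology compact_space_discrete_topology)
qed (use assms in \<open>simp add: subshift_def\<close>)

text \<open>Around each configuration \<open>f\<close> is constant on a cylinder because singletons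
  are open. By compactness finitely many cylinders cover \<open>A\<close>, and one window contains
  the sites of all of them.\<close>

lemma continuous_map_discrete_window:
  fixes A :: "('n::finite, 'a::finite) config set" and f :: "_ \<Rightarrow> 'g::topological_space"
  assumes A: "subshift A" and f: "continuous_map (subtopology config_topology A) euclidean f"
    and discrete: "\<And>S :: 'g set. open S"
  obtains r where "\<And>a b. a \<in> A \<Longrightarrow> b \<in> A \<Longrightarrow> \<forall>w\<in>cube_window r. b w = a w \<Longrightarrow> f b = f a"
proof -
  have "\<exists>r. \<forall>b\<in>A. (\<forall>w\<in>cube_window r. b w = a w) \<longrightarrow> f b = f a" if a: "a \<in> A" for a
  proof -
    have "openin (subtopology config_topology A) {b \<in> A. f b \<in> {f a}}"
      using f discrete[of "{f a}"] unfolding continuous_map by (auto dest!: spec[of _ "{f a}"])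
    then obtain V where V: "openin config_topology V" "{b \<in> A. f b \<in> {f a}} = V \<inter> A"
      unfolding openin_subtopology by blast
    have "a \<in> V" using V(2) a by blast
    then obtain X where X: "finite {i. X i \<noteq> UNIV}" "a \<in> PiE UNIV X" "PiE UNIV X \<subseteq> V"
      using V(1) unfolding config_topology_def openin_product_topology_alt by auto
    obtain r where r: "{i. X i \<noteq> UNIV} \<subseteq> cube_window r" using finite_subset_cube_window[OF X(1)] ..
    have "f b = f a" if b: "b \<in> A" "\<forall>w\<in>cube_window r. b w = a w" for b
    proof -
      have "b w \<in> X w" for w
        using b(2) r X(2) by (cases "X w = UNIV") (auto simp: PiE_def Pi_def)
      then have "b \<in> V" using X(3) by (auto simp: PiE_def)
      then show ?thesis using V(2) b(1) by blast
    qed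
    then show ?thesis by blast
  qed
  then obtain r where r: "\<And>a b. a \<in> A \<Longrightarrow> b \<in> A \<Longrightarrow> \<forall>w\<in>cube_window (r a). b w = a w \<Longrightarrow> f b = f a"
    by metis
  define cyl where "cyl a = {b. \<forall>w\<in>cube_window (r a). b w = a w}" for a
  have "\<exists>\<F>. finite \<F> \<and> \<F> \<subseteq> cyl ` A \<and> A \<subseteq> \<Union>\<F>"
  proof -
    have "\<forall>U\<in>cyl ` A. openin config_topology U"
      by (auto simp: cyl_def openin_cylinder finite_cube_window)
    moreover have "A \<subseteq> \<Union>(cyl ` A)" by (auto simp: cyl_def)
    ultimately show ?thesis
      using compactin_subshift[OF A] unfolding compactin_def by blast
  qed
  then obtain F where F: "F \<subseteq> A" "finite F" "A \<subseteq> \<Union>(cyl ` F)"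
    by (metis finite_subset_image)
  have "finite (\<Union>a\<in>F. cube_window (r a) :: (int ^ 'n) set)"
    using F(2) finite_cube_window by (intro finite_UN_I)
  then obtain s where s: "(\<Union>a\<in>F. cube_window (r a)) \<subseteq> (cube_window s :: (int ^ 'n) set)"
    using finite_subset_cube_window by blast
  show thesis
  proof
    fix a b assume ab: "a \<in> A" "b \<in> A" "\<forall>w\<in>cube_window s. b w = a w"
    then obtain c where c: "c \<in> F" "a \<in> cyl c" using F(3) by blast
    \<comment> \<open>The centre \<open>c\<close> of a cylinder containing \<open>a\<close> serves
      for \<open>b\<close> as well, since its window lies inside the common one on which
      \<open>a\<close> and \<open>b\<close> agree.\<close>
    have sub: "cube_window (r c) \<subseteq> (cube_window s :: (int ^ 'n) set)" using s c(1) by blast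
    have a: "\<forall>w\<in>cube_window (r c) :: (int ^ 'n) set. a w = c w" using c(2) by (simp add: cyl_def)
    have b: "\<forall>w\<in>cube_window (r c) :: (int ^ 'n) set. b w = c w"
    proof
      fix w :: "int ^ 'n" assume w: "w \<in> cube_window (r c)"
      then have "b w = a w" using sub ab(3) by blast
      then show "b w = c w" using a w by simp
    qed
    have "c \<in> A" using c F(1) by blast
    then have "f a = f c" "f b = f c" using r a b ab(1,2) by blast+
    then show "f b = f a" by simp
  qed
qed

text \<open>A product with a discrete factor is a disjoint union of open copies of the other factor,
  so continuity can be tested on each slice.\<close>

lemma continuous_map_prod_discrete:
  "continuous_map (prod_topology (discrete_topology X) Y) Z C \<longleftrightarrow>
    (\<forall>x\<in>X. continuous_map Y Z (\<lambda>y. C (x, y)))"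
proof (intro iffI ballI)
  fix x assume C: "continuous_map (prod_topology (discrete_topology X) Y) Z C" and x: "x \<in> X"
  have "continuous_map Y (prod_topology (discrete_topology X) Y) (\<lambda>y. (x, y))"
    using x by (intro continuous_map_pairedI) auto
  then show "continuous_map Y Z (\<lambda>y. C (x, y))"
    using continuous_map_compose[OF _ C] by (simp add: o_def)
next
  assume *: "\<forall>x\<in>X. continuous_map Y Z (\<lambda>y. C (x, y))"
  show "continuous_map (prod_topology (discrete_topology X) Y) Z C"
    unfolding continuous_map
  proof (intro conjI allI impI)
    show "C ` topspace (prod_topology (discrete_topology X) Y) \<subseteq> topspace Z"
      using * by (auto simp: continuous_map)
    fix U assume "openin Z U"
    then have o: "openin Y {y \<in> topspace Y. C (x, y) \<in> U}" if "x \<in> X" for x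
      using * that by (auto simp: continuous_map)
    have eq: "{p \<in> topspace (prod_topology (discrete_topology X) Y). C p \<in> U}
        = (\<Union>x\<in>X. {x} \<times> {y \<in> topspace Y. C (x, y) \<in> U})" by auto
    show "openin (prod_topology (discrete_topology X) Y)
        {p \<in> topspace (prod_topology (discrete_topology X) Y). C p \<in> U}"
      unfolding eq using o by (intro openin_Union) (auto simp: openin_prod_Times_iff)
  qed
qed

lemma continuous_map_group_diff:
  fixes f g :: "'x \<Rightarrow> 'g::topological_ab_group_add"
  assumes "continuous_map X euclidean f" "continuous_map X euclidean g"
  shows "continuous_map X euclidean (\<lambda>x. f x - g x)"
proof -
  have "continuous_map X euclidean (\<lambda>x. (f x, g x))"
    using continuous_map_pairedI[OF assms] by simp
  moreover have "continuous_on UNIV (\<lambda>p::'g \<times> 'g. fst p - snd p)"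
    by (intro continuous_intros)
  ultimately show ?thesis
    using continuous_map_compose[of X euclidean "\<lambda>x. (f x, g x)" euclidean "\<lambda>p. fst p - snd p"]
    by (simp add: o_def)
qed

section \<open>Equivariant cochains and their values on cells at the origin\<close>

lemma eq_cochainI:
  fixes A :: "('n::finite, 'a) config set" and C :: "('n, 'a, 'g::topological_ab_group_add) eq_cochain"
  assumes A: "subshift A"
    and add: "\<And>a. a \<in> A \<Longrightarrow> additive_on (cells d) (\<lambda>\<zeta>. C (\<zeta>, a))"
    and cont: "\<And>J. card J = d \<Longrightarrow>
      continuous_map (subtopology config_topology A) euclidean (\<lambda>a. C (frag_of (0, J), a))"
    and equi: "\<And>z J a. card J = d \<Longrightarrow> a \<in> A \<Longrightarrow> C (frag_of (z, J), a) = C (frag_of (0, J), shift z a)"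
    and supp: "\<And>\<zeta> a. \<zeta> \<notin> int_chains (cells d) \<or> a \<notin> A \<Longrightarrow> C (\<zeta>, a) = 0"
  shows "C \<in> eq_cochains A d"
  unfolding eq_cochains_def
proof (intro CollectI conjI ballI allI impI)
  show "continuous_map (prod_topology (discrete_topology (int_chains (cells d)))
      (subtopology config_topology A)) euclidean C"
    unfolding continuous_map_prod_discrete
  proof
    fix \<zeta> :: "'n cell \<Rightarrow>\<^sub>0 int" assume "\<zeta> \<in> int_chains (cells d)"
    then have "Poly_Mapping.keys \<zeta> \<subseteq> cells d" by simp
    \<comment> \<open>Chains are built from cells by differences, which preserve continuity in a
      topological group; a single cell at \<open>z\<close> is reduced to the cell at the origin by
      composing with the shift by \<open>z\<close>.\<close>
    then show "continuous_map (subtopology config_topology A) euclidean (\<lambda>a. C (\<zeta>, a))"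
    proof (induction \<zeta> rule: free_Abelian_group_induct[consumes 1, case_names zero diff generator])
      case zero
      have "continuous_map (subtopology config_topology A) euclidean (\<lambda>a. 0)" by simp
      then show ?case
        by (rule continuous_map_eq) (use additive_on_zero[OF add] in auto)
    next
      case (diff \<zeta> \<xi>)
      then have "continuous_map (subtopology config_topology A) euclidean (\<lambda>a. C (\<zeta>, a) - C (\<xi>, a))"
        by (intro continuous_map_group_diff)
      then show ?case
        by (rule continuous_map_eq) (use additive_on_diff[OF add] diff in auto)
    next
      case (generator x)
      obtain z J where x: "x = (z, J)" "card J = d" using generator by (cases x) auto
      have "continuous_map (subtopology config_topology A) euclidean (\<lambda>a. C (frag_of (0, J), shift z a))"
        using continuous_map_compose[OF continuous_map_shift[OF A] cont[OF x(2)]] by (simp add: o_def)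
      then show ?case
        by (rule continuous_map_eq) (use equi x in auto)
    qed
  qed
next
  fix \<zeta> \<xi> :: "'n cell \<Rightarrow>\<^sub>0 int" and a
  assume "\<zeta> \<in> int_chains (cells d)" "\<xi> \<in> int_chains (cells d)" "a \<in> A"
  then show "C (\<zeta> + \<xi>, a) = C (\<zeta>, a) + C (\<xi>, a)"
    using add[of a] by (simp add: additive_on_def)
next
  fix \<zeta> :: "'n cell \<Rightarrow>\<^sub>0 int" and a z assume \<zeta>: "\<zeta> \<in> int_chains (cells d)" and a: "a \<in> A"
  show "C (\<zeta>, shift z a) = C (push (translate_cell z) \<zeta>, a)"
  proof (rule additive_on_eqI[OF _ _ _ \<zeta>])
    show "additive_on (cells d) (\<lambda>\<zeta>. C (\<zeta>, shift z a))"
      by (intro add shift_in A a)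
    show "additive_on (cells d) (\<lambda>\<zeta>. C (push (translate_cell z) \<zeta>, a))"
      by (rule additive_on_push[OF add[OF a]]) (auto simp: translate_cell_def)
    fix x :: "'n cell" assume "x \<in> cells d"
    then obtain y J where x: "x = (y, J)" "card J = d" by (cases x) auto
    then show "C (frag_of x, shift z a) = C (push (translate_cell z) (frag_of x), a)"
      using equi[of J "shift z a" y] equi[of J a "y + z"] a shift_in[OF A a]
      by (simp add: translate_cell_def shift_shift)
  qed
next
  fix p :: "('n cell \<Rightarrow>\<^sub>0 int) \<times> _" assume "p \<notin> int_chains (cells d) \<times> A"
  then show "C p = 0" using supp by (cases p) auto
qed

lemma eq_cochainD:
  assumes "C \<in> eq_cochains A d"
  shows eq_cochain_additive: "a \<in> A \<Longrightarrow> additive_on (cells d) (\<lambda>\<zeta>. C (\<zeta>, a))"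
    and eq_cochain_continuous: "\<zeta> \<in> int_chains (cells d) \<Longrightarrow>
      continuous_map (subtopology config_topology A) euclidean (\<lambda>a. C (\<zeta>, a))"
    and eq_cochain_push: "\<zeta> \<in> int_chains (cells d) \<Longrightarrow> a \<in> A \<Longrightarrow>
      C (push (translate_cell z) \<zeta>, a) = C (\<zeta>, shift z a)"
    and eq_cochain_cell: "card J = d \<Longrightarrow> a \<in> A \<Longrightarrow> C (frag_of (z, J), a) = C (frag_of (0, J), shift z a)"
    and eq_cochain_support: "\<zeta> \<notin> int_chains (cells d) \<or> a \<notin> A \<Longrightarrow> C (\<zeta>, a) = 0"
proof -
  show push: "C (push (translate_cell z) \<zeta>, a) = C (\<zeta>, shift z a)"
    if "\<zeta> \<in> int_chains (cells d)" "a \<in> A" for \<zeta> z a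
    using assms that unfolding eq_cochains_def by auto
  show "C (frag_of (z, J), a) = C (frag_of (0, J), shift z a)" if "card J = d" "a \<in> A"
    using push[of "frag_of (0, J)" a z] that by (simp add: translate_cell_def)
qed (use assms in \<open>auto simp: eq_cochains_def additive_on_def continuous_map_prod_discrete\<close>)

lemma eq_cochain_ext:
  assumes C: "C \<in> eq_cochains A d" and C': "C' \<in> eq_cochains A d" and A: "subshift A"
    and eq: "\<And>J a. card J = d \<Longrightarrow> a \<in> A \<Longrightarrow> C (frag_of (0, J), a) = C' (frag_of (0, J), a)"
  shows "C = C'"
proof (rule ext, clarify)
  fix \<zeta> a
  show "C (\<zeta>, a) = C' (\<zeta>, a)"
  proof (cases "\<zeta> \<in> int_chains (cells d) \<and> a \<in> A")
    case True
    have "C (frag_of x, a) = C' (frag_of x, a)" if "x \<in> cells d" for x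
      using that eq[of "snd x" "shift (fst x) a"] True shift_in[OF A, of a "fst x"]
        eq_cochain_cell[OF C, of "snd x" a "fst x"] eq_cochain_cell[OF C', of "snd x" a "fst x"]
      by (cases x) simp
    then show ?thesis
      using additive_on_eqI[OF eq_cochain_additive[OF C] eq_cochain_additive[OF C'], of a a \<zeta>] True
      by blast
  qed (use eq_cochain_support[OF C] eq_cochain_support[OF C'] in auto)
qed

text \<open>An equivariant cochain may be prescribed freely by continuous functions on
  configurations, one for each direction set \<open>J\<close>, as its values on the cells at the
  origin. The cell at \<open>z\<close> then receives the value at the configuration shifted by
  \<open>z\<close>.\<close>

definition eq_cochain_of ::
    "('n::finite, 'a) config set \<Rightarrow> nat \<Rightarrow> ('n set \<Rightarrow> ('n, 'a) config \<Rightarrow> 'g) \<Rightarrow>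
     ('n, 'a, 'g::topological_ab_group_add) eq_cochain" where
  "eq_cochain_of A d v = (\<lambda>(\<zeta>, a). if \<zeta> \<in> int_chains (cells d) \<and> a \<in> A
     then chain_lift (\<lambda>(z, J). v J (shift z a)) \<zeta> else 0)"

lemma eq_cochain_of_cell [simp]:
  "card J = d \<Longrightarrow> a \<in> A \<Longrightarrow> eq_cochain_of A d v (frag_of (z, J), a) = v J (shift z a)"
  by (simp add: eq_cochain_of_def)

lemma eq_cochain_of_in:
  assumes A: "subshift A"
    and v: "\<And>J. card J = d \<Longrightarrow> continuous_map (subtopology config_topology A) euclidean (v J)"
  shows "eq_cochain_of A d v \<in> eq_cochains A d"
proof (rule eq_cochainI[OF A])
  fix a assume "a \<in> A"
  then show "additive_on (cells d) (\<lambda>\<zeta>. eq_cochain_of A d v (\<zeta>, a))"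
    by (intro additive_on_cong[OF additive_on_chain_lift[of "cells d" "\<lambda>(z, J). v J (shift z a)"]])
      (auto simp: eq_cochain_of_def)
next
  fix J :: "'a set" assume J: "card J = d"
  show "continuous_map (subtopology config_topology A) euclidean
      (\<lambda>a. eq_cochain_of A d v (frag_of (0, J), a))"
    by (rule continuous_map_eq[OF v[OF J]]) (use J in auto)
qed (use shift_in[OF A] in \<open>auto simp: eq_cochain_of_def\<close>)

section \<open>Incidence signs and the cubical boundary\<close>

lemma incidence_sign_remove:
  assumes "j \<in> J" "j \<noteq> k"
  shows "incidence_sign (J - {j}) k = (if j < k then - 1 else 1) * incidence_sign J k"
proof (cases "j < k")
  case True
  have "{i \<in> J. i < k} = insert j {i \<in> J - {j}. i < k}" using assms True by auto
  then have "card {i \<in> J. i < k} = Suc (card {i \<in> J - {j}. i < k})" by simp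
  then show ?thesis using True by (simp add: incidence_sign_def)
next
  case False
  then have "{i \<in> J - {j}. i < k} = {i \<in> J. i < k}" using assms by auto
  then show ?thesis using False by (simp add: incidence_sign_def)
qed

text \<open>Exactly one of \<open>j < k\<close> and \<open>k < j\<close> holds, so removing the
  other direction first changes exactly one of the two signs.\<close>

lemma incidence_sign_swap:
  assumes "j \<in> J" "k \<in> J" "j \<noteq> k"
  shows "incidence_sign J k * incidence_sign (J - {k}) j = - (incidence_sign J j * incidence_sign (J - {j}) k)"
  using incidence_sign_remove[of j J k] incidence_sign_remove[of k J j] assms by (auto simp: not_less_iff_gr_or_eq)

text \<open>Removing \<open>j\<close> and \<open>k\<close> in either order leads to the same signed
  combination of four parallel cells, while the product of the incidence signs is reversed. The
  double sum therefore equals its own negative.\<close>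

lemma frag_extend_cell_boundary_cell_boundary:
  fixes x :: "'n::{finite,linorder} cell"
  shows "frag_extend cell_boundary (cell_boundary x) = 0"
proof -
  obtain z J where x: "x = (z, J)" by (cases x) auto
  \<comment> \<open>The cells are grouped by sign and summed over unordered sets of offsets, which
    makes the symmetry in \<open>j\<close> and \<open>k\<close> immediate. For \<open>j = k\<close>
    one set collapses, but only distinct directions occur below.\<close>
  define D where "D j k = (\<Sum>s\<in>{0, axis j 1 + axis k 1}. frag_of (z + s, J - {j} - {k}))
    - (\<Sum>s\<in>{axis j 1, axis k 1}. frag_of (z + s, J - {j} - {k}))" for j k
  have D: "D j k = D k j" for j k
  proof -
    have "J - {j} - {k} = J - {k} - {j}" by blast
    then show ?thesis by (simp add: D_def add.commute insert_commute)
  qed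
  define T where "T j k = frag_cmul (incidence_sign J j * incidence_sign (J - {j}) k) (D j k)" for j k
  \<comment> \<open>The two offsets in each set are distinct, so that each sum over offsets really
    has two terms.\<close>
  have ne: "(0 :: (int, 'n) vec) \<noteq> axis j 1 + axis k 1" "axis j 1 \<noteq> (axis k 1 :: (int, 'n) vec)" if "j \<noteq> k" for j k
  proof -
    have "(0 :: (int, 'n) vec) $ j \<noteq> (axis j 1 + axis k 1) $ j" "axis j 1 $ j \<noteq> (axis k 1 :: (int, 'n) vec) $ j"
      using that by (auto simp: axis_def)
    then show "(0 :: (int, 'n) vec) \<noteq> axis j 1 + axis k 1" "axis j 1 \<noteq> (axis k 1 :: (int, 'n) vec)" by metis+
  qed
  have "cell_boundary x = (\<Sum>j\<in>J. frag_cmul (incidence_sign J j)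
      (frag_of (z + axis j 1, J - {j}) - frag_of (z, J - {j})))"
    by (simp add: x cell_boundary_def)
  then have "frag_extend cell_boundary (cell_boundary x)
      = (\<Sum>j\<in>J. frag_cmul (incidence_sign J j) (cell_boundary (z + axis j 1, J - {j}) - cell_boundary (z, J - {j})))"
    by (simp add: frag_extend_sum frag_extend_cmul frag_extend_diff o_def)
  also have "\<dots> = (\<Sum>j\<in>J. \<Sum>k\<in>J - {j}. T j k)"
  proof (rule sum.cong[OF refl])
    fix j assume "j \<in> J"
    have "cell_boundary (z + axis j 1, J - {j}) - cell_boundary (z, J - {j})
        = (\<Sum>k\<in>J - {j}. frag_cmul (incidence_sign (J - {j}) k) (D j k))"
      unfolding cell_boundary_def case_prod_conv sum_subtractf[symmetric]
    proof (rule sum.cong[OF refl])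
      fix k assume "k \<in> J - {j}"
      then show "frag_cmul (incidence_sign (J - {j}) k)
            (frag_of (z + axis j 1 + axis k 1, J - {j} - {k}) - frag_of (z + axis j 1, J - {j} - {k}))
          - frag_cmul (incidence_sign (J - {j}) k)
            (frag_of (z + axis k 1, J - {j} - {k}) - frag_of (z, J - {j} - {k}))
          = frag_cmul (incidence_sign (J - {j}) k) (D j k)"
        using ne[of j k] by (intro poly_mapping_eqI) (auto simp: D_def lookup_minus lookup_add algebra_simps)
    qed
    then show "frag_cmul (incidence_sign J j)
        (cell_boundary (z + axis j 1, J - {j}) - cell_boundary (z, J - {j})) = (\<Sum>k\<in>J - {j}. T j k)"
      by (simp add: frag_cmul_sum o_def T_def)
  qed
  also have "\<dots> = 0"
  proof -
    define S where "S = (\<Sum>j\<in>J. \<Sum>k\<in>{k \<in> J. j \<noteq> k}. T j k)"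
    have "S = (\<Sum>k\<in>J. \<Sum>j\<in>{j \<in> J. j \<noteq> k}. T j k)"
      unfolding S_def by (rule sum.swap_restrict) auto
    also have "\<dots> = (\<Sum>k\<in>J. \<Sum>j\<in>{j \<in> J. k \<noteq> j}. - T k j)"
    proof (intro sum.cong)
      fix j k assume "k \<in> J" "j \<in> {j \<in> J. k \<noteq> j}"
      then show "T j k = - T k j"
        using incidence_sign_swap[of k J j] D[of j k] by (simp add: T_def)
    qed auto
    also have "\<dots> = - S" by (simp add: S_def sum_negf)
    \<comment> \<open>Equality with the negative is read coefficientwise: the coefficients are
      integers and must vanish.\<close>
    finally have "poly_mapping.lookup S i = poly_mapping.lookup (- S) i" for i by simp
    then have "S = 0" by (intro poly_mapping_eqI) simp
    moreover have "J - {j} = {k \<in> J. j \<noteq> k}" for j by blast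
    ultimately show ?thesis by (simp add: S_def)
  qed
  finally show ?thesis .
qed

lemma cell_boundary_in: "x \<in> cells (Suc d) \<Longrightarrow> cell_boundary x \<in> int_chains (cells d)"
  by (cases x) (auto simp: cell_boundary_def simp del: carrier_free_Abelian_group_iff
      intro!: sum_closed_free_Abelian_group int_chains_cmul int_chains_diff
      simp: frag_of_in_free_Abelian_group card_Diff_singleton)

lemma cell_boundary_translate:
  "cell_boundary (translate_cell v x) = push (translate_cell v) (cell_boundary x)"
  by (cases x) (simp add: cell_boundary_def translate_cell_def push_def frag_extend_sum frag_extend_cmul
      frag_extend_diff o_def algebra_simps)

section \<open>The equivariant complex and its locally determined part\<close>

lemma comm_group_pointwise_group:
  assumes "(\<lambda>x. 0) \<in> S" "\<And>f g. f \<in> S \<Longrightarrow> g \<in> S \<Longrightarrow> (\<lambda>x. f x - g x) \<in> S"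
  shows "comm_group (pointwise_group S)"
proof (rule comm_groupI)
  have neg: "(\<lambda>x. - g x) \<in> S" if "g \<in> S" for g
    using assms(2)[OF assms(1) that] by simp
  show "f \<otimes>\<^bsub>pointwise_group S\<^esub> g \<in> carrier (pointwise_group S)"
    if "f \<in> carrier (pointwise_group S)" "g \<in> carrier (pointwise_group S)" for f g
    using assms(2)[OF _ neg, of f g] that by (simp add: pointwise_group_def)
  show "\<exists>g\<in>carrier (pointwise_group S). g \<otimes>\<^bsub>pointwise_group S\<^esub> f = \<one>\<^bsub>pointwise_group S\<^esub>"
    if "f \<in> carrier (pointwise_group S)" for f
    using that neg by (intro bexI[of _ "\<lambda>x. - f x"]) (auto simp: pointwise_group_def)
qed (use assms in \<open>auto simp: pointwise_group_def algebra_simps\<close>)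

lemma pointwise_group_simps [simp]:
  "carrier (pointwise_group S) = S"
  "f \<otimes>\<^bsub>pointwise_group S\<^esub> g = (\<lambda>x. f x + g x)"
  "\<one>\<^bsub>pointwise_group S\<^esub> = (\<lambda>x. 0)"
  by (auto simp: pointwise_group_def)

lemma eq_cochains_zero: "(\<lambda>p. 0) \<in> eq_cochains A d"
  by (auto simp: eq_cochains_def)

lemma eq_cochains_diff:
  assumes "subshift A" "C \<in> eq_cochains A d" "C' \<in> eq_cochains A d"
  shows "(\<lambda>p. C p - C' p) \<in> eq_cochains A d"
  by (rule eq_cochainI[OF assms(1)])
    (use assms eq_cochainD[OF assms(2)] eq_cochainD[OF assms(3)] in
      \<open>auto intro!: additive_on_minus continuous_map_group_diff\<close>)

lemma eq_coboundary_in: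
  fixes A :: "('n::{finite,linorder}, 'a) config set"
  assumes A: "subshift A" and C: "C \<in> eq_cochains A d"
  shows "eq_coboundary d C \<in> eq_cochains A (Suc d)"
proof (rule eq_cochainI[OF A])
  fix a assume a: "a \<in> A"
  show "additive_on (cells (Suc d)) (\<lambda>\<zeta>. eq_coboundary d C (\<zeta>, a))"
    by (rule additive_on_cong[OF additive_on_frag_extend[OF eq_cochain_additive[OF C a] cell_boundary_in]])
      (auto simp: eq_coboundary_def)
next
  fix J :: "'n set" assume J: "card J = Suc d"
  then show "continuous_map (subtopology config_topology A) euclidean
      (\<lambda>a. eq_coboundary d C (frag_of (0, J), a))"
    using eq_cochain_continuous[OF C cell_boundary_in[of "(0, J)" d]] by (simp add: eq_coboundary_def)
  fix z a assume a: "a \<in> A"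
  have "cell_boundary (z, J) = push (translate_cell z) (cell_boundary (0, J))"
    using cell_boundary_translate[of z "(0, J)"] by (simp add: translate_cell_def)
  then show "eq_coboundary d C (frag_of (z, J), a) = eq_coboundary d C (frag_of (0, J), shift z a)"
    using J eq_cochain_push[OF C cell_boundary_in[of "(0, J)" d] a] by (simp add: eq_coboundary_def)
next
  fix \<zeta> :: "'n cell \<Rightarrow>\<^sub>0 int" and a assume "\<zeta> \<notin> int_chains (cells (Suc d)) \<or> a \<notin> A"
  then show "eq_coboundary d C (\<zeta>, a) = 0"
    using eq_cochain_support[OF C] by (auto simp: eq_coboundary_def)
qed

lemma eq_coboundary_add: "eq_coboundary d (\<lambda>p. C p + C' p) = (\<lambda>p. eq_coboundary d C p + eq_coboundary d C' p)"
  by (auto simp: eq_coboundary_def)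

lemma eq_coboundary_square_zero:
  assumes "C \<in> eq_cochains A d"
  shows "eq_coboundary (Suc d) (eq_coboundary d C) = (\<lambda>p. 0)"
proof (rule ext, clarify)
  fix \<zeta> a
  have 0: "C (0, a) = 0"
    using eq_cochain_support[OF assms, of 0 a] additive_on_zero[OF eq_cochain_additive[OF assms]]
    by blast
  have "frag_extend cell_boundary (frag_extend cell_boundary \<zeta>) = 0" for \<zeta> :: "'a cell \<Rightarrow>\<^sub>0 int"
    by (simp add: frag_extend_frag_extend frag_extend_cell_boundary_cell_boundary frag_extend_eq_0)
  then show "eq_coboundary (Suc d) (eq_coboundary d C) (\<zeta>, a) = 0"
    using 0 by (simp add: eq_coboundary_def)
qed

lemma eq_cochain_complex:
  fixes A :: "('n::{finite,linorder}, 'a) config set"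
  assumes "subshift A"
  shows "cochain_complex (\<lambda>d. pointwise_group (eq_cochains A d ::
    ('n, 'a, 'g::topological_ab_group_add) eq_cochain set)) eq_coboundary"
proof (rule cochain_complex.intro)
  show "comm_group (pointwise_group (eq_cochains A d :: ('n, 'a, 'g) eq_cochain set))" for d
    by (intro comm_group_pointwise_group eq_cochains_zero eq_cochains_diff assms)
qed (use eq_coboundary_in[OF assms] eq_coboundary_square_zero in
    \<open>auto simp: Group.hom_def eq_coboundary_add\<close>)

text \<open>\<open>cell_box J r\<close> lacks the sites with \<open>u $ i = r\<close> for
  \<open>i\<close> outside \<open>J\<close>; raising the radius by one makes room for the full
  window of radius \<open>r\<close>.\<close>

lemma cube_window_subset_cell_box: "cube_window r \<subseteq> cell_box J (Suc r)"
  unfolding cube_window_def cell_box_def by clarsimp (smt (verit, best) of_nat_Suc)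

text \<open>Equivariance moves every cell to the origin, and a local rule exists there exactly when
  configurations with equal patterns have equal values. This form avoids handling the rule
  itself.\<close>

lemma locally_determined_iff:
  assumes A: "subshift A" and C: "C \<in> eq_cochains A d"
  shows "locally_determined A d r C \<longleftrightarrow> (\<forall>J. card J = d \<longrightarrow> (\<forall>a\<in>A. \<forall>b\<in>A.
    (\<forall>w\<in>cell_box J r. b w = a w) \<longrightarrow> C (frag_of (0, J), b) = C (frag_of (0, J), a)))" (is "_ \<longleftrightarrow> ?R")
proof
  assume L: "locally_determined A d r C"
  show ?R
  proof (intro allI impI ballI)
    fix J a b assume J: "card J = d" and ab: "a \<in> A" "b \<in> A" "\<forall>w\<in>cell_box J r. b w = a w"
    obtain c where c: "\<forall>a\<in>A. \<forall>z. C (frag_of (translate_cell z (0, J)), a) = c (restrict (shift z a) (cell_box J r))"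
      using L J unfolding locally_determined_def by blast
    have "restrict b (cell_box J r) = restrict a (cell_box J r)" using ab by (simp add: restrict_eq_iff)
    then show "C (frag_of (0, J), b) = C (frag_of (0, J), a)"
      using ab c[rule_format, of a 0] c[rule_format, of b 0] by (simp add: translate_cell_def)
  qed
next
  assume R: ?R
  show "locally_determined A d r C"
    unfolding locally_determined_def
  proof (intro allI impI)
    fix J :: "'a set" assume J: "card J = d"
    \<comment> \<open>The rule evaluates \<open>C\<close> at some configuration of \<open>A\<close>
      with the given pattern. On patterns that do not occur in \<open>A\<close> its value is
      arbitrary and never queried.\<close>
    define c where "c p = C (frag_of (0, J), SOME b. b \<in> A \<and> restrict b (cell_box J r) = p)" for p
    have "C (frag_of (translate_cell z (0, J)), a) = c (restrict (shift z a) (cell_box J r))"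
      if a: "a \<in> A" for a z
    proof -
      define b where "b = (SOME b. b \<in> A \<and> restrict b (cell_box J r) = restrict (shift z a) (cell_box J r))"
      have "b \<in> A \<and> restrict b (cell_box J r) = restrict (shift z a) (cell_box J r)"
        unfolding b_def by (rule someI[of _ "shift z a"]) (use shift_in[OF A a] in simp)
      then have "C (frag_of (0, J), b) = C (frag_of (0, J), shift z a)"
        using R J shift_in[OF A a] by (simp add: restrict_eq_iff)
      then show ?thesis
        using eq_cochain_cell[OF C J a] by (simp add: c_def b_def translate_cell_def)
    qed
    then show "\<exists>c. \<forall>a\<in>A. \<forall>z. C (frag_of (translate_cell z (0, J)), a) = c (restrict (shift z a) (cell_box J r))"
      by blast
  qed
qed

lemma loc_cochains_discrete:
  fixes A :: "('n::finite, 'a::finite) config set"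
  assumes A: "subshift A" and discrete: "\<And>S :: 'g::topological_ab_group_add set. open S"
  shows "(loc_cochains A d :: ('n, 'a, 'g) eq_cochain set) = eq_cochains A d"
proof (intro equalityI subsetI)
  fix C :: "('n, 'a, 'g) eq_cochain" assume C: "C \<in> eq_cochains A d"
  have "\<exists>r. \<forall>a\<in>A. \<forall>b\<in>A. (\<forall>w\<in>cube_window r. b w = a w) \<longrightarrow> C (frag_of (0, J), b) = C (frag_of (0, J), a)"
    if "card J = d" for J
  proof (rule continuous_map_discrete_window[OF A eq_cochain_continuous[OF C] discrete])
    show "frag_of (0, J) \<in> int_chains (cells d)" using that by simp
  qed blast
  then obtain r where r: "\<And>J a b. card J = d \<Longrightarrow> a \<in> A \<Longrightarrow> b \<in> A \<Longrightarrow> \<forall>w\<in>cube_window (r J). b w = a w \<Longrightarrow>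
      C (frag_of (0, J), b) = C (frag_of (0, J), a)"
    by metis
  \<comment> \<open>The sum bounds the radii of the finitely many direction sets at once. The
    successor pays for the passage from \<open>cube_window\<close> to
    \<open>cell_box\<close>.\<close>
  define s where "s = Suc (\<Sum>J\<in>UNIV. r J)"
  have box: "cube_window (r J) \<subseteq> cell_box J s" for J
  proof -
    have "r J \<le> (\<Sum>J\<in>UNIV. r J)" by (rule member_le_sum) auto
    then show ?thesis
      unfolding s_def using cube_window_mono cube_window_subset_cell_box by blast
  qed
  have "locally_determined A d s C"
    unfolding locally_determined_iff[OF A C]
  proof (intro allI impI ballI)
    fix J a b assume *: "card J = d" "a \<in> A" "b \<in> A" "\<forall>w\<in>cell_box J s. b w = a w"
    then have "\<forall>w\<in>cube_window (r J). b w = a w" using box[of J] by blast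
    then show "C (frag_of (0, J), b) = C (frag_of (0, J), a)" using r * by blast
  qed
  then show "C \<in> loc_cochains A d" using C by (auto simp: loc_cochains_def)
qed (auto simp: loc_cochains_def)

section \<open>Cells of the tile complex as values of sections\<close>

text \<open>The lowest corner of the face \<open>(z, c, J, U)\<close> lies at
  \<open>z + vertex_offset U\<close>.\<close>

definition vertex_offset :: "'n set \<Rightarrow> int ^ 'n::finite" where
  "vertex_offset U = (\<chi> i. if i \<in> U then 1 else 0)"

lemma vertex_offset_empty [simp]: "vertex_offset {} = 0"
  by (simp add: vertex_offset_def vec_eq_iff)

lemma vertex_offset_remove: "i \<in> U \<Longrightarrow> vertex_offset U = axis i 1 + vertex_offset (U - {i})"
  by (auto simp: vertex_offset_def vec_eq_iff axis_def)

lemma vertex_offset_single: "vertex_offset {i} = axis i 1"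
  by (auto simp: vertex_offset_def vec_eq_iff axis_def)

lemma equiv_glue: "equiv UNIV (glue r A)"
proof -
  have "sym ((glue_step r A \<union> (glue_step r A)\<inverse>)\<^sup>*)"
    by (intro sym_rtrancl sym_Un_converse)
  then show ?thesis
    by (intro equivI) (auto simp: glue_def refl_rtrancl trans_rtrancl)
qed

lemma glue_step_in_glue: "(s, t) \<in> glue_step r A \<Longrightarrow> (s, t) \<in> glue r A"
  by (auto simp: glue_def)

lemma glue_refl [simp]: "(s, s) \<in> glue r A"
  by (simp add: glue_def)

lemma glue_sym: "(s, t) \<in> glue r A \<Longrightarrow> (t, s) \<in> glue r A"
  using equiv_glue[of r A] by (auto simp: equiv_def dest: symD)

lemma glue_trans: "(s, t) \<in> glue r A \<Longrightarrow> (t, u) \<in> glue r A \<Longrightarrow> (s, u) \<in> glue r A"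
  by (auto simp: glue_def)

lemma glue_class_eq_iff: "glue r A `` {s} = glue r A `` {t} \<longleftrightarrow> (s, t) \<in> glue r A"
  using eq_equiv_class_iff[OF equiv_glue, of s t r A] by simp

lemma glue_induct [consumes 1, case_names refl forward backward]:
  assumes "(s, t) \<in> glue r A" and "P s"
    and "\<And>t u. (s, t) \<in> glue r A \<Longrightarrow> (t, u) \<in> glue_step r A \<Longrightarrow> P t \<Longrightarrow> P u"
    and "\<And>t u. (s, t) \<in> glue r A \<Longrightarrow> (u, t) \<in> glue_step r A \<Longrightarrow> P t \<Longrightarrow> P u"
  shows "P t"
  using assms(1) unfolding glue_def
proof (induction rule: rtrancl_induct)
  case (step t u)
  then show ?case using assms(3,4)[of t u] by (auto simp: glue_def)
qed (rule assms(2))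

lemma glue_invariant:
  assumes "(s, t) \<in> glue r A" and "\<And>s t. (s, t) \<in> glue_step r A \<Longrightarrow> f s = f t"
  shows "f s = f t"
  using assms(1) by (induction rule: glue_induct) (auto dest: assms(2))

text \<open>These are invariants of a single gluing step, hence of any chain of steps: the lowest
  corner, the directions, and the label on the cell box when it is read relative to that
  corner.\<close>

lemma glue_face_window:
  assumes "((z, c, J, U), (z', c', J', U')) \<in> glue r A"
  shows "z + vertex_offset U = z' + vertex_offset U'" "J = J'"
    and "\<And>u. u \<in> cell_box J r \<Longrightarrow> c (u + vertex_offset U) = c' (u + vertex_offset U')"
proof -
  define f :: "('a, 'b) tile_face \<Rightarrow> _" where
    "f = (\<lambda>(z, c, J, U). (z + vertex_offset U, J, restrict (\<lambda>u. c (u + vertex_offset U)) (cell_box J r)))"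
  have "f (z, c, J, U) = f (z', c', J', U')"
  proof (rule glue_invariant[OF assms])
    fix s t assume "(s, t) \<in> glue_step r A"
    then obtain z c J U i c' where st: "s = (z, c, J, U)" "t = (z + axis i 1, c', J, U - {i})"
      and h: "J \<inter> U = {}" "i \<in> U" "matching r i c c'"
      unfolding glue_step_def by blast
    have "c (u + vertex_offset U) = c' (u + vertex_offset (U - {i}))" if u: "u \<in> cell_box J r" for u
    proof -
      \<comment> \<open>On the cell box the coordinates in \<open>U\<close>, being outside
        \<open>J\<close>, stay below \<open>r\<close>, so adding 1 does not leave the window. The
        coordinate \<open>i\<close> is at least \<open>- r\<close> and is raised, so it meets the
        strict bound of \<open>upper_box\<close>.\<close>
      have "u + vertex_offset U \<in> upper_box i r"
      proof -
        have "- int r \<le> (u + vertex_offset U) $ k \<and> (u + vertex_offset U) $ k \<le> int r" for k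
        proof -
          have "- int r \<le> u $ k \<and> u $ k \<le> int r" "k \<in> U \<Longrightarrow> u $ k < int r"
            using u h(1) by (auto simp: cell_box_def cube_window_def)
          then show ?thesis by (cases "k \<in> U") (simp_all add: vertex_offset_def)
        qed
        moreover have "(u + vertex_offset U) $ i > - int r"
        proof -
          have "u $ i \<ge> - int r" using u by (auto simp: cell_box_def cube_window_def)
          then show ?thesis using h(2) by (simp add: vertex_offset_def)
        qed
        ultimately show ?thesis by (simp add: upper_box_def cube_window_def)
      qed
      then have "c (u + vertex_offset U) = c' (u + vertex_offset U - axis i 1)"
        using h(3) by (simp add: matching_def)
      also have "u + vertex_offset U - axis i 1 = u + vertex_offset (U - {i})"
        using vertex_offset_remove[OF h(2)] by simp
      finally show ?thesis .
    qed
    then show "f s = f t"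
      using vertex_offset_remove[OF h(2)] by (simp add: f_def st add.assoc restrict_eq_iff)
  qed
  then show "z + vertex_offset U = z' + vertex_offset U'" "J = J'"
    "\<And>u. u \<in> cell_box J r \<Longrightarrow> c (u + vertex_offset U) = c' (u + vertex_offset U')"
    by (auto simp: f_def restrict_eq_iff)
qed

text \<open>On faces with \<open>U = {}\<close> the invariants of gluing say how much of a
  configuration a cell remembers. This is what makes a locally determined cochain well defined on
  cells.\<close>

lemma tile_section_eqD:
  assumes "tile_section r A a (z, J) = tile_section r A b (z', J')"
  shows "z = z'" "J = J'" "\<And>u. u \<in> cell_box J r \<Longrightarrow> shift z a u = shift z b u"
proof -
  have g: "((z, restrict (shift z a) (cube_window r), J, {}), (z', restrict (shift z' b) (cube_window r), J', {}))
      \<in> glue r A"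
    using assms by (simp add: tile_section_def glue_class_eq_iff)
  show "z = z'" "J = J'" using glue_face_window(1,2)[OF g] by auto
  show "shift z a u = shift z b u" if "u \<in> cell_box J r" for u
    using glue_face_window(3)[OF g that] that \<open>z = z'\<close> by (simp add: cell_box_def)
qed

text \<open>The directions in \<open>U\<close> are removed one after another by moving to the
  neighbouring cube whose label is read off the same configuration \<open>a\<close>. Every face thus
  acquires a representative with \<open>U = {}\<close>.\<close>

lemma glue_down:
  fixes A :: "('n::finite, 'a) config set"
  assumes A: "subshift A" and a: "a \<in> A" and "J \<inter> U = {}"
  shows "((z, restrict (shift z a) (cube_window r), J, U),
    (z + vertex_offset U, restrict (shift (z + vertex_offset U) a) (cube_window r), J, {})) \<in> glue r A"
proof -
  have "finite U" by simp
  then show ?thesis using assms(3)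
  proof (induction U arbitrary: z rule: finite_induct)
    case (insert i U)
    have pat: "restrict (shift z a) (cube_window r) \<in> patterns (cube_window r) A" for z
      using shift_in[OF A a] by (auto simp: patterns_def)
    \<comment> \<open>Both labels show the symbol of \<open>a\<close> at the same lattice site; it
      only has to be seen that this site lies in both windows.\<close>
    have "matching r i (restrict (shift z a) (cube_window r)) (restrict (shift (z + axis i 1) a) (cube_window r))"
    proof -
      have "u - axis i 1 \<in> cube_window r" if "u \<in> upper_box i r" for u
        using that by (auto simp: upper_box_def cube_window_def axis_def) (smt (verit))
      then show ?thesis by (auto simp: matching_def shift_def upper_box_def algebra_simps)
    qed
    then have "((z, restrict (shift z a) (cube_window r), J, insert i U),
        (z + axis i 1, restrict (shift (z + axis i 1) a) (cube_window r), J, insert i U - {i})) \<in> glue_step r A"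
      using insert.prems pat unfolding glue_step_def by blast
    then have "((z, restrict (shift z a) (cube_window r), J, insert i U),
        (z + axis i 1, restrict (shift (z + axis i 1) a) (cube_window r), J, U)) \<in> glue r A"
      using insert.hyps by (intro glue_step_in_glue) simp
    moreover have "((z + axis i 1, restrict (shift (z + axis i 1) a) (cube_window r), J, U),
        (z + axis i 1 + vertex_offset U, restrict (shift (z + axis i 1 + vertex_offset U) a) (cube_window r), J, {}))
        \<in> glue r A"
      using insert.prems by (intro insert.IH) auto
    moreover have "z + axis i 1 + vertex_offset U = z + vertex_offset (insert i U)"
      using vertex_offset_remove[of i "insert i U"] insert.hyps by simp
    ultimately show ?case using glue_trans by (simp only:) blast
  qed simp
qed

lemma tile_cells_eq:
  fixes A :: "('n::finite, 'a) config set"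
  assumes A: "subshift A"
  shows "tile_cells r A d = {tile_section r A a x | a x. a \<in> A \<and> x \<in> cells d}"
proof (intro equalityI subsetI)
  fix X assume "X \<in> tile_cells r A d"
  then obtain z c J U where X: "X = glue r A `` {(z, c, J, U)}" "c \<in> patterns (cube_window r) A"
    "card J = d" "J \<inter> U = {}"
    by (auto simp: tile_cells_def quotient_def tile_faces_def)
  obtain b where b: "b \<in> A" "c = restrict b (cube_window r)" using X(2) by (auto simp: patterns_def)
  \<comment> \<open>\<open>b\<close> shows the label around 0, whereas the section needs it around
    \<open>z\<close>; hence the shift by \<open>- z\<close>.\<close>
  define a where "a = shift (- z) b"
  have a: "a \<in> A" "shift z a = b" using shift_in[OF A b(1)] by (auto simp: a_def shift_shift)
  have "X = tile_section r A a (z + vertex_offset U, J)"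
    unfolding X(1) tile_section_def case_prod_conv glue_class_eq_iff
    using glue_down[OF A a(1) X(4), of z r] a(2) b(2) by simp
  then show "X \<in> {tile_section r A a x | a x. a \<in> A \<and> x \<in> cells d}" using a X(3) by auto
next
  fix X assume "X \<in> {tile_section r A a x | a x. a \<in> A \<and> x \<in> cells d}"
  then obtain a z J where X: "X = tile_section r A a (z, J)" "a \<in> A" "card J = d" by auto
  then have "(z, restrict (shift z a) (cube_window r), J, {}) \<in> tile_faces r A d"
    using shift_in[OF A X(2)] by (auto simp: tile_faces_def patterns_def)
  then show "X \<in> tile_cells r A d"
    unfolding X tile_section_def tile_cells_def by (auto intro: quotientI)
qed

lemma tile_section_in: "subshift A \<Longrightarrow> a \<in> A \<Longrightarrow> x \<in> cells d \<Longrightarrow> tile_section r A a x \<in> tile_cells r A d"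
  unfolding tile_cells_eq by blast

lemma tile_section_image: "subshift A \<Longrightarrow> a \<in> A \<Longrightarrow> tile_section r A a ` cells d \<subseteq> tile_cells r A d"
  using tile_section_in by blast

definition face_dirs :: "('n::finite, 'a) tile_face \<Rightarrow> 'n set" where
  "face_dirs = (\<lambda>(z, c, J, U). J)"

lemma glue_step_dirs: "(s, t) \<in> glue_step r A \<Longrightarrow> face_dirs s = face_dirs t"
  by (auto simp: glue_step_def face_dirs_def)

lemma glue_dirs: "(s, t) \<in> glue r A \<Longrightarrow> face_dirs s = face_dirs t"
  by (rule glue_invariant[where f = face_dirs]) (auto dest: glue_step_dirs)

text \<open>Maps of cells apply a face map to the whole class and saturate; if single steps are
  respected, any one member gives the result. The condition on \<open>face_dirs\<close> makes facts
  about the directions of \<open>s\<close> available for every member, which the upper face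
  requires.\<close>

lemma glue_image:
  assumes "\<And>t u. (t, u) \<in> glue_step r A \<Longrightarrow> face_dirs t = face_dirs s \<Longrightarrow> (f t, f u) \<in> glue r' A'"
  shows "glue r' A' `` (f ` (glue r A `` {s})) = glue r' A' `` {f s}"
proof -
  have "(f s, f t) \<in> glue r' A'" if "(s, t) \<in> glue r A" for t
    using that
  proof (induction rule: glue_induct)
    case (forward t u)
    then show ?case using assms[of t u] glue_dirs[of s t] by (auto intro: glue_trans)
  next
    case (backward t u)
    then have "face_dirs u = face_dirs s" using glue_dirs[of s t] glue_step_dirs by metis
    then show ?case using backward assms[of u t] by (auto intro: glue_trans glue_sym)
  qed simp
  then have "(f s, u) \<in> glue r' A' \<longleftrightarrow> (\<exists>t. (s, t) \<in> glue r A \<and> (f t, u) \<in> glue r' A')" for u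
    by (metis glue_refl glue_trans)
  then show ?thesis by blast
qed

lemma tile_dirs_section: "tile_dirs (tile_section r A a (z, J)) = J"
proof -
  have "J' = J" if "((z, c, J, {}), (z', c', J', U')) \<in> glue r A" for c z' c' J' U'
    using glue_dirs[OF that] by (simp add: face_dirs_def)
  then show ?thesis unfolding tile_dirs_def tile_section_def by (fastforce intro: glue_refl)
qed

lemma lower_face_section:
  "lower_face r A j (tile_section r A a (z, J)) = tile_section r A a (z, J - {j})"
  unfolding lower_face_def tile_section_def case_prod_conv
proof (subst glue_image)
  fix t u assume "(t, u) \<in> glue_step r A"
  then obtain z c J U i c' where "t = (z, c, J, U)" "u = (z + axis i 1, c', J, U - {i})"
    and "c \<in> patterns (cube_window r) A" "c' \<in> patterns (cube_window r) A"
      "J \<inter> U = {}" "i \<in> U" "matching r i c c'"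
    unfolding glue_step_def by blast
  then have "((\<lambda>(z, c, J, U). (z, c, J - {j}, U)) t, (\<lambda>(z, c, J, U). (z, c, J - {j}, U)) u) \<in> glue_step r A"
    unfolding glue_step_def by auto
  then show "((\<lambda>(z, c, J, U). (z, c, J - {j}, U)) t, (\<lambda>(z, c, J, U). (z, c, J - {j}, U)) u) \<in> glue r A"
    by (rule glue_step_in_glue)
qed simp

lemma upper_face_section:
  assumes A: "subshift A" and a: "a \<in> A" and j: "j \<in> J"
  shows "upper_face r A j (tile_section r A a (z, J)) = tile_section r A a (z + axis j 1, J - {j})"
proof -
  have "upper_face r A j (tile_section r A a (z, J))
      = glue r A `` {(z, restrict (shift z a) (cube_window r), J - {j}, {j})}"
    unfolding upper_face_def tile_section_def case_prod_conv
  proof (subst glue_image)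
    fix t u assume "(t, u) \<in> glue_step r A"
      and d: "face_dirs t = face_dirs (z, restrict (shift z a) (cube_window r), J, {})"
    then obtain z c K U i c' where tu: "t = (z, c, K, U)" "u = (z + axis i 1, c', K, U - {i})"
      and h: "c \<in> patterns (cube_window r) A" "c' \<in> patterns (cube_window r) A"
        "K \<inter> U = {}" "i \<in> U" "matching r i c c'"
      unfolding glue_step_def by blast
    have K: "K = J" using d by (simp add: face_dirs_def tu)
    \<comment> \<open>\<open>i\<close> lies in \<open>U\<close> and \<open>j\<close> in
      \<open>J\<close>, which are disjoint, so crossing direction \<open>i\<close> and moving to the
      top in direction \<open>j\<close> do not interfere.\<close>
    have "insert j (U - {i}) = insert j U - {i}" using h j K by blast
    then have "((\<lambda>(z, c, J, U). (z, c, J - {j}, insert j U)) t, (\<lambda>(z, c, J, U). (z, c, J - {j}, insert j U)) u)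
        \<in> glue_step r A"
      using h j K unfolding glue_step_def by (auto simp: tu)
    then show "((\<lambda>(z, c, J, U). (z, c, J - {j}, insert j U)) t, (\<lambda>(z, c, J, U). (z, c, J - {j}, insert j U)) u)
        \<in> glue r A"
      by (rule glue_step_in_glue)
  qed simp
  \<comment> \<open>The face at height \<open>z $ j + 1\<close> is the lower face of the next cube
    along the same configuration.\<close>
  also have "\<dots> = tile_section r A a (z + axis j 1, J - {j})"
    unfolding tile_section_def case_prod_conv glue_class_eq_iff
    using glue_down[OF A a, of "J - {j}" "{j}" z r] by (simp add: vertex_offset_single)
  finally show ?thesis .
qed

text \<open>A section is a cellular map, so it commutes with boundaries. Through this identity the
  boundary of tile cells is reduced to the cubical one.\<close>

lemma tile_boundary_section:
  assumes "subshift A" "a \<in> A"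
  shows "tile_boundary r A (tile_section r A a x) = push (tile_section r A a) (cell_boundary x)"
proof (cases x)
  case (Pair z J)
  then show ?thesis
    using upper_face_section[OF assms, of _ J r z]
    by (simp add: tile_boundary_def cell_boundary_def tile_dirs_section lower_face_section
        push_def frag_extend_sum frag_extend_cmul frag_extend_diff o_def)
qed

text \<open>Translation by \<open>w\<close> keeps the label and moves the cube from \<open>z\<close>
  to \<open>z + w\<close>. The configuration showing that label there is \<open>a\<close> shifted by
  \<open>- w\<close>.\<close>

lemma tile_shift_section:
  "tile_shift w (tile_section r A a x) = tile_section r A (shift (- w) a) (translate_cell w x)"
proof (cases x)
  case (Pair z J)
  define f :: "int ^ 'a \<Rightarrow> ('a, 'b) tile_face \<Rightarrow> ('a, 'b) tile_face" where
    "f w = (\<lambda>(z, c, J, U). (z + w, c, J, U))" for w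
  have step: "(f w s, f w t) \<in> glue_step r A" if "(s, t) \<in> glue_step r A" for w s t
    using that unfolding glue_step_def f_def by (auto simp: algebra_simps)
  have glue: "(f w s, f w t) \<in> glue r A" if "(s, t) \<in> glue r A" for w s t
    using that
  proof (induction rule: glue_induct)
    case (forward t u)
    then show ?case using glue_trans glue_step_in_glue[OF step] by blast
  next
    case (backward t u)
    then show ?case using glue_trans glue_sym[OF glue_step_in_glue[OF step]] by blast
  qed simp
  have inv: "f w (f (- w) t) = t" "f (- w) (f w t) = t" for w t by (auto simp: f_def split: prod.splits)
  \<comment> \<open>No saturation occurs in \<open>tile_shift\<close>, so the image must be shown to
    be a whole class; the missing inclusion comes from translating back by
    \<open>- w\<close>.\<close>
  have "f w ` (glue r A `` {s}) = glue r A `` {f w s}" for s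
  proof (intro equalityI subsetI)
    fix t assume "t \<in> glue r A `` {f w s}"
    then have "f (- w) t \<in> glue r A `` {s}" using glue[of "f w s" t "- w"] by (simp add: inv)
    then show "t \<in> f w ` (glue r A `` {s})" using inv(1)[of w t] by (metis imageI)
  qed (use glue in auto)
  then show ?thesis
    unfolding tile_shift_def Pair tile_section_def case_prod_conv translate_cell_def
    by (simp add: f_def shift_shift)
qed

lemma inv_cochainD:
  assumes "C \<in> inv_cochains r A d"
  shows inv_cochain_additive: "additive_on (tile_cells r A d) C"
    and inv_cochain_support: "\<zeta> \<notin> int_chains (tile_cells r A d) \<Longrightarrow> C \<zeta> = 0"
    and inv_cochain_shift: "\<zeta> \<in> int_chains (tile_cells r A d) \<Longrightarrow> C (push (tile_shift z) \<zeta>) = C \<zeta>"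
  using assms by (auto simp: inv_cochains_def cochains_def additive_on_def)

text \<open>Invariance becomes equivariance here: translating by \<open>- z\<close> brings the cell
  to the origin and replaces \<open>a\<close> by \<open>shift z a\<close>.\<close>

lemma inv_cochain_section:
  assumes "subshift A" "C \<in> inv_cochains r A d" "a \<in> A" "card J = d"
  shows "C (frag_of (tile_section r A a (z, J))) = C (frag_of (tile_section r A (shift z a) (0, J)))"
proof -
  have "tile_shift (- z) (tile_section r A a (z, J)) = tile_section r A (shift z a) (0, J)"
    by (simp add: tile_shift_section translate_cell_def)
  then show ?thesis
    using inv_cochain_shift[OF assms(2), of "frag_of (tile_section r A a (z, J))" "- z"]
      tile_section_in[OF assms(1,3), of "(z, J)" d r] assms(4) by simp
qed

lemma inv_cochainI:
  assumes A: "subshift A" and add: "additive_on (tile_cells r A d) C"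
    and supp: "\<And>\<zeta>. \<zeta> \<notin> int_chains (tile_cells r A d) \<Longrightarrow> C \<zeta> = 0"
    and inv: "\<And>w a x. a \<in> A \<Longrightarrow> x \<in> cells d \<Longrightarrow>
      C (frag_of (tile_section r A (shift (- w) a) (translate_cell w x))) = C (frag_of (tile_section r A a x))"
  shows "C \<in> inv_cochains r A d"
  unfolding inv_cochains_def
proof (intro CollectI conjI allI ballI)
  show "C \<in> cochains (tile_cells r A d)"
    using add supp by (auto simp: cochains_def additive_on_def)
  fix z and \<zeta> :: "('a, 'b) tile_cell \<Rightarrow>\<^sub>0 int" assume \<zeta>: "\<zeta> \<in> int_chains (tile_cells r A d)"
  show "C (push (tile_shift z) \<zeta>) = C \<zeta>"
  proof (rule additive_on_eqI[OF _ add _ \<zeta>])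
    show "additive_on (tile_cells r A d) (\<lambda>\<zeta>. C (push (tile_shift z) \<zeta>))"
    proof (rule additive_on_push[OF add])
      show "tile_shift z ` tile_cells r A d \<subseteq> tile_cells r A d"
      proof
        fix Y assume "Y \<in> tile_shift z ` tile_cells r A d"
        then obtain a x where Y: "Y = tile_shift z (tile_section r A a x)" "a \<in> A" "x \<in> cells d"
          unfolding tile_cells_eq[OF A] by blast
        then show "Y \<in> tile_cells r A d"
          unfolding tile_shift_section Y(1)
          by (intro tile_section_in[OF A shift_in[OF A Y(2)]]) (cases x, simp add: translate_cell_def)
      qed
    qed
    fix X assume "X \<in> tile_cells r A d"
    then show "C (push (tile_shift z) (frag_of X)) = C (frag_of X)"
      using inv by (auto simp: tile_cells_eq[OF A] tile_shift_section)
  qed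
qed

lemma section_pullback_frag_of:
  "a \<in> A \<Longrightarrow> x \<in> cells d \<Longrightarrow> section_pullback A d r C (frag_of x, a) = C (frag_of (tile_section r A a x))"
  by (simp add: section_pullback_def)

lemma section_pullback_additive:
  assumes "subshift A" "a \<in> A" "C \<in> inv_cochains r A d"
  shows "additive_on (cells d) (\<lambda>\<zeta>. section_pullback A d r C (\<zeta>, a))"
  by (rule additive_on_cong[OF additive_on_push[OF inv_cochain_additive[OF assms(3)] tile_section_image[OF assms(1,2)]]])
    (use assms in \<open>auto simp: section_pullback_def\<close>)

lemma tile_section_window:
  "\<forall>w\<in>cube_window r. b w = a w \<Longrightarrow> tile_section r A b (0, J) = tile_section r A a (0, J)"
proof -
  assume "\<forall>w\<in>cube_window r. b w = a w"
  then have "restrict b (cube_window r) = restrict a (cube_window r)" by (simp add: restrict_eq_iff)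
  then show ?thesis by (simp add: tile_section_def)
qed

text \<open>At the origin the section depends on the configuration only through its pattern of
  radius \<open>r\<close>, which gives continuity; equivariance comes from invariance under
  translations.\<close>

lemma section_pullback_in:
  fixes C :: "('n::finite, 'a, 'g::topological_ab_group_add) tile_cochain"
  assumes A: "subshift A" and C: "C \<in> inv_cochains r A d"
  shows "section_pullback A d r C \<in> eq_cochains A d"
proof (rule eq_cochainI[OF A])
  fix a assume "a \<in> A"
  then show "additive_on (cells d) (\<lambda>\<zeta>. section_pullback A d r C (\<zeta>, a))"
    by (rule section_pullback_additive[OF A _ C])
next
  fix J :: "'n set" assume J: "card J = d"
  show "continuous_map (subtopology config_topology A) euclidean
      (\<lambda>a. section_pullback A d r C (frag_of (0, J), a))"
    by (rule continuous_map_window[OF finite_cube_window[of r]])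
      (use J tile_section_window in \<open>simp add: section_pullback_frag_of, metis\<close>)
  show "section_pullback A d r C (frag_of (z, J), a) = section_pullback A d r C (frag_of (0, J), shift z a)"
    if "a \<in> A" for z a
    using inv_cochain_section[OF A C that J] that J shift_in[OF A that]
    by (simp add: section_pullback_frag_of)
qed (auto simp: section_pullback_def)

text \<open>The radius grows by one because agreement of labels on the cell box is only shown to be necessary
  for the gluing of faces.\<close>

lemma section_pullback_loc:
  assumes A: "subshift A" and C: "C \<in> inv_cochains r A d"
  shows "section_pullback A d r C \<in> loc_cochains A d"
proof -
  have "locally_determined A d (Suc r) (section_pullback A d r C)"
    unfolding locally_determined_iff[OF A section_pullback_in[OF A C]]
  proof (intro allI impI ballI)
    fix J a b assume *: "card J = d" "a \<in> A" "b \<in> A" "\<forall>w\<in>cell_box J (Suc r). b w = a w"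
    then have "\<forall>w\<in>cube_window r. b w = a w" using cube_window_subset_cell_box by blast
    then show "section_pullback A d r C (frag_of (0, J), b) = section_pullback A d r C (frag_of (0, J), a)"
      using * tile_section_window[of r b a] by (simp add: section_pullback_frag_of)
  qed
  then show ?thesis using section_pullback_in[OF A C] by (auto simp: loc_cochains_def)
qed

lemma section_pullback_inj:
  assumes A: "subshift A"
  shows "inj_on (section_pullback A d r) (inv_cochains r A d)"
proof (rule inj_onI, rule ext)
  fix C C' \<zeta>
  assume C: "C \<in> inv_cochains r A d" "C' \<in> inv_cochains r A d"
    and eq: "section_pullback A d r C = section_pullback A d r C'"
  show "C \<zeta> = C' \<zeta>"
  proof (cases "\<zeta> \<in> int_chains (tile_cells r A d)")
    case True
    show ?thesis
    proof (rule additive_on_eqI[OF inv_cochain_additive[OF C(1)] inv_cochain_additive[OF C(2)] _ True])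
      fix X assume "X \<in> tile_cells r A d"
      then obtain a x where "X = tile_section r A a x" "a \<in> A" "x \<in> cells d"
        by (auto simp: tile_cells_eq[OF A])
      then show "C (frag_of X) = C' (frag_of X)"
        using section_pullback_frag_of[of a A x d r C] section_pullback_frag_of[of a A x d r C'] eq by simp
    qed
  qed (use inv_cochain_support[OF C(1)] inv_cochain_support[OF C(2)] in auto)
qed

text \<open>\<open>L\<close> descends to the tile complex: the value on a cell is the value of
  \<open>L\<close> at any configuration whose section passes through it.\<close>

lemma section_pullback_surj:
  assumes A: "subshift A" and L: "L \<in> eq_cochains A d" and loc: "locally_determined A d r L"
  shows "L \<in> section_pullback A d r ` inv_cochains r A d"
proof -
  \<comment> \<open>Equal cells force equal positions and directions and agreement on the cell box
    after shifting, which is all that \<open>L\<close> reads.\<close>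
  have wd: "L (frag_of x, a) = L (frag_of y, b)"
    if eq: "tile_section r A a x = tile_section r A b y" and ab: "a \<in> A" "b \<in> A" "x \<in> cells d" for a b x y
  proof -
    obtain z J where x: "x = (z, J)" by (cases x)
    obtain z' J' where y: "y = (z', J')" by (cases y)
    note D = tile_section_eqD[OF eq[unfolded x y]]
    have "y = x" using D x y by simp
    then show ?thesis
      using loc[unfolded locally_determined_iff[OF A L]] D(3) ab x shift_in[OF A]
        eq_cochain_cell[OF L, of J a z] eq_cochain_cell[OF L, of J b z] by simp
  qed
  define v where "v X = (SOME g. \<exists>a\<in>A. \<exists>x\<in>cells d. X = tile_section r A a x \<and> g = L (frag_of x, a))" for X
  have v: "v (tile_section r A a x) = L (frag_of x, a)" if "a \<in> A" "x \<in> cells d" for a x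
  proof -
    have "\<exists>b\<in>A. \<exists>y\<in>cells d. tile_section r A a x = tile_section r A b y \<and>
        v (tile_section r A a x) = L (frag_of y, b)"
      unfolding v_def by (rule someI[of _ "L (frag_of x, a)"]) (use that in blast)
    then show ?thesis using wd that by metis
  qed
  define C where "C \<zeta> = (if \<zeta> \<in> int_chains (tile_cells r A d) then chain_lift v \<zeta> else 0)" for \<zeta>
  have Cv: "C (frag_of (tile_section r A a x)) = L (frag_of x, a)" if "a \<in> A" "x \<in> cells d" for a x
    using tile_section_in[OF A that] v[OF that] by (simp add: C_def)
  have C: "C \<in> inv_cochains r A d"
  proof (rule inv_cochainI[OF A])
    show "additive_on (tile_cells r A d) C"
      by (rule additive_on_cong[OF additive_on_chain_lift[of _ v]]) (simp add: C_def)
    fix w a and x :: "'a cell" assume a: "a \<in> A" and x: "x \<in> cells d"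
    have tx: "translate_cell w x \<in> cells d" using x by (cases x) (simp add: translate_cell_def)
    show "C (frag_of (tile_section r A (shift (- w) a) (translate_cell w x))) = C (frag_of (tile_section r A a x))"
      using eq_cochain_push[OF L, of "frag_of x" "shift (- w) a" w] x a
      by (simp add: Cv tx shift_in[OF A] shift_shift)
  qed (simp add: C_def)
  have "section_pullback A d r C = L"
    by (rule eq_cochain_ext[OF section_pullback_in[OF A C] L A]) (simp add: section_pullback_frag_of Cv)
  then show ?thesis using C by blast
qed

lemma tile_boundary_in:
  assumes A: "subshift A" and X: "X \<in> tile_cells r A (Suc d)"
  shows "tile_boundary r A X \<in> int_chains (tile_cells r A d)"
proof -
  obtain a x where X: "X = tile_section r A a x" "a \<in> A" "x \<in> cells (Suc d)"
    using X by (auto simp: tile_cells_eq[OF A])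
  show ?thesis
    unfolding X(1) tile_boundary_section[OF A X(2)]
    by (rule int_chains_push[OF tile_section_image[OF A X(2)] cell_boundary_in[OF X(3)]])
qed

lemma inv_coboundary_in:
  assumes A: "subshift A" and C: "C \<in> inv_cochains r A d"
  shows "inv_coboundary r A d C \<in> inv_cochains r A (Suc d)"
proof (rule inv_cochainI[OF A])
  show "additive_on (tile_cells r A (Suc d)) (inv_coboundary r A d C)"
    by (rule additive_on_cong[OF additive_on_frag_extend[OF inv_cochain_additive[OF C] tile_boundary_in[OF A]]])
      (auto simp: inv_coboundary_def pullback_def)
  show "inv_coboundary r A d C \<zeta> = 0" if "\<zeta> \<notin> int_chains (tile_cells r A (Suc d))" for \<zeta>
    using that by (simp add: inv_coboundary_def pullback_def)
  fix w a and x :: "'a cell" assume a: "a \<in> A" and x: "x \<in> cells (Suc d)"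
  have tx: "translate_cell w x \<in> cells (Suc d)" using x by (cases x) (simp add: translate_cell_def)
  have a': "shift (- w) a \<in> A" using shift_in[OF A a] .
  have "tile_boundary r A (tile_section r A (shift (- w) a) (translate_cell w x))
      = push (tile_shift w) (tile_boundary r A (tile_section r A a x))"
    by (simp add: tile_boundary_section[OF A a] tile_boundary_section[OF A a'] cell_boundary_translate
        push_push tile_shift_section)
  then show "inv_coboundary r A d C (frag_of (tile_section r A (shift (- w) a) (translate_cell w x)))
      = inv_coboundary r A d C (frag_of (tile_section r A a x))"
    using inv_cochain_shift[OF C tile_boundary_in[OF A tile_section_in[OF A a x]]]
      tile_section_in[OF A a x, of r] tile_section_in[OF A a' tx, of r]
    by (simp add: inv_coboundary_def pullback_def)
qed

lemma section_pullback_coboundary: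
  fixes C :: "('n::{finite,linorder}, 'a, 'g::topological_ab_group_add) tile_cochain"
  assumes A: "subshift A" and C: "C \<in> inv_cochains r A d"
  shows "section_pullback A (Suc d) r (inv_coboundary r A d C) = eq_coboundary d (section_pullback A d r C)"
proof (rule eq_cochain_ext[OF section_pullback_in[OF A inv_coboundary_in[OF A C]]
      eq_coboundary_in[OF A section_pullback_in[OF A C]] A])
  fix J :: "'n set" and a assume J: "card J = Suc d" and a: "a \<in> A"
  have x: "(0, J) \<in> cells (Suc d)" using J by simp
  show "section_pullback A (Suc d) r (inv_coboundary r A d C) (frag_of (0, J), a)
      = eq_coboundary d (section_pullback A d r C) (frag_of (0, J), a)"
    using tile_section_in[OF A a x, of r] cell_boundary_in[OF x] x a
    by (simp add: section_pullback_def eq_coboundary_def inv_coboundary_def pullback_def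
        tile_boundary_section[OF A a])
qed

text \<open>One lemma serves the bonding maps, with \<open>F\<close> the identity, and the maps
  induced by morphisms. If a cell map \<open>f\<close> carries the section of \<open>a\<close> to
  the section of \<open>F a\<close>, then pulling back along \<open>f\<close> amounts to
  substituting \<open>F a\<close>; equivariance of \<open>F\<close> keeps the result
  invariant.\<close>

lemma section_pullback_induced:
  assumes A: "subshift A" and A': "subshift A'"
    and F: "\<And>a. a \<in> A \<Longrightarrow> F a \<in> A'" "\<And>a z. a \<in> A \<Longrightarrow> F (shift z a) = shift z (F a)"
    and f: "\<And>a x. a \<in> A \<Longrightarrow> x \<in> cells d \<Longrightarrow> f (tile_section r A a x) = tile_section r' A' (F a) x"
    and C: "C \<in> inv_cochains r' A' d"
  shows "pullback (tile_cells r A d) (push f) C \<in> inv_cochains r A d"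
    and "section_pullback A d r (pullback (tile_cells r A d) (push f) C)
      = (\<lambda>(\<zeta>, a). if \<zeta> \<in> int_chains (cells d) \<and> a \<in> A then section_pullback A' d r' C (\<zeta>, F a) else 0)"
proof -
  have f_in: "f ` tile_cells r A d \<subseteq> tile_cells r' A' d"
  proof
    fix Y assume "Y \<in> f ` tile_cells r A d"
    then obtain a x where "Y = f (tile_section r A a x)" "a \<in> A" "x \<in> cells d"
      unfolding tile_cells_eq[OF A] by blast
    then show "Y \<in> tile_cells r' A' d" using f F(1) tile_section_in[OF A'] by simp
  qed
  show "pullback (tile_cells r A d) (push f) C \<in> inv_cochains r A d"
  proof (rule inv_cochainI[OF A])
    show "additive_on (tile_cells r A d) (pullback (tile_cells r A d) (push f) C)"
      by (rule additive_on_cong[OF additive_on_push[OF inv_cochain_additive[OF C] f_in]])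
        (simp add: pullback_def)
    show "pullback (tile_cells r A d) (push f) C \<zeta> = 0" if "\<zeta> \<notin> int_chains (tile_cells r A d)" for \<zeta>
      using that by (simp add: pullback_def)
    fix w a and x :: "'a cell" assume a: "a \<in> A" and x: "x \<in> cells d"
    have tx: "translate_cell w x \<in> cells d" using x by (cases x) (simp add: translate_cell_def)
    have a': "shift (- w) a \<in> A" using shift_in[OF A a] .
    show "pullback (tile_cells r A d) (push f) C (frag_of (tile_section r A (shift (- w) a) (translate_cell w x)))
        = pullback (tile_cells r A d) (push f) C (frag_of (tile_section r A a x))"
      using inv_cochain_shift[OF C, of "frag_of (tile_section r' A' (F a) x)" w]
        tile_section_in[OF A a x, of r] tile_section_in[OF A a' tx, of r] tile_section_in[OF A' F(1)[OF a] x, of r']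
      by (simp add: pullback_def f a a' x tx F tile_shift_section)
  qed
  have "push f (push (tile_section r A a) \<zeta>) = push (tile_section r' A' (F a)) \<zeta>"
    if "a \<in> A" "\<zeta> \<in> int_chains (cells d)" for a \<zeta>
    unfolding push_push using that f by (intro push_eqI) auto
  then show "section_pullback A d r (pullback (tile_cells r A d) (push f) C)
      = (\<lambda>(\<zeta>, a). if \<zeta> \<in> int_chains (cells d) \<and> a \<in> A then section_pullback A' d r' C (\<zeta>, F a) else 0)"
    using F(1) int_chains_push[OF tile_section_image[OF A], of _ _ d r]
    by (auto simp: section_pullback_def pullback_def fun_eq_iff)
qed

lemma tile_restrict_section:
  "tile_restrict r A (tile_section (Suc r) A a x) = tile_section r A a x"
proof -
  obtain z J where x: "x = (z, J)" by (cases x)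
  define f :: "('a, 'b) tile_face \<Rightarrow> ('a, 'b) tile_face" where
    "f = (\<lambda>(z, c, J, U). (z, restrict c (cube_window r), J, U))"
  have sub: "cube_window r \<subseteq> (cube_window (Suc r) :: (int ^ 'a) set)" by (rule cube_window_mono) simp
  have rr: "restrict (restrict b (cube_window (Suc r))) (cube_window r) = restrict b (cube_window r)"
    for b :: "('a, 'b) config"
    using sub by (simp add: Int_absorb1)
  have step: "(f t, f u) \<in> glue_step r A" if "(t, u) \<in> glue_step (Suc r) A" for t u
  proof -
    obtain z c J U i c' where tu: "t = (z, c, J, U)" "u = (z + axis i 1, c', J, U - {i})"
      and h: "c \<in> patterns (cube_window (Suc r)) A" "c' \<in> patterns (cube_window (Suc r)) A"
        "J \<inter> U = {}" "i \<in> U" "matching (Suc r) i c c'"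
      using \<open>(t, u) \<in> glue_step (Suc r) A\<close> unfolding glue_step_def by blast
    \<comment> \<open>Matching labels of radius \<open>r + 1\<close> agree on a larger overlap,
      which contains the overlap for radius \<open>r\<close>.\<close>
    have "matching r i (restrict c (cube_window r)) (restrict c' (cube_window r))"
    proof -
      have "u \<in> cube_window r \<and> u - axis i 1 \<in> cube_window r \<and> u \<in> upper_box i (Suc r)"
        if "u \<in> upper_box i r" for u :: "int ^ 'a"
        using that sub by (auto simp: upper_box_def cube_window_def axis_def) (smt (verit))+
      then show ?thesis using h(5) by (auto simp: matching_def)
    qed
    moreover have "restrict c (cube_window r) \<in> patterns (cube_window r) A"
      "restrict c' (cube_window r) \<in> patterns (cube_window r) A"
      using h(1,2) rr by (auto simp: patterns_def)
    ultimately show ?thesis using h(3,4) unfolding glue_step_def f_def tu by auto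
  qed
  have "tile_restrict r A (tile_section (Suc r) A a x)
      = glue r A `` (f ` (glue (Suc r) A `` {(z, restrict (shift z a) (cube_window (Suc r)), J, {})}))"
    by (simp add: tile_restrict_def tile_section_def f_def x)
  also have "\<dots> = glue r A `` {f (z, restrict (shift z a) (cube_window (Suc r)), J, {})}"
    by (rule glue_image) (auto intro: glue_step_in_glue step)
  also have "\<dots> = tile_section r A a x"
    unfolding f_def x tile_section_def case_prod_conv rr ..
  finally show ?thesis .
qed

text \<open>A rule of radius \<open>s\<close> evaluated on the window of radius \<open>r\<close>
  reads only the window of radius \<open>r + s\<close>, so applying \<open>F\<close> to labels makes
  sense and respects matching. The class can then be computed from one face.\<close>

lemma tile_map_section:
  fixes A :: "('n::finite, 'a) config set" and A' :: "('n, 'b) config set"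
  assumes A: "subshift A" and A': "subshift A'" and mor: "subshift_morphism A A' F"
    and rule: "rule_radius A F s" and a: "a \<in> A"
  shows "tile_map A A' F s r (tile_section (r + s) A a x) = tile_section r A' (F a) x"
proof -
  obtain z J where x: "x = (z, J)" by (cases x)
  have F: "F b \<in> A'" "F (shift v b) = shift v (F b)" if "b \<in> A" for b v
    using mor that unfolding subshift_morphism_def by (auto simp: continuous_map)
  \<comment> \<open>\<open>rule_radius\<close> speaks of the value at 0 only. Shifting carries it to
    two sites \<open>u\<close> and \<open>v\<close> that may differ, as is required for neighbouring
    cubes.\<close>
  have local: "F b u = F b' v"
    if "b \<in> A" "b' \<in> A" "\<And>w. w \<in> cube_window s \<Longrightarrow> b (w + u) = b' (w + v)" for b b' u v
  proof -
    have "restrict (shift u b) (cube_window s) = restrict (shift v b') (cube_window s)"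
      using that(3) by (simp add: restrict_eq_iff shift_def)
    then have "F (shift u b) 0 = F (shift v b') 0"
      using rule shift_in[OF A that(1)] shift_in[OF A that(2)] unfolding rule_radius_def by blast
    then show ?thesis using F(2) that(1,2) by (simp add: shift_def)
  qed
  have box: "w + u \<in> cube_window (r + s)"
    if "w \<in> cube_window s" "u \<in> cube_window r" for w u :: "int ^ 'n"
    unfolding cube_window_def
  proof (intro CollectI allI)
    fix i show "- int (r + s) \<le> (w + u) $ i \<and> (w + u) $ i \<le> int (r + s)"
      using that by (auto simp: cube_window_def dest!: spec[of _ i])
  qed
  \<comment> \<open>\<open>tile_map\<close> ranges over configurations; \<open>g\<close> is the
    induced function on patterns, computed with an arbitrary extension in \<open>A\<close>, and
    turns the tile map into a face map.\<close>
  define g where "g c = restrict (F (SOME b. b \<in> A \<and> restrict b (cube_window (r + s)) = c)) (cube_window r)" for c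
  have g: "g (restrict b (cube_window (r + s))) = restrict (F b) (cube_window r)" if b: "b \<in> A" for b
  proof -
    define b' where "b' = (SOME b'. b' \<in> A \<and> restrict b' (cube_window (r + s)) = restrict b (cube_window (r + s)))"
    have b': "b' \<in> A \<and> restrict b' (cube_window (r + s)) = restrict b (cube_window (r + s))"
      unfolding b'_def by (rule someI[of _ b]) (use b in simp)
    have "F b' u = F b u" if u: "u \<in> cube_window r" for u
      by (rule local) (use b b' box[OF _ u] in \<open>auto simp: restrict_eq_iff\<close>)
    then show ?thesis unfolding g_def b'_def[symmetric] by (simp add: restrict_eq_iff)
  qed
  define f :: "('n, 'a) tile_face \<Rightarrow> ('n, 'b) tile_face" where "f = (\<lambda>(z, c, J, U). (z, g c, J, U))"
  have step: "(f t, f u) \<in> glue_step r A'" if tu: "(t, u) \<in> glue_step (r + s) A" for t u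
  proof -
    obtain z c J U i c' where tu: "t = (z, c, J, U)" "u = (z + axis i 1, c', J, U - {i})"
      and h: "c \<in> patterns (cube_window (r + s)) A" "c' \<in> patterns (cube_window (r + s)) A"
        "J \<inter> U = {}" "i \<in> U" "matching (r + s) i c c'"
      using tu unfolding glue_step_def by blast
    obtain b b' where b: "b \<in> A" "c = restrict b (cube_window (r + s))"
      and b': "b' \<in> A" "c' = restrict b' (cube_window (r + s))"
      using h(1,2) by (auto simp: patterns_def)
    have "matching r i (restrict (F b) (cube_window r)) (restrict (F b') (cube_window r))"
      unfolding matching_def
    proof
      fix u :: "int ^ 'n" assume u: "u \<in> upper_box i r"
      have u1: "u \<in> cube_window r" "u - axis i 1 \<in> cube_window r"
        using u by (auto simp: upper_box_def cube_window_def axis_def) (smt (verit))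
      have "F b u = F b' (u - axis i 1)"
      proof (rule local[OF b(1) b'(1)])
        fix w :: "int ^ 'n" assume w: "w \<in> cube_window s"
        have "w + u \<in> upper_box i (r + s)"
          using box[OF w u1(1)] w u by (auto simp: upper_box_def cube_window_def dest!: spec[of _ i])
        then have "c (w + u) = c' (w + u - axis i 1)" using h(5) by (simp add: matching_def)
        then show "b (w + u) = b' (w + (u - axis i 1))"
          using box[OF w u1(1)] box[OF w u1(2)] by (simp add: b b' algebra_simps)
      qed
      then show "restrict (F b) (cube_window r) u = restrict (F b') (cube_window r) (u - axis i 1)"
        using u1 by simp
    qed
    then have "matching r i (g c) (g c')" using g b b' by simp
    moreover have "g c \<in> patterns (cube_window r) A'" "g c' \<in> patterns (cube_window r) A'"
      using g b b' F(1) by (auto simp: patterns_def)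
    ultimately show ?thesis using h(3,4) unfolding glue_step_def f_def tu by auto
  qed
  define t0 where "t0 = (z, restrict (shift z a) (cube_window (r + s)), J, {} :: 'n set)"
  \<comment> \<open>Faces glued to \<open>t0\<close> have admissible labels, so each label in the
    class extends to a configuration of \<open>A\<close>. One inclusion of the set equality below
    rests on this.\<close>
  have pat: "fst (snd t) \<in> patterns (cube_window (r + s)) A" if "(t0, t) \<in> glue (r + s) A" for t
    using that
  proof (induction rule: glue_induct)
    case refl
    show ?case
      using imageI[OF shift_in[OF A a], of "\<lambda>a. restrict a (cube_window (r + s))" z]
      unfolding t0_def patterns_def fst_conv snd_conv .
  qed (auto simp: glue_step_def)
  have "{(z, restrict (F b) (cube_window r), J, U) | z b J U.
      b \<in> A \<and> (z, restrict b (cube_window (r + s)), J, U) \<in> glue (r + s) A `` {t0}}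
    = f ` (glue (r + s) A `` {t0})" (is "?L = ?R")
  proof (intro equalityI subsetI)
    fix t assume "t \<in> ?L"
    then obtain z b J U where b: "b \<in> A" "t = (z, restrict (F b) (cube_window r), J, U)"
      "(z, restrict b (cube_window (r + s)), J, U) \<in> glue (r + s) A `` {t0}" by blast
    then show "t \<in> ?R" using g[OF b(1)]
      by (intro image_eqI[OF _ b(3)]) (simp add: f_def)
  next
    fix t assume "t \<in> ?R"
    then obtain u where u: "t = f u" "(t0, u) \<in> glue (r + s) A" by blast
    obtain z c J U where u': "u = (z, c, J, U)" by (cases u)
    obtain b where b: "b \<in> A" "c = restrict b (cube_window (r + s))"
      using pat[OF u(2)] by (auto simp: u' patterns_def)
    then show "t \<in> ?L" using u g[OF b(1)] by (auto simp: u' f_def)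
  qed
  then have "tile_map A A' F s r (tile_section (r + s) A a x) = glue r A' `` (f ` (glue (r + s) A `` {t0}))"
    by (simp add: tile_map_def tile_section_def t0_def x)
  also have "\<dots> = glue r A' `` {f t0}"
    by (rule glue_image) (auto intro: glue_step_in_glue step)
  also have "\<dots> = tile_section r A' (F a) x"
    using g[OF shift_in[OF A a]] F(2)[OF a] by (simp add: f_def t0_def x tile_section_def)
  finally show ?thesis .
qed

section \<open>The locally determined complex as a union of invariant complexes\<close>

lemma inv_cochains_zero: "(\<lambda>\<zeta>. 0) \<in> inv_cochains r A d"
  by (simp add: inv_cochains_def cochains_def)

lemma inv_cochains_diff:
  assumes "subshift A" "C \<in> inv_cochains r A d" "C' \<in> inv_cochains r A d"
  shows "(\<lambda>\<zeta>. C \<zeta> - C' \<zeta>) \<in> inv_cochains r A d"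
proof -
  have "additive_on (tile_cells r A d) (\<lambda>\<zeta>. C \<zeta> - C' \<zeta>)"
    by (intro additive_on_minus inv_cochain_additive assms)
  then show ?thesis
    using assms(2,3) by (simp add: inv_cochains_def cochains_def additive_on_def)
qed

lemma inv_coboundary_add:
  "inv_coboundary r A d (\<lambda>\<zeta>. C \<zeta> + C' \<zeta>) = (\<lambda>\<zeta>. inv_coboundary r A d C \<zeta> + inv_coboundary r A d C' \<zeta>)"
  by (auto simp: inv_coboundary_def pullback_def)

lemma section_pullback_zero: "section_pullback A d r (\<lambda>\<zeta>. 0) = (\<lambda>p. 0)"
  by (auto simp: section_pullback_def)

lemma section_pullback_diff:
  "section_pullback A d r (\<lambda>\<zeta>. C \<zeta> - C' \<zeta>) = (\<lambda>p. section_pullback A d r C p - section_pullback A d r C' p)"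
  by (auto simp: section_pullback_def)

lemma section_pullback_add:
  "section_pullback A d r (\<lambda>\<zeta>. C \<zeta> + C' \<zeta>) = (\<lambda>p. section_pullback A d r C p + section_pullback A d r C' p)"
  by (auto simp: section_pullback_def)

text \<open>The square of the coboundary is not computed on tile cells: pulled back along sections
  it becomes the square of \<open>eq_coboundary\<close>, which vanishes, and the pullback is
  injective.\<close>

lemma inv_cochain_complex:
  fixes A :: "('n::{finite,linorder}, 'a) config set"
  assumes A: "subshift A"
  shows "cochain_complex (inv_complex r A :: nat \<Rightarrow> ('n, 'a, 'g::topological_ab_group_add) tile_cochain monoid)
    (inv_coboundary r A)"
proof (rule cochain_complex.intro)
  show "comm_group (inv_complex r A d :: ('n, 'a, 'g) tile_cochain monoid)" for d
    unfolding inv_complex_def by (intro comm_group_pointwise_group inv_cochains_zero inv_cochains_diff A)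
  show "inv_coboundary r A d \<in> Group.hom (inv_complex r A d :: ('n, 'a, 'g) tile_cochain monoid)
      (inv_complex r A (Suc d))" for d
    using inv_coboundary_in[OF A] by (auto simp: inv_complex_def Group.hom_def inv_coboundary_add)
  fix C :: "('n, 'a, 'g) tile_cochain" and d assume "C \<in> carrier (inv_complex r A d)"
  then have C: "C \<in> inv_cochains r A d" by (simp add: inv_complex_def)
  note C1 = inv_coboundary_in[OF A C]
  have "section_pullback A (Suc (Suc d)) r (inv_coboundary r A (Suc d) (inv_coboundary r A d C))
      = section_pullback A (Suc (Suc d)) r (\<lambda>\<zeta>. 0)"
    by (simp add: section_pullback_coboundary[OF A C1] section_pullback_coboundary[OF A C]
        eq_coboundary_square_zero[OF section_pullback_in[OF A C]] section_pullback_zero)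
  then have "inv_coboundary r A (Suc d) (inv_coboundary r A d C) = (\<lambda>\<zeta>. 0)"
    by (rule inj_onD[OF section_pullback_inj[OF A]]) (intro inv_coboundary_in[OF A C1] inv_cochains_zero)+
  then show "inv_coboundary r A (Suc d) (inv_coboundary r A d C) = \<one>\<^bsub>inv_complex r A (Suc (Suc d))\<^esub>"
    by (simp add: inv_complex_def)
qed

abbreviation tile_pullback ::
    "('n::finite, 'a) config set \<Rightarrow> nat \<Rightarrow> nat \<Rightarrow>
     ('n, 'a, 'g::ab_group_add) tile_cochain \<Rightarrow> ('n, 'a, 'g) tile_cochain" where
  "tile_pullback A r d \<equiv> pullback (tile_cells (Suc r) A d) (push (tile_restrict r A))"

lemma tile_pullback:
  fixes A :: "('n::finite, 'a) config set"
    and C :: "('n, 'a, 'g::ab_group_add) tile_cochain"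
  assumes A: "subshift A" and C: "C \<in> inv_cochains r A d"
  shows "tile_pullback A r d C \<in> inv_cochains (Suc r) A d"
    and section_pullback_tile_pullback:
      "section_pullback A d (Suc r) (tile_pullback A r d C) = section_pullback A d r C"
proof -
  note induced = section_pullback_induced[OF A A, of "\<lambda>a. a" d "tile_restrict r A" "Suc r" r C,
      OF _ _ tile_restrict_section C, simplified]
  show "tile_pullback A r d C \<in> inv_cochains (Suc r) A d" by (rule induced)
  show "section_pullback A d (Suc r) (tile_pullback A r d C) = section_pullback A d r C"
    unfolding induced(2) by (auto simp: section_pullback_def)
qed

text \<open>The bonding maps become the identity on equivariant cochains, so the images can only
  grow with the radius.\<close>

lemma section_pullback_image_mono:
  assumes A: "subshift A" and "r \<le> s"
  shows "section_pullback A d r ` inv_cochains r A d \<subseteq> section_pullback A d s ` inv_cochains s A d"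
  using \<open>r \<le> s\<close>
proof (induction s rule: dec_induct)
  case (step s)
  have "section_pullback A d s ` inv_cochains s A d
      \<subseteq> section_pullback A d (Suc s) ` inv_cochains (Suc s) A d"
    using tile_pullback[OF A] by (metis image_eqI image_subsetI)
  then show ?case using step.IH by blast
qed simp

text \<open>Since the images increase, the union may start at any \<open>R\<close>, and the unit of
  radius lost in one of the inclusions disappears in it.\<close>

lemma loc_cochains_eq:
  assumes A: "subshift A"
  shows "(loc_cochains A d :: ('n::finite, 'a, 'g::topological_ab_group_add) eq_cochain set)
    = (\<Union>r\<in>{R..}. section_pullback A d r ` inv_cochains r A d)"
proof (intro equalityI subsetI)
  fix L :: "('n, 'a, 'g) eq_cochain" assume "L \<in> loc_cochains A d"
  then obtain r where L: "L \<in> eq_cochains A d" "locally_determined A d r L"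
    by (auto simp: loc_cochains_def)
  then have "L \<in> section_pullback A d r ` inv_cochains r A d" by (rule section_pullback_surj[OF A])
  then have "L \<in> section_pullback A d (max r R) ` inv_cochains (max r R) A d"
    using section_pullback_image_mono[OF A, of r "max r R" d] by auto
  then show "L \<in> (\<Union>r\<in>{R..}. section_pullback A d r ` inv_cochains r A d)"
    by (intro UN_I[of "max r R"]) auto
next
  fix L :: "('n, 'a, 'g) eq_cochain" assume "L \<in> (\<Union>r\<in>{R..}. section_pullback A d r ` inv_cochains r A d)"
  then show "L \<in> loc_cochains A d" using section_pullback_loc[OF A] by blast
qed

text \<open>Two cochains of different radii are represented at the larger radius, where their
  difference is the pullback of a difference.\<close>

lemma loc_cochains_diff:
  assumes A: "subshift A" and "L \<in> loc_cochains A d" "L' \<in> loc_cochains A d"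
  shows "(\<lambda>p. L p - L' p) \<in> loc_cochains A d"
proof -
  obtain r C r' C' where C: "C \<in> inv_cochains r A d" "L = section_pullback A d r C"
    and C': "C' \<in> inv_cochains r' A d" "L' = section_pullback A d r' C'"
    using assms(2,3) unfolding loc_cochains_eq[OF A, of d 0] by blast
  have "L \<in> section_pullback A d (max r r') ` inv_cochains (max r r') A d"
    "L' \<in> section_pullback A d (max r r') ` inv_cochains (max r r') A d"
    using section_pullback_image_mono[OF A, of r "max r r'" d] C
      section_pullback_image_mono[OF A, of r' "max r r'" d] C' by auto
  then obtain D D' where D: "D \<in> inv_cochains (max r r') A d" "D' \<in> inv_cochains (max r r') A d"
    "L = section_pullback A d (max r r') D" "L' = section_pullback A d (max r r') D'" by blast
  then show ?thesis
    using section_pullback_loc[OF A inv_cochains_diff[OF A D(1,2)]] by (simp add: section_pullback_diff)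
qed

lemma loc_coboundary_in:
  fixes A :: "('n::{finite,linorder}, 'a) config set"
    and L :: "('n, 'a, 'g::topological_ab_group_add) eq_cochain"
  assumes A: "subshift A" and L: "L \<in> loc_cochains A d"
  shows "eq_coboundary d L \<in> loc_cochains A (Suc d)"
proof -
  obtain r and C :: "('n, 'a, 'g) tile_cochain" where C: "C \<in> inv_cochains r A d" "L = section_pullback A d r C"
    using L unfolding loc_cochains_eq[OF A, of d 0] by blast
  then show ?thesis
    using section_pullback_loc[OF A inv_coboundary_in[OF A C(1)]] section_pullback_coboundary[OF A C(1)] by simp
qed

lemma loc_cochain_complex:
  fixes A :: "('n::{finite,linorder}, 'a) config set"
  assumes A: "subshift A"
  shows "cochain_complex (loc_complex A :: nat \<Rightarrow> ('n, 'a, 'g::topological_ab_group_add) eq_cochain monoid)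
    eq_coboundary"
proof (rule cochain_complex.intro)
  have zero: "(\<lambda>p. 0) \<in> (loc_cochains A d :: ('n, 'a, 'g) eq_cochain set)" for d
    using section_pullback_loc[OF A inv_cochains_zero, of d 0] by (simp add: section_pullback_zero)
  show "comm_group (loc_complex A d :: ('n, 'a, 'g) eq_cochain monoid)" for d
    unfolding loc_complex_def by (intro comm_group_pointwise_group zero loc_cochains_diff A)
  show "eq_coboundary d \<in> Group.hom (loc_complex A d :: ('n, 'a, 'g) eq_cochain monoid)
      (loc_complex A (Suc d))" for d
    using loc_coboundary_in[OF A] by (auto simp: loc_complex_def Group.hom_def eq_coboundary_add)
  fix C :: "('n, 'a, 'g) eq_cochain" and d assume "C \<in> carrier (loc_complex A d)"
  then have "C \<in> eq_cochains A d" by (auto simp: loc_complex_def loc_cochains_def)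
  then show "eq_coboundary (Suc d) (eq_coboundary d C) = \<one>\<^bsub>loc_complex A (Suc (Suc d))\<^esub>"
    by (simp add: eq_coboundary_square_zero loc_complex_def)
qed

lemma section_pullback_cochain_map:
  fixes A :: "('n::{finite,linorder}, 'a) config set"
  assumes A: "subshift A"
  shows "cochain_map (inv_complex r A :: nat \<Rightarrow> ('n, 'a, 'g::topological_ab_group_add) tile_cochain monoid)
    (inv_coboundary r A) (loc_complex A) eq_coboundary (\<lambda>d. section_pullback A d r)"
proof (intro cochain_map.intro inv_cochain_complex loc_cochain_complex A cochain_map_axioms.intro)
  show "section_pullback A d r \<in> Group.hom (inv_complex r A d :: ('n, 'a, 'g) tile_cochain monoid)
      (loc_complex A d)" for d
    using section_pullback_loc[OF A]
    by (auto simp: inv_complex_def loc_complex_def Group.hom_def section_pullback_add)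
qed (use section_pullback_coboundary[OF A] in \<open>auto simp: inv_complex_def\<close>)

text \<open>\<open>g\<close> is the counterpart of \<open>f\<close> on equivariant cochains. Its
  commutation with coboundaries, assumed on pullbacks of invariant cochains, is transported to
  \<open>f\<close> by injectivity.\<close>

lemma inv_cochain_map:
  fixes A :: "('n::{finite,linorder}, 'a) config set" and A' :: "('n, 'b) config set"
    and f :: "nat \<Rightarrow> ('n, 'b, 'g::topological_ab_group_add) tile_cochain \<Rightarrow> ('n, 'a, 'g) tile_cochain"
    and g :: "nat \<Rightarrow> ('n, 'b, 'g) eq_cochain \<Rightarrow> ('n, 'a, 'g) eq_cochain"
  assumes A: "subshift A" and A': "subshift A'"
    and add: "\<And>d C C'. f d (\<lambda>\<zeta>. C \<zeta> + C' \<zeta>) = (\<lambda>\<zeta>. f d C \<zeta> + f d C' \<zeta>)"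
    and f: "\<And>d C. C \<in> inv_cochains r' A' d \<Longrightarrow> f d C \<in> inv_cochains r A d"
    and fg: "\<And>d C. C \<in> inv_cochains r' A' d \<Longrightarrow>
      section_pullback A d r (f d C) = g d (section_pullback A' d r' C)"
    and g: "\<And>d C. C \<in> inv_cochains r' A' d \<Longrightarrow>
      g (Suc d) (eq_coboundary d (section_pullback A' d r' C)) = eq_coboundary d (g d (section_pullback A' d r' C))"
  shows "cochain_map (inv_complex r' A') (inv_coboundary r' A') (inv_complex r A) (inv_coboundary r A) f"
proof (intro cochain_map.intro inv_cochain_complex A A' cochain_map_axioms.intro)
  show "f d \<in> Group.hom (inv_complex r' A' d) (inv_complex r A d)" for d
    using f add by (auto simp: inv_complex_def Group.hom_def)
  fix C :: "('n, 'b, 'g) tile_cochain" and d assume "C \<in> carrier (inv_complex r' A' d)"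
  then have C: "C \<in> inv_cochains r' A' d" by (simp add: inv_complex_def)
  have "section_pullback A (Suc d) r (f (Suc d) (inv_coboundary r' A' d C))
      = section_pullback A (Suc d) r (inv_coboundary r A d (f d C))"
    using fg[OF inv_coboundary_in[OF A' C]] g[OF C] fg[OF C]
    by (simp add: section_pullback_coboundary[OF A' C] section_pullback_coboundary[OF A f[OF C]])
  then show "f (Suc d) (inv_coboundary r' A' d C) = inv_coboundary r A d (f d C)"
    by (rule inj_onD[OF section_pullback_inj[OF A]]) (intro f inv_coboundary_in A A' C)+
qed

lemma pullback_add: "pullback S f (\<lambda>\<zeta>. C \<zeta> + C' \<zeta>) = (\<lambda>\<zeta>. pullback S f C \<zeta> + pullback S f C' \<zeta>)"
  by (auto simp: pullback_def)

lemma tile_pullback_cochain_map: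
  fixes A :: "('n::{finite,linorder}, 'a) config set"
  assumes A: "subshift A"
  shows "cochain_map (inv_complex r A :: nat \<Rightarrow> ('n, 'a, 'g::topological_ab_group_add) tile_cochain monoid)
    (inv_coboundary r A) (inv_complex (Suc r) A) (inv_coboundary (Suc r) A) (tile_pullback A r)"
  by (rule inv_cochain_map[OF A A, where g = "\<lambda>d C. C"])
    (use tile_pullback[OF A] in \<open>auto simp: pullback_add\<close>)

lemma tile_exhausting_complexes:
  fixes A :: "('n::{finite,linorder}, 'a) config set"
  assumes A: "subshift A"
  shows "exhausting_complexes (\<lambda>r. inv_complex r A :: nat \<Rightarrow> ('n, 'a, 'g::topological_ab_group_add) tile_cochain monoid)
    (\<lambda>r. inv_coboundary r A) (loc_complex A) eq_coboundary (tile_pullback A)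
    (\<lambda>r d. section_pullback A d r) R"
proof (rule exhausting_complexes.intro)
  fix y :: "('n, 'a, 'g) eq_cochain" and d assume "y \<in> carrier (loc_complex A d)"
  then show "\<exists>r\<ge>R. y \<in> section_pullback A d r ` carrier (inv_complex r A d)"
    unfolding loc_complex_def pointwise_group_simps loc_cochains_eq[OF A, of d R]
    by (auto simp: inv_complex_def)
qed (use section_pullback_cochain_map[OF A] tile_pullback_cochain_map[OF A] section_pullback_inj[OF A]
    section_pullback_tile_pullback[OF A] in \<open>auto simp: inv_complex_def\<close>)

definition inv_limit_class ::
    "nat \<Rightarrow> ('n::{finite,linorder}, 'a) config set \<Rightarrow> nat \<Rightarrow> nat \<Rightarrow>
     ('n, 'a, 'g::ab_group_add) tile_cochain \<Rightarrow> ('n, 'a, 'g) inv_class" where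
  "inv_limit_class R A d r C = limit_rel R (\<lambda>r. tile_cohomology r A d) (tile_bond A d) ``
     {(r, coboundaries (inv_complex r A) (inv_coboundary r A) d #>\<^bsub>inv_complex r A d\<^esub> C)}"

text \<open>The abstract limit theorem is applied to the tile complexes. Besides the isomorphism it
  provides a representing cocycle for each class and the value on it, which is what naturality is
  checked with.\<close>

lemma comparison:
  fixes A :: "('n::{finite,linorder}, 'a) config set"
  assumes A: "subshift A"
  shows comparison_iso: "(comparison A d :: ('n, 'a, 'g::topological_ab_group_add) inv_class \<Rightarrow> _)
      \<in> iso (inv_cohomology R A d) (loc_cohomology A d)"
    and comparison_inv_limit_class: "\<And>r C :: ('n, 'a, 'g) tile_cochain. R \<le> r \<Longrightarrow>
      C \<in> cocycles (inv_complex r A) (inv_coboundary r A) d \<Longrightarrow>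
      comparison A d (inv_limit_class R A d r C)
        = coboundaries (loc_complex A) eq_coboundary d #>\<^bsub>loc_complex A d\<^esub> section_pullback A d r C"
    and inv_cohomology_cases: "\<And>X :: ('n, 'a, 'g) inv_class. X \<in> carrier (inv_cohomology R A d) \<Longrightarrow>
      \<exists>r\<ge>R. \<exists>C\<in>cocycles (inv_complex r A) (inv_coboundary r A) d. X = inv_limit_class R A d r C"
proof -
  interpret E: exhausting_complexes
    "\<lambda>r. inv_complex r A :: nat \<Rightarrow> ('n, 'a, 'g::topological_ab_group_add) tile_cochain monoid"
    "\<lambda>r. inv_coboundary r A" "loc_complex A" eq_coboundary "tile_pullback A"
    "\<lambda>r d. section_pullback A d r" R
    by (rule tile_exhausting_complexes[OF A])
  have H: "(\<lambda>r. cohomology (inv_complex r A) (inv_coboundary r A) d)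
      = (\<lambda>r. tile_cohomology r A d :: ('n, 'a, 'g) tile_cochain set monoid)"
    by (simp add: tile_cohomology_def)
  have bond: "E.Hmap d = tile_bond A d"
    by (simp add: tile_bond_def fun_eq_iff)
  note lim = E.cohomology_map_limit[where d = d, unfolded bond H]
  show "(comparison A d :: ('n, 'a, 'g) inv_class \<Rightarrow> _) \<in> iso (inv_cohomology R A d) (loc_cohomology A d)"
    using lim(1) unfolding comparison_def[abs_def] inv_cohomology_def loc_cohomology_def .
  show "comparison A d (inv_limit_class R A d r C)
        = coboundaries (loc_complex A) eq_coboundary d #>\<^bsub>loc_complex A d\<^esub> section_pullback A d r C"
    if "R \<le> r" "C \<in> cocycles (inv_complex r A) (inv_coboundary r A) d" for r and C :: "('n, 'a, 'g) tile_cochain"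
    using lim(2)[OF that] unfolding comparison_def inv_limit_class_def E.\<Psi>.source.cls_def E.\<Psi>.target.cls_def .
  show "\<exists>r\<ge>R. \<exists>C\<in>cocycles (inv_complex r A) (inv_coboundary r A) d. X = inv_limit_class R A d r C"
    if X: "X \<in> carrier (inv_cohomology R A d)" for X :: "('n, 'a, 'g) inv_class"
  proof -
    obtain r Y where r: "r \<ge> R" "Y \<in> carrier (tile_cohomology r A d)"
      "X = limit_rel R (\<lambda>r. tile_cohomology r A d) (tile_bond A d) `` {(r, Y)}"
      using X by (auto simp: inv_cohomology_def direct_limit_def quotient_def)
    then obtain C where "C \<in> cocycles (inv_complex r A) (inv_coboundary r A) d" "Y = E.\<Psi>.source.cls r d C"
      unfolding tile_cohomology_def E.\<Psi>.source.carrier_cohomology by blast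
    then show ?thesis using r by (auto simp: inv_limit_class_def E.\<Psi>.source.cls_def)
  qed
qed

section \<open>Naturality\<close>

lemma bond_add: "bond f r (k + l) x = bond f (r + k) l (bond f r k x)"
  by (induction l) (simp_all add: add.assoc)

text \<open>The two merging points lie \<open>l\<close> and \<open>k'\<close> steps beyond the
  middle stage. Advancing the first by \<open>k'\<close> and the second by \<open>l\<close> brings
  them to a common stage.\<close>

lemma limit_rel_trans:
  assumes "(p, q) \<in> limit_rel R G f" "(q, w) \<in> limit_rel R G f"
  shows "(p, w) \<in> limit_rel R G f"
proof -
  obtain r x s y t z where pqw: "p = (r, x)" "q = (s, y)" "w = (t, z)" by (cases p, cases q, cases w)
  obtain k l where 1: "r + k = s + l" "bond f r k x = bond f s l y"
    using assms(1) unfolding pqw limit_rel_def by blast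
  obtain k' l' where 2: "s + k' = t + l'" "bond f s k' y = bond f t l' z"
    using assms(2) unfolding pqw limit_rel_def by blast
  have "bond f r (k + k') x = bond f s (l + k') y" using 1 by (simp add: bond_add)
  also have "\<dots> = bond f s (k' + l) y" by (simp add: add.commute)
  also have "\<dots> = bond f t (l' + l) z" using 2 by (simp add: bond_add)
  finally have "bond f r (k + k') x = bond f t (l' + l) z" .
  moreover have "r + (k + k') = t + (l' + l)" using 1(1) 2(1) by simp
  ultimately show ?thesis using assms unfolding pqw limit_rel_def by blast
qed

text \<open>Maps that commute with the bonding maps send related pairs to related pairs, so
  saturating the image of a class gives the class of a single image. The bound
  \<open>R \<le> R' + s\<close> ensures that stage \<open>r + s\<close> belongs to the target
  system.\<close>

lemma limit_map_class:
  assumes R: "R \<le> R' + s" and r: "R' \<le> r" and x: "x \<in> carrier (G' r)"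
    and f': "\<And>r x. R' \<le> r \<Longrightarrow> x \<in> carrier (G' r) \<Longrightarrow> f' r x \<in> carrier (G' (Suc r))"
    and \<phi>: "\<And>r x. R' \<le> r \<Longrightarrow> x \<in> carrier (G' r) \<Longrightarrow> \<phi> r x \<in> carrier (G (r + s))"
    and comm: "\<And>r x. R' \<le> r \<Longrightarrow> x \<in> carrier (G' r) \<Longrightarrow> \<phi> (Suc r) (f' r x) = f (r + s) (\<phi> r x)"
  shows "limit_map (limit_rel R G f) s \<phi> (limit_rel R' G' f' `` {(r, x)}) = limit_rel R G f `` {(r + s, \<phi> r x)}"
proof -
  have bond: "bond f' r k x \<in> carrier (G' (r + k)) \<and> bond f (r + s) k (\<phi> r x) = \<phi> (r + k) (bond f' r k x)"
    if "R' \<le> r" "x \<in> carrier (G' r)" for r k x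
  proof (induction k)
    case (Suc k)
    then show ?case using f'[of "r + k" "bond f' r k x"] comm[of "r + k" "bond f' r k x"] that
      by (simp add: ac_simps)
  qed (use that in simp)
  have rel: "((r + s, \<phi> r x), (t + s, \<phi> t y)) \<in> limit_rel R G f" if ty: "((r, x), (t, y)) \<in> limit_rel R' G' f'" for t y
  proof -
    obtain k l where kl: "r + k = t + l" "bond f' r k x = bond f' t l y" and t: "R' \<le> t" "y \<in> carrier (G' t)"
      using ty unfolding limit_rel_def by blast
    have "bond f (r + s) k (\<phi> r x) = bond f (t + s) l (\<phi> t y)"
      using bond[OF r x, of k] bond[OF t, of l] kl by simp
    moreover have "r + s + k = t + s + l" using kl(1) by simp
    ultimately show ?thesis
      using \<phi>[OF r x] \<phi>[OF t] R r t unfolding limit_rel_def by force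
  qed
  have self: "((r, x), (r, x)) \<in> limit_rel R' G' f'"
    using r x unfolding limit_rel_def by auto
  show ?thesis
    unfolding limit_map_def
  proof (intro equalityI subsetI)
    fix q assume "q \<in> limit_rel R G f `` ((\<lambda>(r, x). (r + s, \<phi> r x)) ` (limit_rel R' G' f' `` {(r, x)}))"
    then obtain t y where "((r, x), (t, y)) \<in> limit_rel R' G' f'" "((t + s, \<phi> t y), q) \<in> limit_rel R G f"
      by auto
    then show "q \<in> limit_rel R G f `` {(r + s, \<phi> r x)}"
      using rel limit_rel_trans by blast
  next
    fix q assume "q \<in> limit_rel R G f `` {(r + s, \<phi> r x)}"
    then show "q \<in> limit_rel R G f `` ((\<lambda>(r, x). (r + s, \<phi> r x)) ` (limit_rel R' G' f' `` {(r, x)}))"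
      using self by force
  qed
qed

text \<open>Change of coefficients, with \<open>s = 0\<close>, and morphisms of subshifts with a
  rule of radius \<open>s\<close> are both instances. Compatibility with the bonding maps is assumed
  for cochains and passed on to cohomology.\<close>

lemma limit_map_inv_limit_class:
  fixes A :: "('n::{finite,linorder}, 'a) config set" and A' :: "('n, 'b) config set"
    and \<phi> :: "nat \<Rightarrow> nat \<Rightarrow> ('n, 'b, 'g::topological_ab_group_add) tile_cochain \<Rightarrow>
      ('n, 'a, 'h::topological_ab_group_add) tile_cochain"
  assumes A: "subshift A" and A': "subshift A'"
    and \<phi>: "\<And>r. cochain_map (inv_complex r A') (inv_coboundary r A')
      (inv_complex (r + s) A) (inv_coboundary (r + s) A) (\<phi> r)"
    and comm: "\<And>r C. C \<in> inv_cochains r A' d \<Longrightarrow>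
      \<phi> (Suc r) d (tile_pullback A' r d C) = tile_pullback A (r + s) d (\<phi> r d C)"
    and R: "R \<le> R' + s" "R' \<le> r" and C: "C \<in> cocycles (inv_complex r A') (inv_coboundary r A') d"
  shows "limit_map (limit_rel R (\<lambda>r. tile_cohomology r A d) (tile_bond A d)) s
      (\<lambda>r. cohomology_map (inv_complex (r + s) A) (inv_coboundary (r + s) A) d (\<phi> r d))
      (inv_limit_class R' A' d r C) = inv_limit_class R A d (r + s) (\<phi> r d C)"
proof -
  interpret \<phi>: cochain_map "inv_complex t A'" "inv_coboundary t A'" "inv_complex (t + s) A"
    "inv_coboundary (t + s) A" "\<phi> t" for t by (rule \<phi>)
  interpret \<beta>: cochain_map "inv_complex t A :: nat \<Rightarrow> ('n, 'a, 'h) tile_cochain monoid" "inv_coboundary t A"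
    "inv_complex (Suc t) A" "inv_coboundary (Suc t) A" "tile_pullback A t" for t
    by (rule tile_pullback_cochain_map[OF A])
  interpret \<beta>': cochain_map "inv_complex t A' :: nat \<Rightarrow> ('n, 'b, 'g) tile_cochain monoid" "inv_coboundary t A'"
    "inv_complex (Suc t) A'" "inv_coboundary (Suc t) A'" "tile_pullback A' t" for t
    by (rule tile_pullback_cochain_map[OF A'])
  let ?\<phi> = "\<lambda>r. cohomology_map (inv_complex (r + s) A) (inv_coboundary (r + s) A) d (\<phi> r d)"
  have cls: "\<exists>D\<in>cocycles (inv_complex r A') (inv_coboundary r A') d. x = \<phi>.source.cls r d D"
    if "x \<in> carrier (tile_cohomology r A' d)" for r x
    using that by (auto simp: tile_cohomology_def \<phi>.source.carrier_cohomology)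
  have carrier: "\<phi>.source.cls r d C \<in> carrier (tile_cohomology r A' d)"
    using C by (auto simp: tile_cohomology_def \<phi>.source.carrier_cohomology)
  have maps: "tile_bond A' d r x \<in> carrier (tile_cohomology (Suc r) A' d) \<and>
      ?\<phi> r x \<in> carrier (tile_cohomology (r + s) A d) \<and>
      ?\<phi> (Suc r) (tile_bond A' d r x) = tile_bond A d (r + s) (?\<phi> r x)"
    if x: "x \<in> carrier (tile_cohomology r A' d)" for r x
  proof -
    obtain D where D: "D \<in> cocycles (inv_complex r A') (inv_coboundary r A') d" "x = \<phi>.source.cls r d D"
      using cls[OF x] by blast
    have bx: "tile_bond A' d r x = \<phi>.source.cls (Suc r) d (tile_pullback A' r d D)"
      using \<beta>'.cohomology_map_cls[OF D(1)] D(2) by (simp add: tile_bond_def)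
    have \<phi>x: "?\<phi> r x = \<phi>.target.cls r d (\<phi> r d D)"
      using \<phi>.cohomology_map_cls[OF D(1)] D(2) by simp
    have "?\<phi> (Suc r) (tile_bond A' d r x) = \<phi>.target.cls (Suc r) d (\<phi> (Suc r) d (tile_pullback A' r d D))"
      using \<phi>.cohomology_map_cls[OF \<beta>'.map_cocycle[OF D(1)]] bx by simp
    also have "\<dots> = \<phi>.target.cls (Suc r) d (tile_pullback A (r + s) d (\<phi> r d D))"
      using comm D(1) by (simp add: cocycles_def kernel_def inv_complex_def)
    also have "\<dots> = tile_bond A d (r + s) (?\<phi> r x)"
      using \<beta>.cohomology_map_cls[OF \<phi>.map_cocycle[OF D(1)]] \<phi>x
      by (simp add: tile_bond_def \<beta>.source.cls_def \<phi>.target.cls_def)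
    finally show ?thesis
      using bx \<beta>'.map_cocycle[OF D(1)] \<phi>x \<phi>.map_cocycle[OF D(1)]
      by (simp add: tile_cohomology_def \<phi>.source.carrier_cohomology \<phi>.target.carrier_cohomology)
  qed
  have "limit_map (limit_rel R (\<lambda>r. tile_cohomology r A d) (tile_bond A d)) s ?\<phi>
      (limit_rel R' (\<lambda>r. tile_cohomology r A' d) (tile_bond A' d) `` {(r, \<phi>.source.cls r d C)})
      = limit_rel R (\<lambda>r. tile_cohomology r A d) (tile_bond A d) `` {(r + s, ?\<phi> r (\<phi>.source.cls r d C))}"
    by (rule limit_map_class[OF R], rule carrier) (use maps in blast)+
  then show ?thesis
    using \<phi>.cohomology_map_cls[OF C]
    by (simp add: inv_limit_class_def \<phi>.source.cls_def \<phi>.target.cls_def)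
qed

section \<open>Change of coefficients\<close>

lemma coefficient_hom_zero: "coefficient_hom h \<Longrightarrow> h 0 = 0"
  unfolding coefficient_hom_def by (metis add_cancel_right_right)

lemma coefficient_hom_add: "coefficient_hom h \<Longrightarrow> h (x + y) = h x + h y"
  by (simp add: coefficient_hom_def)

lemma coeff_inv_cochains:
  "coefficient_hom h \<Longrightarrow> C \<in> inv_cochains r A d \<Longrightarrow> h \<circ> C \<in> inv_cochains r A d"
  by (auto simp: inv_cochains_def cochains_def coefficient_hom_add coefficient_hom_zero)

lemma coeff_pullback: "coefficient_hom h \<Longrightarrow> pullback S f (h \<circ> C) = h \<circ> pullback S f C"
  by (auto simp: pullback_def coefficient_hom_zero)

lemma coeff_section_pullback:
  "coefficient_hom h \<Longrightarrow> section_pullback A d r (h \<circ> C) = h \<circ> section_pullback A d r C"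
  by (auto simp: section_pullback_def coefficient_hom_zero)

lemma coeff_eq_coboundary: "coefficient_hom h \<Longrightarrow> eq_coboundary d (h \<circ> C) = h \<circ> eq_coboundary d C"
  by (auto simp: eq_coboundary_def coefficient_hom_zero)

lemma coeff_loc_cochains:
  assumes A: "subshift A" and h: "coefficient_hom h" and L: "L \<in> loc_cochains A d"
  shows "h \<circ> L \<in> loc_cochains A d"
proof -
  obtain r C where C: "C \<in> inv_cochains r A d" "L = section_pullback A d r C"
    using L unfolding loc_cochains_eq[OF A, of d 0] by blast
  then show ?thesis
    using section_pullback_loc[OF A coeff_inv_cochains[OF h C(1)]] by (simp add: coeff_section_pullback[OF h])
qed

lemma coeff_inv_cochain_map:
  fixes A :: "('n::{finite,linorder}, 'a) config set"
    and h :: "'g::topological_ab_group_add \<Rightarrow> 'h::topological_ab_group_add"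
  assumes A: "subshift A" and h: "coefficient_hom h"
  shows "cochain_map (inv_complex r A) (inv_coboundary r A) (inv_complex r A) (inv_coboundary r A)
    (\<lambda>d C. h \<circ> C)"
  by (intro cochain_map.intro inv_cochain_complex A cochain_map_axioms.intro)
    (auto simp: inv_complex_def Group.hom_def coeff_inv_cochains[OF h] coefficient_hom_add[OF h]
      coeff_pullback[OF h] inv_coboundary_def fun_eq_iff)

lemma coeff_loc_cochain_map:
  fixes A :: "('n::{finite,linorder}, 'a) config set"
    and h :: "'g::topological_ab_group_add \<Rightarrow> 'h::topological_ab_group_add"
  assumes A: "subshift A" and h: "coefficient_hom h"
  shows "cochain_map (loc_complex A) eq_coboundary (loc_complex A) eq_coboundary (\<lambda>d C. h \<circ> C)"
  by (intro cochain_map.intro loc_cochain_complex A cochain_map_axioms.intro)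
    (auto simp: loc_complex_def Group.hom_def coeff_loc_cochains[OF A h] coefficient_hom_add[OF h]
      coeff_eq_coboundary[OF h] fun_eq_iff)

text \<open>On a representing cocycle both sides are the class of \<open>h\<close> composed with the
  pulled-back cochain. Composition with \<open>h\<close> commutes with pulling back because
  \<open>h 0 = 0\<close> respects the extension by 0.\<close>

lemma comparison_coeff:
  fixes A :: "('n::{finite,linorder}, 'a) config set"
    and h :: "'g::topological_ab_group_add \<Rightarrow> 'h::topological_ab_group_add"
  assumes A: "subshift A" and h: "coefficient_hom h" and X: "X \<in> carrier (inv_cohomology R A d)"
  shows "comparison A d (inv_coeff_map R A d h X) = loc_coeff_map A d h (comparison A d X)"
proof -
  obtain r C where r: "R \<le> r" and C: "C \<in> cocycles (inv_complex r A) (inv_coboundary r A) d"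
    and X: "X = inv_limit_class R A d r C"
    using inv_cohomology_cases[OF A X] by blast
  interpret I: cochain_map "inv_complex r A :: nat \<Rightarrow> ('n, 'a, 'g) tile_cochain monoid" "inv_coboundary r A"
    "inv_complex r A :: nat \<Rightarrow> ('n, 'a, 'h) tile_cochain monoid" "inv_coboundary r A" "\<lambda>d C. h \<circ> C"
    by (rule coeff_inv_cochain_map[OF A h])
  interpret L: cochain_map "loc_complex A :: nat \<Rightarrow> ('n, 'a, 'g) eq_cochain monoid" eq_coboundary
    "loc_complex A :: nat \<Rightarrow> ('n, 'a, 'h) eq_cochain monoid" eq_coboundary "\<lambda>d C. h \<circ> C"
    by (rule coeff_loc_cochain_map[OF A h])
  interpret \<Psi>: cochain_map "inv_complex r A :: nat \<Rightarrow> ('n, 'a, 'g) tile_cochain monoid" "inv_coboundary r A"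
    "loc_complex A" eq_coboundary "\<lambda>d. section_pullback A d r"
    by (rule section_pullback_cochain_map[OF A])
  have "inv_coeff_map R A d h X = inv_limit_class R A d r (h \<circ> C)"
    using limit_map_inv_limit_class[OF A A, of 0 "\<lambda>r d C. h \<circ> C" d R R r C] coeff_inv_cochain_map[OF A h]
      r C X by (simp add: inv_coeff_map_def coeff_pullback[OF h])
  then have "comparison A d (inv_coeff_map R A d h X) = L.target.cls d (section_pullback A d r (h \<circ> C))"
    using comparison_inv_limit_class[OF A r I.map_cocycle[OF C]] by (simp add: L.target.cls_def)
  also have "\<dots> = loc_coeff_map A d h (L.source.cls d (section_pullback A d r C))"
    using L.cohomology_map_cls[OF \<Psi>.map_cocycle[OF C]]
    by (simp add: loc_coeff_map_def coeff_section_pullback[OF h])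
  also have "L.source.cls d (section_pullback A d r C) = comparison A d X"
    using comparison_inv_limit_class[OF A r C] X by (simp add: L.source.cls_def)
  finally show ?thesis .
qed

section \<open>Pullback along morphisms of subshifts\<close>

definition config_pullback ::
    "('n::finite, 'a) config set \<Rightarrow> (('n, 'a) config \<Rightarrow> ('n, 'b) config) \<Rightarrow> nat \<Rightarrow>
     ('n, 'b, 'g::ab_group_add) eq_cochain \<Rightarrow> ('n, 'a, 'g) eq_cochain" where
  "config_pullback A F d L = (\<lambda>(\<zeta>, a). if \<zeta> \<in> int_chains (cells d) \<and> a \<in> A then L (\<zeta>, F a) else 0)"

lemma config_pullback_coboundary:
  "config_pullback A F (Suc d) (eq_coboundary d L) = eq_coboundary d (config_pullback A F d L)"
proof (rule ext, clarify)
  fix \<zeta> :: "'a cell \<Rightarrow>\<^sub>0 int" and a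
  have "frag_extend cell_boundary \<zeta> \<in> int_chains (cells d)" if "\<zeta> \<in> int_chains (cells (Suc d))"
    using int_chains_frag_extend[OF cell_boundary_in that] .
  then show "config_pullback A F (Suc d) (eq_coboundary d L) (\<zeta>, a)
      = eq_coboundary d (config_pullback A F d L) (\<zeta>, a)"
    by (auto simp: config_pullback_def eq_coboundary_def)
qed

locale local_morphism =
  fixes A :: "('n::{finite,linorder}, 'a) config set" and A' :: "('n, 'b) config set"
    and F :: "('n, 'a) config \<Rightarrow> ('n, 'b) config" and s :: nat
  assumes A: "subshift A" and A': "subshift A'" and morphism: "subshift_morphism A A' F"
    and radius: "rule_radius A F s"
begin

abbreviation P :: "nat \<Rightarrow> nat \<Rightarrow> ('n, 'b, 'g::topological_ab_group_add) tile_cochain \<Rightarrow>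
    ('n, 'a, 'g) tile_cochain" where
  "P r d \<equiv> pullback (tile_cells (r + s) A d) (push (tile_map A A' F s r))"

lemma P_in: "C \<in> inv_cochains r A' d \<Longrightarrow> P r d C \<in> inv_cochains (r + s) A d"
  and section_P: "C \<in> inv_cochains r A' d \<Longrightarrow>
    section_pullback A d (r + s) (P r d C) = config_pullback A F d (section_pullback A' d r C)"
proof -
  have F: "F a \<in> A'" "F (shift z a) = shift z (F a)" if "a \<in> A" for a z
    using morphism that unfolding subshift_morphism_def by (auto simp: continuous_map)
  assume C: "C \<in> inv_cochains r A' d"
  note induced = section_pullback_induced[OF A A' F tile_map_section[OF A A' morphism radius] C]
  show "P r d C \<in> inv_cochains (r + s) A d" by (rule induced)
  show "section_pullback A d (r + s) (P r d C) = config_pullback A F d (section_pullback A' d r C)"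
    unfolding config_pullback_def by (rule induced)
qed

lemma P_cochain_map:
  "cochain_map (inv_complex r A' :: nat \<Rightarrow> ('n, 'b, 'g::topological_ab_group_add) tile_cochain monoid)
    (inv_coboundary r A') (inv_complex (r + s) A) (inv_coboundary (r + s) A) (P r)"
  by (rule inv_cochain_map[OF A A' pullback_add P_in section_P config_pullback_coboundary])

text \<open>Both composites correspond to substituting \<open>F a\<close> in the same equivariant
  cochain, so they agree by injectivity.\<close>

lemma P_tile_pullback:
  assumes C: "C \<in> inv_cochains r A' d"
  shows "P (Suc r) d (tile_pullback A' r d C) = tile_pullback A (r + s) d (P r d C)"
proof -
  note T = tile_pullback[OF A P_in[OF C]] and T' = tile_pullback[OF A' C]
  have "section_pullback A d (Suc (r + s)) (P (Suc r) d (tile_pullback A' r d C))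
      = section_pullback A d (Suc (r + s)) (tile_pullback A (r + s) d (P r d C))"
    using section_P[OF T'(1)] section_P[OF C] T(2) T'(2) by simp
  then show ?thesis
    by (rule inj_onD[OF section_pullback_inj[OF A]]) (use P_in[OF T'(1)] T(1) in simp_all)
qed

text \<open>Instead of estimating a new radius, the cochain is written as a pullback from a tile
  complex of radius \<open>r\<close>; the substitution then comes from the tile complex of radius
  \<open>r + s\<close>.\<close>

lemma config_pullback_loc:
  assumes L: "L \<in> loc_cochains A' d"
  shows "config_pullback A F d L \<in> loc_cochains A d"
proof -
  obtain r C where C: "C \<in> inv_cochains r A' d" "L = section_pullback A' d r C"
    using L unfolding loc_cochains_eq[OF A', of d 0] by blast
  then show ?thesis
    using section_pullback_loc[OF A P_in[OF C(1)]] by (simp add: section_P[OF C(1)])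
qed

lemma config_pullback_cochain_map:
  "cochain_map (loc_complex A' :: nat \<Rightarrow> ('n, 'b, 'g::topological_ab_group_add) eq_cochain monoid)
    eq_coboundary (loc_complex A) eq_coboundary (config_pullback A F)"
proof (intro cochain_map.intro loc_cochain_complex A A' cochain_map_axioms.intro)
  have "config_pullback A F d (\<lambda>p. L p + L' p)
      = (\<lambda>p. config_pullback A F d L p + config_pullback A F d L' p)"
    for d and L L' :: "('n, 'b, 'g) eq_cochain"
    by (auto simp: config_pullback_def)
  then show "config_pullback A F d \<in> Group.hom (loc_complex A' d :: ('n, 'b, 'g) eq_cochain monoid)
      (loc_complex A d)" for d
    using config_pullback_loc by (auto simp: loc_complex_def Group.hom_def)
qed (rule config_pullback_coboundary)

text \<open>On a cocycle of radius \<open>r\<close> the left side passes through the tile complex of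
  radius \<open>r + s\<close>, while the right side substitutes \<open>F a\<close> directly;
  \<open>section_P\<close> identifies the two cochains.\<close>

lemma comparison_pullback:
  fixes X :: "('n, 'b, 'g::topological_ab_group_add) inv_class"
  assumes R: "R \<le> R' + s" and X: "X \<in> carrier (inv_cohomology R' A' d)"
  shows "comparison A d (inv_pullback R A A' d F s X) = loc_pullback A d F (comparison A' d X)"
proof -
  obtain r C where r: "R' \<le> r" and C: "C \<in> cocycles (inv_complex r A') (inv_coboundary r A') d"
    and X: "X = inv_limit_class R' A' d r C"
    using inv_cohomology_cases[OF A' X] by blast
  interpret I: cochain_map "inv_complex r A' :: nat \<Rightarrow> ('n, 'b, 'g) tile_cochain monoid" "inv_coboundary r A'"
    "inv_complex (r + s) A" "inv_coboundary (r + s) A" "P r"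
    by (rule P_cochain_map)
  interpret L: cochain_map "loc_complex A' :: nat \<Rightarrow> ('n, 'b, 'g) eq_cochain monoid" eq_coboundary
    "loc_complex A" eq_coboundary "config_pullback A F"
    by (rule config_pullback_cochain_map)
  interpret \<Psi>: cochain_map "inv_complex r A' :: nat \<Rightarrow> ('n, 'b, 'g) tile_cochain monoid" "inv_coboundary r A'"
    "loc_complex A'" eq_coboundary "\<lambda>d. section_pullback A' d r"
    by (rule section_pullback_cochain_map[OF A'])
  have Ci: "C \<in> inv_cochains r A' d" using C by (simp add: I.source.cocycles_iff inv_complex_def)
  have rs: "R \<le> r + s" using R r by simp
  have "inv_pullback R A A' d F s X = inv_limit_class R A d (r + s) (P r d C)"
    unfolding inv_pullback_def X
    by (rule limit_map_inv_limit_class[OF A A' P_cochain_map P_tile_pullback R r C])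
  then have "comparison A d (inv_pullback R A A' d F s X)
      = L.target.cls d (section_pullback A d (r + s) (P r d C))"
    using comparison_inv_limit_class[OF A rs I.map_cocycle[OF C]] by (simp add: L.target.cls_def)
  also have "\<dots> = loc_pullback A d F (L.source.cls d (section_pullback A' d r C))"
    using L.cohomology_map_cls[OF \<Psi>.map_cocycle[OF C]]
    by (simp add: loc_pullback_def section_P[OF Ci] config_pullback_def[abs_def])
  also have "L.source.cls d (section_pullback A' d r C) = comparison A' d X"
    using comparison_inv_limit_class[OF A' r C] X by (simp add: L.source.cls_def)
  finally show ?thesis .
qed

end

section \<open>Dynamical cocycles and edge cochains\<close>

text \<open>The antidifference is the sum of \<open>h\<close> from 0 to \<open>t\<close> taken with
  sign. The case \<open>t = -1\<close> is separate because \<open>t + 1\<close> already falls into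
  the other branch.\<close>

lemma int_antidifference:
  fixes h :: "int \<Rightarrow> 'g::ab_group_add"
  shows "\<exists>F. \<forall>t. F (t + 1) - F t = h t"
proof (intro exI[of _ "\<lambda>t. if t \<ge> 0 then sum h {0..<t} else - sum h {t..<0}"] allI)
  fix t :: int
  consider "t \<ge> 0" | "t = -1" | "t < -1" by linarith
  then show "(if t + 1 \<ge> 0 then sum h {0..<t + 1} else - sum h {t + 1..<0})
      - (if t \<ge> 0 then sum h {0..<t} else - sum h {t..<0}) = h t"
  proof cases
    case 1
    then have "{0..<t + 1} = insert t {0..<t}" by auto
    then show ?thesis using 1 by simp
  next
    case 2
    have "{-1..<0::int} = {-1}" by auto
    then show ?thesis using 2 by simp
  next
    case 3
    then have "{t..<0} = insert t {t + 1..<0}" by auto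
    then show ?thesis using 3 by simp
  qed
qed

text \<open>The directions are integrated one at a time: once \<open>f\<close> is a potential in the directions of \<open>S\<close>, the
  defect in direction \<open>k\<close> is invariant under the translations along \<open>S\<close>, so summing it in
  direction \<open>k\<close> does not disturb them.\<close>

lemma lattice_potential:
  fixes g :: "'n::finite \<Rightarrow> int ^ 'n \<Rightarrow> 'g::ab_group_add"
  assumes closed: "\<And>i j z. g i (z + axis j 1) - g i z = g j (z + axis i 1) - g j z"
  shows "\<exists>f. \<forall>j z. f (z + axis j 1) - f z = g j z"
proof -
  have "\<exists>f. \<forall>j\<in>S. \<forall>z. f (z + axis j 1) - f z = g j z" if "finite S" for S
    using that
  proof induction
    case (insert k S)
    then obtain f where f: "\<And>j z. j \<in> S \<Longrightarrow> f (z + axis j 1) - f z = g j z" by blast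
    obtain I :: "(int \<Rightarrow> 'g) \<Rightarrow> int \<Rightarrow> 'g" where I: "\<And>h t. I h (t + 1) - I h t = h t"
      using int_antidifference by metis
    define h where "h z = g k z - (f (z + axis k 1) - f z)" for z
    have h: "h (z + axis j 1) = h z" if j: "j \<in> S" for j z
    proof -
      have "g k (z + axis j 1) - g k z = g j (z + axis k 1) - g j z" by (rule closed)
      then show ?thesis
        using f[OF j, of "z + axis k 1"] f[OF j, of z] by (simp add: h_def algebra_simps)
    qed
    \<comment> \<open>The defect is summed along the line through \<open>z\<close> in direction
      \<open>k\<close>: \<open>z + axis k (t - z $ k)\<close> is the point of that line with
      coordinate \<open>t\<close>, so \<open>z\<close> and \<open>z + axis k 1\<close> use the same
      summands.\<close>
    define H where "H z = I (\<lambda>t. h (z + axis k (t - z $ k))) (z $ k)" for z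
    have Hk: "H (z + axis k 1) - H z = h z" for z
    proof -
      have "z + axis k 1 + axis k (t - (z $ k + 1)) = z + axis k (t - z $ k)" for t
        by (auto simp: vec_eq_iff axis_def)
      moreover have "(z + axis k 1) $ k = z $ k + 1" by (simp add: axis_def)
      moreover have "z + axis k (z $ k - z $ k) = z" by (auto simp: vec_eq_iff axis_def)
      ultimately show ?thesis
        using I[of "\<lambda>t. h (z + axis k (t - z $ k))" "z $ k"] by (simp only: H_def)
    qed
    have Hj: "H (z + axis j 1) = H z" if j: "j \<in> S" for j z
    proof -
      have "j \<noteq> k" using j insert.hyps by blast
      then have k: "(z + axis j 1) $ k = z $ k" by (simp add: axis_def)
      have "z + axis j 1 + axis k (t - z $ k) = z + axis k (t - z $ k) + axis j 1" for t
        by (simp add: algebra_simps)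
      then show ?thesis by (simp only: H_def k h[OF j])
    qed
    have "f (z + axis j 1) + H (z + axis j 1) - (f z + H z) = g j z" if "j \<in> insert k S" for j z
    proof (cases "j = k")
      case True
      have "f (z + axis k 1) + H (z + axis k 1) - (f z + H z) = f (z + axis k 1) - f z + (H (z + axis k 1) - H z)"
        by simp
      then show ?thesis using True by (simp only: Hk) (simp add: h_def)
    next
      case False
      then show ?thesis using that Hj[of j z] f[of j z] by (simp add: algebra_simps)
    qed
    then show ?case by (intro exI[of _ "\<lambda>z. f z + H z"]) blast
  qed simp
  from this[of UNIV] show ?thesis by simp
qed

text \<open>Coordinates are filled in one at a time: an induction on the set of coordinates allowed
  to be nonzero, with an integer induction in both directions for each new one.\<close>

lemma lattice_induct [case_names zero add diff]:
  fixes z :: "int ^ 'n::finite"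
  assumes zero: "P 0" and add: "\<And>z j. P z \<Longrightarrow> P (z + axis j 1)" and diff: "\<And>z j. P z \<Longrightarrow> P (z - axis j 1)"
  shows "P z"
proof -
  have "\<forall>z. (\<forall>i. i \<notin> S \<longrightarrow> z $ i = 0) \<longrightarrow> P z" if "finite S" for S
    using that
  proof induction
    case empty
    then show ?case using zero by (metis empty_iff vec_eq_iff zero_index)
  next
    case (insert k S)
    show ?case
    proof (intro allI impI)
      fix z :: "int ^ 'n" assume z: "\<forall>i. i \<notin> insert k S \<longrightarrow> z $ i = 0"
      define w where "w = z - axis k (z $ k)"
      have "P w" using insert.IH z by (auto simp: w_def axis_def)
      then have "P (w + axis k m)" for m
      proof (induction m rule: int_induct[where k = 0])
        case base
        have "w + axis k 0 = w" by (simp add: vec_eq_iff axis_def)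
        then show ?case using base by (simp only:)
      next
        case (step1 i)
        have "w + axis k (i + 1) = w + axis k i + axis k 1" by (auto simp: vec_eq_iff axis_def)
        then show ?case using add step1 by metis
      next
        case (step2 i)
        have "w + axis k (i - 1) = w + axis k i - axis k 1" by (auto simp: vec_eq_iff axis_def)
        then show ?case using diff step2 by metis
      qed
      then have "P (w + axis k (z $ k))" .
      then show "P z" by (simp add: w_def)
    qed
  qed
  from this[of UNIV] show ?thesis by simp
qed

lemma dy_cocycleI:
  assumes "\<And>z. continuous_map (subtopology config_topology A) euclidean (\<lambda>a. C (z, a))"
    and "\<And>y z a. a \<in> A \<Longrightarrow> C (y + z, a) = C (y, shift z a) + C (z, a)"
    and "\<And>z a. a \<notin> A \<Longrightarrow> C (z, a) = 0"
  shows "C \<in> dy_cocycles A"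
  using assms by (auto simp: dy_cocycles_def continuous_map_prod_discrete)

lemma dy_cocycleD:
  assumes "C \<in> dy_cocycles A"
  shows dy_cocycle_continuous: "continuous_map (subtopology config_topology A) euclidean (\<lambda>a. C (z, a))"
    and dy_cocycle_add: "a \<in> A \<Longrightarrow> C (y + z, a) = C (y, shift z a) + C (z, a)"
    and dy_cocycle_support: "a \<notin> A \<Longrightarrow> C (z, a) = 0"
  using assms by (auto simp: dy_cocycles_def continuous_map_prod_discrete)

text \<open>The cocycle identity expresses all values through those on the generators
  \<open>axis j 1\<close> at various configurations.\<close>

lemma dy_cocycle_ext:
  fixes A :: "('n::finite, 'a) config set" and C C' :: "('n, 'a, 'g::topological_ab_group_add) dy_cochain"
  assumes A: "subshift A" and C: "C \<in> dy_cocycles A" and C': "C' \<in> dy_cocycles A"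
    and eq: "\<And>j a. a \<in> A \<Longrightarrow> C (axis j 1, a) = C' (axis j 1, a)"
  shows "C = C'"
proof -
  have "\<forall>a\<in>A. C (z, a) = C' (z, a)" for z
  proof (induction z rule: lattice_induct)
    case zero
    show ?case using dy_cocycle_add[OF C, of _ 0 0] dy_cocycle_add[OF C', of _ 0 0] by simp
  next
    case (add z j)
    then show ?case
      using dy_cocycle_add[OF C, of _ z "axis j 1"] dy_cocycle_add[OF C', of _ z "axis j 1"] eq shift_in[OF A]
      by simp
  next
    case (diff z j)
    show ?case
    proof
      fix a assume a: "a \<in> A"
      \<comment> \<open>The identity for \<open>(z - axis j 1) + axis j 1\<close> contains the
        wanted value at a shifted configuration, so it is applied at the preimage \<open>b\<close>
        of \<open>a\<close>.\<close>
      define b where "b = shift (- axis j 1) a"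
      have b: "b \<in> A" "shift (axis j 1) b = a" using shift_in[OF A a] by (auto simp: b_def shift_shift)
      show "C (z - axis j 1, a) = C' (z - axis j 1, a)"
        using dy_cocycle_add[OF C b(1), of "z - axis j 1" "axis j 1"]
          dy_cocycle_add[OF C' b(1), of "z - axis j 1" "axis j 1"] diff.IH eq[OF b(1)] b
        by simp
    qed
  qed
  then show ?thesis
    using dy_cocycle_support[OF C] dy_cocycle_support[OF C'] by (auto simp: fun_eq_iff) metis
qed

lemma dy_coboundary_cocycle:
  fixes A :: "('n::finite, 'a) config set" and B :: "('n, 'a) config \<Rightarrow> 'g::topological_ab_group_add"
  assumes A: "subshift A" and B: "continuous_map (subtopology config_topology A) euclidean B"
  shows "(\<lambda>(z, a). if a \<in> A then B (shift z a) - B a else 0) \<in> dy_cocycles A"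
proof (rule dy_cocycleI)
  fix z
  have "continuous_map (subtopology config_topology A) euclidean (\<lambda>a. B (shift z a))"
    using continuous_map_compose[OF continuous_map_shift[OF A] B] by (simp add: o_def)
  then have "continuous_map (subtopology config_topology A) euclidean (\<lambda>a. B (shift z a) - B a)"
    by (rule continuous_map_group_diff[OF _ B])
  then show "continuous_map (subtopology config_topology A) euclidean
      (\<lambda>a. (\<lambda>(z, a). if a \<in> A then B (shift z a) - B a else 0) (z, a))"
    by (rule continuous_map_eq) auto
qed (auto simp: shift_in[OF A] shift_shift)

lemma comm_group_dy_cocycles:
  fixes A :: "('n::finite, 'a) config set"
  shows "comm_group (pointwise_group (dy_cocycles A :: ('n, 'a, 'g::topological_ab_group_add) dy_cochain set))"
proof (rule comm_group_pointwise_group)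
  show "(\<lambda>p. 0) \<in> (dy_cocycles A :: ('n, 'a, 'g) dy_cochain set)"
    by (rule dy_cocycleI) auto
  fix C C' :: "('n, 'a, 'g) dy_cochain" assume C: "C \<in> dy_cocycles A" "C' \<in> dy_cocycles A"
  show "(\<lambda>p. C p - C' p) \<in> dy_cocycles A"
    by (rule dy_cocycleI)
      (use dy_cocycleD[OF C(1)] dy_cocycleD[OF C(2)] in \<open>auto intro!: continuous_map_group_diff\<close>)
qed

section \<open>Boundaries of edges and squares, and the cocycle condition in degree one\<close>

lemma cell_boundary_edge: "cell_boundary (z, {j}) = frag_of (z + axis j 1, {}) - frag_of (z, {})"
proof -
  have "{i \<in> {j}. i < j} = {}" by auto
  then have "incidence_sign {j} j = 1" by (simp only: incidence_sign_def card.empty power_0)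
  then show ?thesis by (simp add: cell_boundary_def)
qed

lemma cell_boundary_square:
  assumes "i < j"
  shows "cell_boundary (z, {i, j}) = (frag_of (z + axis i 1, {j}) - frag_of (z, {j}))
    - (frag_of (z + axis j 1, {i}) - frag_of (z, {i}))"
proof -
  have "{k \<in> {i, j}. k < i} = {}" "{k \<in> {i, j}. k < j} = {i}" using assms by auto
  then have "incidence_sign {i, j} i = 1" "incidence_sign {i, j} j = - 1"
    by (simp_all only: incidence_sign_def card.empty power_0) simp_all
  moreover have "{i, j} - {i} = {j}" "{i, j} - {j} = {i}" "i \<noteq> j" using assms by auto
  ultimately show ?thesis by (simp add: cell_boundary_def)
qed

lemma eq_coboundary_edge:
  fixes A :: "('n::{finite,linorder}, 'a) config set"
  assumes b: "b \<in> eq_cochains A 0" and a: "a \<in> A"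
  shows "eq_coboundary 0 b (frag_of (0, {j}), a) = b (frag_of (0, {}), shift (axis j 1) a) - b (frag_of (0, {}), a)"
proof -
  have "b (frag_of (axis j 1, {}) - frag_of (0, {}), a) = b (frag_of (axis j 1, {}), a) - b (frag_of (0, {}), a)"
    by (rule additive_on_diff[OF eq_cochain_additive[OF b a]]) auto
  then show ?thesis
    using eq_cochain_cell[OF b _ a, of "{}" "axis j 1"] by (simp add: eq_coboundary_def cell_boundary_edge)
qed

lemma eq_coboundary_square:
  fixes A :: "('n::{finite,linorder}, 'a) config set"
  assumes L: "L \<in> eq_cochains A 1" and a: "a \<in> A" and ij: "i < j"
  shows "eq_coboundary 1 L (frag_of (0, {i, j}), a)
    = (L (frag_of (0, {j}), shift (axis i 1) a) - L (frag_of (0, {j}), a))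
    - (L (frag_of (0, {i}), shift (axis j 1) a) - L (frag_of (0, {i}), a))"
proof -
  note d = additive_on_diff[OF eq_cochain_additive[OF L a]]
  have int: "frag_of (z, {k}) \<in> int_chains (cells 1)" for z and k :: 'n by simp
  have "eq_coboundary 1 L (frag_of (0, {i, j}), a)
      = (L (frag_of (axis i 1, {j}), a) - L (frag_of (0, {j}), a))
      - (L (frag_of (axis j 1, {i}), a) - L (frag_of (0, {i}), a))"
    using ij int int_chains_diff[OF int int]
    by (simp add: eq_coboundary_def cell_boundary_square[OF ij] d del: carrier_free_Abelian_group_iff
        frag_of_in_free_Abelian_group)
      (simp add: card_insert_if)
  then show ?thesis
    using eq_cochain_cell[OF L _ a, of "{j}" "axis i 1"] eq_cochain_cell[OF L _ a, of "{i}" "axis j 1"] by simp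
qed

text \<open>Only the values of \<open>C\<close> on generators are kept. In degree one a direction
  set is a singleton, and \<open>the_elem J\<close> is its direction.\<close>

definition edge_cochain ::
    "('n::finite, 'a) config set \<Rightarrow> ('n, 'a, 'g::topological_ab_group_add) dy_cochain \<Rightarrow> ('n, 'a, 'g) eq_cochain" where
  "edge_cochain A C = eq_cochain_of A 1 (\<lambda>J a. C (axis (the_elem J) 1, a))"

lemma edge_cochain_cell:
  "a \<in> A \<Longrightarrow> edge_cochain A C (frag_of (0, {j}), a) = C (axis j 1, a)"
  by (simp add: edge_cochain_def)

lemma edge_cochain_in: "subshift A \<Longrightarrow> C \<in> dy_cocycles A \<Longrightarrow> edge_cochain A C \<in> eq_cochains A 1"
  unfolding edge_cochain_def by (intro eq_cochain_of_in dy_cocycle_continuous)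

lemma edge_ext:
  assumes "subshift A" "L \<in> eq_cochains A 1" "L' \<in> eq_cochains A 1"
    and "\<And>j a. a \<in> A \<Longrightarrow> L (frag_of (0, {j}), a) = L' (frag_of (0, {j}), a)"
  shows "L = L'"
  using assms by (intro eq_cochain_ext[OF assms(2,3,1)]) (auto simp: card_1_singleton_iff)

text \<open>The boundary of a square gives the identity for \<open>i < j\<close>. Exchanging
  \<open>i\<close> and \<open>j\<close> exchanges its two sides, and it is trivial for
  \<open>i = j\<close>, so the order on directions drops out.\<close>

lemma edge_cocycle_iff:
  fixes A :: "('n::{finite,linorder}, 'a) config set"
  assumes A: "subshift A" and L: "L \<in> eq_cochains A 1"
  shows "eq_coboundary 1 L = (\<lambda>p. 0) \<longleftrightarrow> (\<forall>a\<in>A. \<forall>i j.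
    L (frag_of (0, {j}), shift (axis i 1) a) - L (frag_of (0, {j}), a)
    = L (frag_of (0, {i}), shift (axis j 1) a) - L (frag_of (0, {i}), a))" (is "_ \<longleftrightarrow> ?R")
proof
  assume eq: "eq_coboundary 1 L = (\<lambda>p. 0)"
  have *: "L (frag_of (0, {j}), shift (axis i 1) a) - L (frag_of (0, {j}), a)
    = L (frag_of (0, {i}), shift (axis j 1) a) - L (frag_of (0, {i}), a)" if "a \<in> A" "i < j" for a i j
    using eq_coboundary_square[OF L that] eq by simp
  show ?R
  proof (intro ballI allI)
    fix a i j assume a: "a \<in> A"
    show "L (frag_of (0, {j}), shift (axis i 1) a) - L (frag_of (0, {j}), a)
      = L (frag_of (0, {i}), shift (axis j 1) a) - L (frag_of (0, {i}), a)"
      using *[OF a, of i j] *[OF a, of j i] by (cases i j rule: linorder_cases) auto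
  qed
next
  assume R: ?R
  have in2: "eq_coboundary 1 L \<in> eq_cochains A 2"
    using eq_coboundary_in[OF A L] by (simp add: numeral_2_eq_2)
  show "eq_coboundary 1 L = (\<lambda>p. 0)"
  proof (rule eq_cochain_ext[OF in2 eq_cochains_zero A])
    fix J :: "'n set" and a assume "card J = 2" and a: "a \<in> A"
    then obtain i j where "J = {i, j}" "i \<noteq> j" by (auto simp: card_2_iff)
    then obtain i j where J: "J = {i, j}" "i < j"
      by (metis insert_commute linorder_less_linear)
    show "eq_coboundary 1 L (frag_of (0, J), a) = 0"
      using R a by (simp add: J eq_coboundary_square[OF L a J(2)] del: One_nat_def)
  qed
qed

text \<open>The generators \<open>axis i 1\<close> and \<open>axis j 1\<close> commute: expanding
  the value on their sum in both orders gives the identity for squares.\<close>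

lemma edge_cochain_cocycle:
  fixes A :: "('n::{finite,linorder}, 'a) config set"
  assumes A: "subshift A" and C: "C \<in> dy_cocycles A"
  shows "eq_coboundary 1 (edge_cochain A C) = (\<lambda>p. 0)"
  unfolding edge_cocycle_iff[OF A edge_cochain_in[OF A C]]
proof (intro ballI allI)
  fix a i j assume a: "a \<in> A"
  have "C (axis j 1 + axis i 1, a) = C (axis i 1 + axis j 1, a)" by (simp add: add.commute)
  then show "edge_cochain A C (frag_of (0, {j}), shift (axis i 1) a) - edge_cochain A C (frag_of (0, {j}), a)
      = edge_cochain A C (frag_of (0, {i}), shift (axis j 1) a) - edge_cochain A C (frag_of (0, {i}), a)"
    using dy_cocycle_add[OF C a, of "axis j 1" "axis i 1"] dy_cocycle_add[OF C a, of "axis i 1" "axis j 1"]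
    by (simp add: edge_cochain_cell a shift_in[OF A a] algebra_simps)
qed

text \<open>Along the orbit of a fixed \<open>a\<close> the edge values form a closed lattice
  1-form, and its potential, normalised at 0, gives the desired cocycle. Potentials are chosen for
  each \<open>a\<close> separately, so continuity in \<open>a\<close> and the cocycle identity must
  be recovered from the increments.\<close>

lemma edge_cochain_surj:
  fixes A :: "('n::{finite,linorder}, 'a) config set"
    and L :: "('n, 'a, 'g::topological_ab_group_add) eq_cochain"
  assumes A: "subshift A" and L: "L \<in> eq_cochains A 1" and closed: "eq_coboundary 1 L = (\<lambda>p. 0)"
  shows "\<exists>C\<in>dy_cocycles A. edge_cochain A C = L"
proof -
  define c where "c j a = L (frag_of (0, {j}), a)" for j a
  have c: "c j (shift (axis i 1) a) - c j a = c i (shift (axis j 1) a) - c i a" if "a \<in> A" for a i j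
    using closed that unfolding edge_cocycle_iff[OF A L] c_def by blast
  have "\<exists>f. \<forall>j z. f (z + axis j 1) - f z = c j (shift z a)" if a: "a \<in> A" for a
    using c[OF shift_in[OF A a]] by (intro lattice_potential) (simp add: shift_shift add.commute)
  then obtain f where f: "\<And>a j z. a \<in> A \<Longrightarrow> f a (z + axis j 1) - f a z = c j (shift z a)"
    by metis
  \<comment> \<open>Subtracting the value at 0 removes the arbitrary constant of each chosen
    potential.\<close>
  define C where "C = (\<lambda>(z, a). if a \<in> A then f a z - f a 0 else 0)"
  have C0: "C (0, a) = 0" for a by (simp add: C_def)
  have Cadd: "C (z + axis j 1, a) = C (z, a) + c j (shift z a)" if "a \<in> A" for z j a
    using f[OF that, of z j] that by (simp add: C_def algebra_simps)
  have Cdiff: "C (z - axis j 1, a) = C (z, a) - c j (shift (z - axis j 1) a)" if "a \<in> A" for z j a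
    using Cadd[OF that, of "z - axis j 1" j] by (simp add: algebra_simps)
  have cont: "continuous_map (subtopology config_topology A) euclidean (\<lambda>a. c j (shift z a))" for j z
  proof -
    have "continuous_map (subtopology config_topology A) euclidean (c j)"
      unfolding c_def by (rule eq_cochain_continuous[OF L]) simp
    then show ?thesis
      using continuous_map_compose[OF continuous_map_shift[OF A, of z]] by (fastforce simp: o_def)
  qed
  have C: "C \<in> dy_cocycles A"
  proof (rule dy_cocycleI)
    show "continuous_map (subtopology config_topology A) euclidean (\<lambda>a. C (z, a))" for z
    proof (induction z rule: lattice_induct)
      case (add z j)
      \<comment> \<open>The sum is written as a difference because continuity has been established
        for differences.\<close>
      have "continuous_map (subtopology config_topology A) euclidean (\<lambda>a. C (z, a) - (0 - c j (shift z a)))"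
        by (intro continuous_map_group_diff add cont) simp
      then show ?case by (rule continuous_map_eq) (simp add: Cadd)
    next
      case (diff z j)
      have "continuous_map (subtopology config_topology A) euclidean
          (\<lambda>a. C (z, a) - c j (shift (z - axis j 1) a))"
        by (intro continuous_map_group_diff diff cont)
      then show ?case by (rule continuous_map_eq) (simp add: Cdiff)
    qed (simp add: C0)
    \<comment> \<open>As functions of \<open>y\<close> both sides agree at 0 and have the same
      increment in direction \<open>j\<close>, namely \<open>c j\<close> at the configuration
      shifted by \<open>y + z\<close>.\<close>
    have "\<forall>a\<in>A. \<forall>z. C (y + z, a) = C (y, shift z a) + C (z, a)" for y
    proof (induction y rule: lattice_induct)
      case (add y j)
      show ?case
      proof (intro ballI allI)
        fix a z assume a: "a \<in> A"
        have "C (y + z + axis j 1, a) = C (y, shift z a) + C (z, a) + c j (shift (y + z) a)"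
          using add a by (simp add: Cadd)
        then show "C (y + axis j 1 + z, a) = C (y + axis j 1, shift z a) + C (z, a)"
          by (simp add: Cadd shift_in[OF A a] shift_shift algebra_simps)
      qed
    next
      case (diff y j)
      show ?case
      proof (intro ballI allI)
        fix a z assume a: "a \<in> A"
        have "C (y + z - axis j 1, a) = C (y, shift z a) + C (z, a) - c j (shift (y + z - axis j 1) a)"
          using diff a by (simp add: Cdiff)
        then show "C (y - axis j 1 + z, a) = C (y - axis j 1, shift z a) + C (z, a)"
          by (simp add: Cdiff shift_in[OF A a] shift_shift algebra_simps)
      qed
    qed (simp add: C0)
    then show "C (y + z, a) = C (y, shift z a) + C (z, a)" if "a \<in> A" for y z a using that by blast
  qed (simp add: C_def)
  have "edge_cochain A C = L"
  proof (rule edge_ext[OF A edge_cochain_in[OF A C] L])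
    fix j a assume a: "a \<in> A"
    show "edge_cochain A C (frag_of (0, {j}), a) = L (frag_of (0, {j}), a)"
      using Cadd[OF a, of 0 j] a by (simp add: edge_cochain_cell C0 c_def)
  qed
  then show ?thesis using C by blast
qed

text \<open>A 0-cochain is the same as a continuous function \<open>B\<close> of the configuration,
  its value at the vertex 0, and its coboundary on edges at the origin is the increment of
  \<open>B\<close>. Comparing values on generators then suffices in both directions.\<close>

lemma edge_cochain_coboundary_iff:
  fixes A :: "('n::{finite,linorder}, 'a) config set"
    and C :: "('n, 'a, 'g::topological_ab_group_add) dy_cochain"
  assumes A: "subshift A" and C: "C \<in> dy_cocycles A"
  shows "edge_cochain A C \<in> eq_coboundary 0 ` eq_cochains A 0 \<longleftrightarrow> C \<in> dy_coboundaries A"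
proof
  assume "edge_cochain A C \<in> eq_coboundary 0 ` eq_cochains A 0"
  then obtain b where b: "b \<in> eq_cochains A 0" "edge_cochain A C = eq_coboundary 0 b" by blast
  define B where "B a = b (frag_of (0, {}), a)" for a
  have B: "continuous_map (subtopology config_topology A) euclidean B"
    unfolding B_def by (rule eq_cochain_continuous[OF b(1)]) simp
  have "C = (\<lambda>(z, a). if a \<in> A then B (shift z a) - B a else 0)"
  proof (rule dy_cocycle_ext[OF A C dy_coboundary_cocycle[OF A B]])
    fix j a assume a: "a \<in> A"
    have "C (axis j 1, a) = eq_coboundary 0 b (frag_of (0, {j}), a)"
      using b(2) edge_cochain_cell[OF a, of C j] by simp
    then show "C (axis j 1, a) = (\<lambda>(z, a). if a \<in> A then B (shift z a) - B a else 0) (axis j 1, a)"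
      using a by (simp add: eq_coboundary_edge[OF b(1) a] B_def)
  qed
  then show "C \<in> dy_coboundaries A" using B unfolding dy_coboundaries_def by blast
next
  assume "C \<in> dy_coboundaries A"
  then obtain B where B: "continuous_map (subtopology config_topology A) euclidean B"
    "C = (\<lambda>(z, a). if a \<in> A then B (shift z a) - B a else 0)"
    unfolding dy_coboundaries_def by blast
  define b where "b = eq_cochain_of A 0 (\<lambda>J. B)"
  have b: "b \<in> eq_cochains A 0" unfolding b_def by (rule eq_cochain_of_in[OF A B(1)])
  have "edge_cochain A C = eq_coboundary 0 b"
  proof (rule edge_ext[OF A edge_cochain_in[OF A C]])
    show "eq_coboundary 0 b \<in> eq_cochains A 1" using eq_coboundary_in[OF A b] by simp
    fix j a assume a: "a \<in> A"
    then show "edge_cochain A C (frag_of (0, {j}), a) = eq_coboundary 0 b (frag_of (0, {j}), a)"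
      using shift_in[OF A a] by (simp add: edge_cochain_cell eq_coboundary_edge[OF b a] B(2)) (simp add: b_def)
  qed
  then show "edge_cochain A C \<in> eq_coboundary 0 ` eq_cochains A 0" using b by blast
qed

lemma edge_cochain_add:
  assumes A: "subshift A" and C: "C \<in> dy_cocycles A" "C' \<in> dy_cocycles A"
  shows "edge_cochain A (\<lambda>p. C p + C' p) = (\<lambda>p. edge_cochain A C p + edge_cochain A C' p)"
proof -
  have sum: "(\<lambda>p. C p + C' p) \<in> dy_cocycles A"
    using monoid.m_closed[OF group.is_monoid[OF comm_group.axioms(2)[OF comm_group_dy_cocycles]], of C A C'] C
    by simp
  have "(\<lambda>p. edge_cochain A C p - (0 - edge_cochain A C' p)) \<in> eq_cochains A 1"
    by (intro eq_cochains_diff[OF A] edge_cochain_in[OF A] eq_cochains_zero C)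
  then have "(\<lambda>p. edge_cochain A C p + edge_cochain A C' p) \<in> eq_cochains A 1" by simp
  then show ?thesis
    by (rule edge_ext[OF A edge_cochain_in[OF A sum]]) (simp add: edge_cochain_cell)
qed

text \<open>This is the first isomorphism theorem for the map sending a dynamical cocycle to the
  class of its edge cochain: it is onto, and its kernel consists of the dynamical coboundaries. The
  resulting isomorphism is inverted at the end.\<close>

lemma eq_cohomology_iso_dy_cohomology:
  fixes A :: "('n::{finite,linorder}, 'a) config set"
  assumes A: "subshift A"
  shows "(eq_cohomology A 1 :: ('n, 'a, 'g::topological_ab_group_add) eq_cochain set monoid)
    \<cong> (dy_cohomology A :: ('n, 'a, 'g) dy_cochain set monoid)"
proof -
  interpret E: cochain_complex "\<lambda>d. pointwise_group (eq_cochains A d :: ('n, 'a, 'g) eq_cochain set)" eq_coboundary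
    by (rule eq_cochain_complex[OF A])
  let ?D = "pointwise_group (dy_cocycles A :: ('n, 'a, 'g) dy_cochain set)"
  let ?H = "cohomology (\<lambda>d. pointwise_group (eq_cochains A d :: ('n, 'a, 'g) eq_cochain set)) eq_coboundary 1"
  let ?Q = "\<lambda>C. E.cls 1 (edge_cochain A C)"
  have coc: "edge_cochain A C \<in> cocycles (\<lambda>d. pointwise_group (eq_cochains A d)) eq_coboundary 1"
    if "C \<in> dy_cocycles A" for C :: "('n, 'a, 'g) dy_cochain"
    using edge_cochain_in[OF A that] edge_cochain_cocycle[OF A that] by (simp add: E.cocycles_iff)
  have hom: "?Q \<in> Group.hom ?D ?H"
  proof (rule homI)
    show "?Q C \<in> carrier ?H" if "C \<in> carrier ?D" for C
      using coc that by (simp only: E.carrier_cohomology pointwise_group_simps) blast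
    show "?Q (C \<otimes>\<^bsub>?D\<^esub> C') = ?Q C \<otimes>\<^bsub>?H\<^esub> ?Q C'" if "C \<in> carrier ?D" "C' \<in> carrier ?D" for C C'
      using hom_mult[OF E.cls_hom, of "edge_cochain A C" 1 "edge_cochain A C'"] coc that
      by (simp add: edge_cochain_add[OF A])
  qed
  have D: "group ?D" by (rule comm_group.axioms(2)[OF comm_group_dy_cocycles])
  interpret Q: group_hom ?D ?H ?Q
    using D E.group_cohomology hom by (simp add: group_hom_def group_hom_axioms_def)
  have kernel: "kernel ?D ?H ?Q = dy_coboundaries A"
  proof -
    have "?Q C = \<one>\<^bsub>?H\<^esub> \<longleftrightarrow> C \<in> dy_coboundaries A" if C: "C \<in> dy_cocycles A" for C
    proof -
      \<comment> \<open>The neutral class is represented by the zero cochain, so membership in the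
        kernel becomes a statement about coboundaries.\<close>
      have "\<one>\<^bsub>?H\<^esub> = E.cls 1 (\<lambda>p. 0)"
        using group_hom.hom_one[of "(pointwise_group (eq_cochains A 1))\<lparr>carrier := cocycles
          (\<lambda>d. pointwise_group (eq_cochains A d)) eq_coboundary 1\<rparr>" ?H "E.cls 1"]
          E.cls_hom[of 1] E.cocycle_group[of 1] E.group_cohomology[of 1]
        by (simp add: group_hom_def group_hom_axioms_def comm_group_def)
      then have "?Q C = \<one>\<^bsub>?H\<^esub> \<longleftrightarrow> ?Q C = E.cls 1 (\<lambda>p. 0)" by simp
      also have "\<dots> \<longleftrightarrow> edge_cochain A C \<in> coboundaries (\<lambda>d. pointwise_group (eq_cochains A d)) eq_coboundary 1"
        using E.cls_eq_iff[of "edge_cochain A C" 1 "\<lambda>p. 0"] edge_cochain_in[OF A C]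
          monoid.inv_one[OF group.is_monoid[OF E.group[of 1]]]
          monoid.r_one[OF group.is_monoid[OF E.group[of 1]], of "edge_cochain A C"]
        by (simp add: eq_cochains_zero del: One_nat_def)
      also have "\<dots> \<longleftrightarrow> C \<in> dy_coboundaries A"
        using edge_cochain_coboundary_iff[OF A C] E.coboundaries_Suc[of 0] by simp
      finally show ?thesis .
    qed
    moreover have "dy_coboundaries A \<subseteq> dy_cocycles A"
      unfolding dy_coboundaries_def using dy_coboundary_cocycle[OF A] by blast
    ultimately show ?thesis by (auto simp: kernel_def)
  qed
  have surj: "?Q ` carrier ?D = carrier ?H"
  proof (intro equalityI subsetI)
    fix X assume "X \<in> carrier ?H"
    then obtain L where L: "L \<in> eq_cochains A 1" "eq_coboundary 1 L = (\<lambda>p. 0)" "X = E.cls 1 L"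
      by (auto simp: E.carrier_cohomology E.cocycles_iff)
    then show "X \<in> ?Q ` carrier ?D" using edge_cochain_surj[OF A L(1,2)] by auto
  qed (use Q.hom_closed in auto)
  have iso: "?D Mod dy_coboundaries A \<cong> ?H"
    using Q.FactGroup_iso[OF surj] unfolding kernel .
  have "group (?D Mod dy_coboundaries A)"
    using normal.factorgroup_is_group[OF Q.normal_kernel] unfolding kernel .
  then show ?thesis
    unfolding dy_cohomology_def eq_cohomology_def by (rule group.iso_sym[OF _ iso])
qed

lemma loc_cohomology_discrete:
  fixes A :: "('n::{finite,linorder}, 'a::finite) config set"
  assumes "subshift A" and "\<And>S :: 'g::topological_ab_group_add set. open S"
  shows "(loc_cohomology A :: nat \<Rightarrow> ('n, 'a, 'g) eq_cochain set monoid) = eq_cohomology A"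
proof -
  have "(loc_complex A :: nat \<Rightarrow> ('n, 'a, 'g) eq_cochain monoid) = (\<lambda>d. pointwise_group (eq_cochains A d))"
    by (simp add: loc_complex_def fun_eq_iff loc_cochains_discrete[OF assms])
  then show ?thesis by (simp add: loc_cohomology_def eq_cohomology_def)
qed

theorem theorem4p11:
  fixes A :: "('n::{finite,linorder}, 'a::finite) config set"
    and R d :: nat
  assumes "sft R A"
    and "d \<le> CARD('n)"
  shows
    "(comparison A d :: ('n, 'a, 'g::topological_ab_group_add) inv_class \<Rightarrow> _)
        \<in> iso (inv_cohomology R A d) (loc_cohomology A d) \<and>
     (\<forall>h :: 'g \<Rightarrow> 'h::topological_ab_group_add. coefficient_hom h \<longrightarrow>
        (\<forall>X\<in>carrier (inv_cohomology R A d).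
           comparison A d (inv_coeff_map R A d h X) = loc_coeff_map A d h (comparison A d X))) \<and>
     (\<forall>(A' :: ('n, 'b::finite) config set) R' F s.
        sft R' A' \<and> subshift_morphism A A' F \<and> rule_radius A F s \<and> R \<le> R' + s \<longrightarrow>
        (\<forall>X\<in>carrier (inv_cohomology R' A' d :: ('n, 'b, 'g) inv_class monoid).
           comparison A d (inv_pullback R A A' d F s X) = loc_pullback A d F (comparison A' d X))) \<and>
     ((\<forall>S :: 'g set. open S) \<longrightarrow>
        (loc_cohomology A d :: ('n, 'a, 'g) eq_cochain set monoid) = eq_cohomology A d \<and>
        (inv_cohomology R A d :: ('n, 'a, 'g) inv_class monoid)
          \<cong> (eq_cohomology A d :: ('n, 'a, 'g) eq_cochain set monoid) \<and>
        (inv_cohomology R A 1 :: ('n, 'a, 'g) inv_class monoid)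
          \<cong> (dy_cohomology A :: ('n, 'a, 'g) dy_cochain set monoid))"
proof (intro conjI allI impI ballI)
  have A: "subshift A" using assms(1) by (simp add: sft_def)
  \<comment> \<open>The degree is generalised, because degree one is used at the end along with the
    given \<open>d\<close>.\<close>
  show iso: "(comparison A d :: ('n, 'a, 'g) inv_class \<Rightarrow> _) \<in> iso (inv_cohomology R A d) (loc_cohomology A d)" for d
    by (rule comparison_iso[OF A])
  show "comparison A d (inv_coeff_map R A d h X) = loc_coeff_map A d h (comparison A d X)"
    if "coefficient_hom h" "X \<in> carrier (inv_cohomology R A d)"
    for h :: "'g \<Rightarrow> 'h" and X :: "('n, 'a, 'g) inv_class"
    by (rule comparison_coeff[OF A that])
  show "comparison A d (inv_pullback R A A' d F s X) = loc_pullback A d F (comparison A' d X)"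
    if "sft R' A' \<and> subshift_morphism A A' F \<and> rule_radius A F s \<and> R \<le> R' + s"
      and "X \<in> carrier (inv_cohomology R' A' d)"
    for A' :: "('n, 'b) config set" and R' F s and X :: "('n, 'b, 'g) inv_class"
  proof -
    interpret local_morphism A A' F s
      using that(1) A by (simp add: local_morphism_def sft_def)
    show ?thesis using that by (intro comparison_pullback) auto
  qed
  assume discrete: "\<forall>S :: 'g set. open S"
  have loc: "(loc_cohomology A :: nat \<Rightarrow> ('n, 'a, 'g) eq_cochain set monoid) = eq_cohomology A"
    by (rule loc_cohomology_discrete[OF A]) (use discrete in blast)
  show "(loc_cohomology A d :: ('n, 'a, 'g) eq_cochain set monoid) = eq_cohomology A d"
    by (simp add: loc)
  have inv: "(inv_cohomology R A d :: ('n, 'a, 'g) inv_class monoid)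
      \<cong> (eq_cohomology A d :: ('n, 'a, 'g) eq_cochain set monoid)" for d
    using is_isoI[OF iso[of d]] by (simp add: loc)
  then show "(inv_cohomology R A d :: ('n, 'a, 'g) inv_class monoid)
      \<cong> (eq_cohomology A d :: ('n, 'a, 'g) eq_cochain set monoid)" .
  show "(inv_cohomology R A 1 :: ('n, 'a, 'g) inv_class monoid)
      \<cong> (dy_cohomology A :: ('n, 'a, 'g) dy_cochain set monoid)"
    using inv[of 1] eq_cohomology_iso_dy_cohomology[OF A] by (rule iso_trans)
qed

end
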